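(* Let $G=G_{2(2)}$ be the simply connected Lie group whose Lie algebra $\mathfrak{g}$ is the split real form of type $G_2$, $L\subset G$ the Iwasawa subgroup (the connected Lie subgroup with Lie algebra $\mathfrak{l}$), and $S=G/G_{ev}=G_{2(2)}/(SL(2)\cdot SL(2))$. Then $L$ acts with at least two open orbits on $S$.
   Context: Lie algebra $\mathfrak{g}$: $V=\mathbb{R}^3$ with standard basis $(e_1,e_2,e_3)$, dual basis $(e^1,e^2,e^3)$ of $V^*$, and $e_i^j=e_i\otimes e^j\in\mathfrak{gl}(V)$. As a vector space $\mathfrak{g}=V\oplus\mathfrak{sl}(V)\oplus V^*$; $\mathfrak{sl}(V)$ is a subalgebra acting on $V$ and $V^*$ by the standard and the dual representation, and the remaining brackets are, for $x,y\in V$, $\xi,\eta\in V^*$, $[x,y]=-2\,x\times y$, $[\xi,\eta]=2\,\xi\times\eta$, $[x,\xi]=3x\otimes\xi-\xi(x)\mathrm{Id}\in\mathfrak{sl}(V)$, where $x\times y=\det(x,y,\cdot)\in V^*$ and $\xi\times\eta=\det^{-1}(\xi,\eta,\cdot)\in V^{**}=V$ (so $e_1\times e_2=e^3$, $e^1\times e^2=e_3$, and cyclically). $\mathfrak{a}=\{\sum_i\lambda_ie_i^i\mid\sum_i\lambda_i=0\}$. $\mathfrak{g}_{ev}=\mathfrak{a}+\mathrm{span}\{e_3,e^3,e_1^2,e_2^1\}\cong\mathfrak{sl}_2\oplus\mathfrak{sl}_2$, $\mathfrak{l}=\mathfrak{a}+\mathrm{span}\{e_1,e^2,e^3,e_1^2,e_1^3,e_2^3\}$.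 $G_{ev}\subset G$ (also written $SL(2)\cdot SL(2)$) is the connected Lie subgroup with Lie algebra $\mathfrak{g}_{ev}$. *)

theory Defs
  imports
    "HOL-Analysis.Analysis"
    "HOL-Algebra.Group_Action"
    "HOL-Algebra.Left_Coset"
begin

section \<open>Smooth maps between open subsets of Euclidean spaces\<close>

text \<open>Used for open \<^term>\<open>S\<close> only. Since all derivatives are taken in fixed directions, the
  recursion stays within one function type; for a finite-dimensional domain this is the usual class
  of \<open>k\<close> times continuously differentiable maps.\<close>

primrec Ck_on :: "nat \<Rightarrow> 'e::euclidean_space set \<Rightarrow> ('e \<Rightarrow> 'f::euclidean_space) \<Rightarrow> bool" where
  "Ck_on 0 S f \<longleftrightarrow> continuous_on S f"
| "Ck_on (Suc k) S f \<longleftrightarrow>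
     (\<forall>x\<in>S. f differentiable (at x)) \<and> (\<forall>v. Ck_on k S (\<lambda>x. frechet_derivative f (at x) v))"

definition smooth_on :: "'e::euclidean_space set \<Rightarrow> ('e \<Rightarrow> 'f::euclidean_space) \<Rightarrow> bool" where
  "smooth_on S f \<longleftrightarrow> (\<forall>k. Ck_on k S f)"


section \<open>Smooth manifolds\<close>

type_synonym ('a, 'e) chart = "'a set \<times> ('a \<Rightarrow> 'e)"

abbreviation chart_dom :: "('a, 'e) chart \<Rightarrow> 'a set" where
  "chart_dom c \<equiv> fst c"

abbreviation chart_inv :: "('a, 'e) chart \<Rightarrow> 'e \<Rightarrow> 'a" where
  "chart_inv c \<equiv> inv_into (fst c) (snd c)"

definition is_chart :: "'a topology \<Rightarrow> ('a, 'e::euclidean_space) chart \<Rightarrow> bool" where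
  "is_chart X c \<longleftrightarrow> openin X (chart_dom c) \<and> open (snd c ` chart_dom c) \<and>
     homeomorphic_map (subtopology X (chart_dom c)) (top_of_set (snd c ` chart_dom c)) (snd c)"

definition smooth_atlas :: "'a topology \<Rightarrow> ('a, 'e::euclidean_space) chart set \<Rightarrow> bool" where
  "smooth_atlas X A \<longleftrightarrow> (\<forall>c\<in>A. is_chart X c) \<and> (\<Union>c\<in>A. chart_dom c) = topspace X \<and>
     (\<forall>c\<in>A. \<forall>d\<in>A. smooth_on (snd c ` (chart_dom c \<inter> chart_dom d)) (snd d \<circ> chart_inv c))"

definition smooth_manifold :: "'a topology \<Rightarrow> ('a, 'e::euclidean_space) chart set \<Rightarrow> bool" where
  "smooth_manifold X A \<longleftrightarrow> Hausdorff_space X \<and> second_countable X \<and> smooth_atlas X A"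

definition smooth_map ::
  "'a topology \<Rightarrow> ('a, 'e::euclidean_space) chart set \<Rightarrow>
   'b topology \<Rightarrow> ('b, 'f::euclidean_space) chart set \<Rightarrow> ('a \<Rightarrow> 'b) \<Rightarrow> bool" where
  "smooth_map X A Y B f \<longleftrightarrow> continuous_map X Y f \<and>
     (\<forall>c\<in>A. \<forall>d\<in>B. smooth_on (snd c ` {x \<in> chart_dom c. f x \<in> chart_dom d})
                            (snd d \<circ> f \<circ> chart_inv c))"

definition prod_atlas ::
  "('a, 'e::euclidean_space) chart set \<Rightarrow> ('b, 'f::euclidean_space) chart set \<Rightarrow>
   ('a \<times> 'b, 'e \<times> 'f) chart set" where
  "prod_atlas A B =
     {(chart_dom c \<times> chart_dom d, map_prod (snd c) (snd d)) | c d. c \<in> A \<and> d \<in> B}"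

text \<open>The differential of \<^term>\<open>f\<close> at \<^term>\<open>p\<close>, with both tangent spaces identified with the model
  spaces by means of a chart \<^term>\<open>c\<close> around \<^term>\<open>p\<close> and a chart \<^term>\<open>d\<close> around
  \<^term>\<open>f p\<close>.\<close>

definition differential_in ::
  "('a, 'e::euclidean_space) chart \<Rightarrow> ('b, 'f::euclidean_space) chart \<Rightarrow>
   ('a \<Rightarrow> 'b) \<Rightarrow> 'a \<Rightarrow> 'e \<Rightarrow> 'f" where
  "differential_in c d f p = frechet_derivative (snd d \<circ> f \<circ> chart_inv c) (at (snd c p))"

definition immersion ::
  "'a topology \<Rightarrow> ('a, 'e::euclidean_space) chart set \<Rightarrow>
   'b topology \<Rightarrow> ('b, 'f::euclidean_space) chart set \<Rightarrow> ('a \<Rightarrow> 'b) \<Rightarrow> bool" where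
  "immersion X A Y B f \<longleftrightarrow> smooth_map X A Y B f \<and>
     (\<forall>p\<in>topspace X. \<forall>c\<in>A. \<forall>d\<in>B.
        p \<in> chart_dom c \<and> f p \<in> chart_dom d \<longrightarrow> inj (differential_in c d f p))"

text \<open>Analogue of \<^const>\<open>simply_connected\<close> for abstract topologies.\<close>

definition simply_connected_space :: "'a topology \<Rightarrow> bool" where
  "simply_connected_space X \<longleftrightarrow>
     (\<forall>p q. pathin X p \<and> p 1 = p 0 \<and> pathin X q \<and> q 1 = q 0 \<longrightarrow>
        homotopic_with (\<lambda>r. r 1 = r 0) (top_of_set {0..1}) X p q)"


section \<open>Lie groups, their Lie algebras and Lie subgroups\<close>

definition lie_group ::
  "('a, 'm) monoid_scheme \<Rightarrow> 'a topology \<Rightarrow> ('a, 'e::euclidean_space) chart set \<Rightarrow> bool" where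
  "lie_group G X A \<longleftrightarrow> group G \<and> topspace X = carrier G \<and> smooth_manifold X A \<and>
     smooth_map (prod_topology X X) (prod_atlas A A) X A (\<lambda>(x, y). x \<otimes>\<^bsub>G\<^esub> y) \<and>
     smooth_map X A X A (\<lambda>x. inv\<^bsub>G\<^esub> x)"

text \<open>The tangent space at the identity is identified with the model space by means of a chart
  \<^term>\<open>c\<close> around the identity. The left-invariant vector field with value \<^term>\<open>v\<close> at the
  identity is written in this chart, that is, as a map on the image of \<^term>\<open>c\<close>, by differentiating
  left translations; the bracket of two vector fields is taken in coordinates and then evaluated at
  the identity. For matrix groups this convention gives the commutator of matrices.\<close>

definition left_inv_field ::
  "('a, 'm) monoid_scheme \<Rightarrow> ('a, 'e::euclidean_space) chart \<Rightarrow> 'e \<Rightarrow> 'e \<Rightarrow> 'e" where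
  "left_inv_field G c v x = differential_in c c (\<lambda>g. chart_inv c x \<otimes>\<^bsub>G\<^esub> g) \<one>\<^bsub>G\<^esub> v"

definition vector_field_bracket ::
  "('e::euclidean_space \<Rightarrow> 'e) \<Rightarrow> ('e \<Rightarrow> 'e) \<Rightarrow> 'e \<Rightarrow> 'e" where
  "vector_field_bracket V W x =
     frechet_derivative W (at x) (V x) - frechet_derivative V (at x) (W x)"

definition lie_bracket ::
  "('a, 'm) monoid_scheme \<Rightarrow> ('a, 'e::euclidean_space) chart \<Rightarrow> 'e \<Rightarrow> 'e \<Rightarrow> 'e" where
  "lie_bracket G c v w =
     vector_field_bracket (left_inv_field G c v) (left_inv_field G c w) (snd c \<one>\<^bsub>G\<^esub>)"

text \<open>\<^term>\<open>\<theta>\<close> is an isomorphism from the Lie algebra with underlying subspace \<^term>\<open>\<gg>\<close> and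
  bracket \<^term>\<open>br\<close> onto the Lie algebra of \<^term>\<open>G\<close>. Values of \<^term>\<open>\<theta>\<close> outside
  \<^term>\<open>\<gg>\<close> are irrelevant: every linear map on \<^term>\<open>\<gg>\<close> extends to the ambient space.\<close>

definition lie_algebra_iso ::
  "'v::real_vector set \<Rightarrow> ('v \<Rightarrow> 'v \<Rightarrow> 'v) \<Rightarrow>
   ('a, 'm) monoid_scheme \<Rightarrow> ('a, 'e::euclidean_space) chart \<Rightarrow> ('v \<Rightarrow> 'e) \<Rightarrow> bool" where
  "lie_algebra_iso \<gg> br G c \<theta> \<longleftrightarrow> linear \<theta> \<and> bij_betw \<theta> \<gg> UNIV \<and>
     (\<forall>u\<in>\<gg>. \<forall>v\<in>\<gg>. \<theta> (br u v) = lie_bracket G c (\<theta> u) (\<theta> v))"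

text \<open>The topology and the smooth structure of a Lie subgroup are its own; they need not be
  inherited from \<^term>\<open>G\<close>.\<close>

definition lie_subgroup ::
  "('a, 'm) monoid_scheme \<Rightarrow> 'a topology \<Rightarrow> ('a, 'e::euclidean_space) chart set \<Rightarrow>
   'a set \<Rightarrow> 'a topology \<Rightarrow> ('a, 'f::euclidean_space) chart set \<Rightarrow> bool" where
  "lie_subgroup G X A H Y B \<longleftrightarrow> subgroup H G \<and> lie_group (G\<lparr>carrier := H\<rparr>) Y B \<and>
     immersion Y B X A (\<lambda>x. x)"

text \<open>\<^term>\<open>\<hh>\<close> is a subspace of the tangent space of \<^term>\<open>G\<close> at the identity, written in the
  chart \<^term>\<open>c\<close>.\<close>

definition connected_lie_subgroup_with_algebra ::
  "('a, 'm) monoid_scheme \<Rightarrow> 'a topology \<Rightarrow> ('a, 'e::euclidean_space) chart set \<Rightarrow>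
   ('a, 'e) chart \<Rightarrow> 'e set \<Rightarrow>
   'a set \<Rightarrow> 'a topology \<Rightarrow> ('a, 'f::euclidean_space) chart set \<Rightarrow> bool" where
  "connected_lie_subgroup_with_algebra G X A c \<hh> H Y B \<longleftrightarrow>
     lie_subgroup G X A H Y B \<and> connected_space Y \<and>
     (\<forall>d\<in>B. \<one>\<^bsub>G\<^esub> \<in> chart_dom d \<longrightarrow> range (differential_in d c (\<lambda>x. x) \<one>\<^bsub>G\<^esub>) = \<hh>)"


section \<open>Homogeneous spaces\<close>

definition coset_topology ::
  "('a, 'm) monoid_scheme \<Rightarrow> 'a topology \<Rightarrow> 'a set \<Rightarrow> 'a set topology" where
  "coset_topology G X H = topology (\<lambda>U. U \<subseteq> (\<lambda>x. x <#\<^bsub>G\<^esub> H) ` topspace X \<and>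
     openin X {x \<in> topspace X. x <#\<^bsub>G\<^esub> H \<in> U})"

lemma openin_coset_topology:
  "openin (coset_topology G X H) U \<longleftrightarrow> U \<subseteq> (\<lambda>x. x <#\<^bsub>G\<^esub> H) ` topspace X \<and>
     openin X {x \<in> topspace X. x <#\<^bsub>G\<^esub> H \<in> U}"
proof -
  let ?q = "\<lambda>x. x <#\<^bsub>G\<^esub> H"
  let ?P = "\<lambda>U. U \<subseteq> ?q ` topspace X \<and> openin X {x \<in> topspace X. ?q x \<in> U}"
  have "?P (S \<inter> T)" if "?P S" "?P T" for S T
  proof -
    have "{x \<in> topspace X. ?q x \<in> S \<inter> T} =
        {x \<in> topspace X. ?q x \<in> S} \<inter> {x \<in> topspace X. ?q x \<in> T}" by blast
    then show ?thesis using that by (auto intro: openin_Int)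
  qed
  moreover have "?P (\<Union>\<K>)" if "\<forall>K\<in>\<K>. ?P K" for \<K>
  proof -
    have "{x \<in> topspace X. ?q x \<in> \<Union>\<K>} = (\<Union>K\<in>\<K>. {x \<in> topspace X. ?q x \<in> K})" by blast
    moreover have "openin X (\<Union>K\<in>\<K>. {x \<in> topspace X. ?q x \<in> K})"
      using that by (intro openin_Union) auto
    ultimately show ?thesis using that by auto
  qed
  ultimately have "istopology ?P" by (simp add: istopology_def)
  then show ?thesis by (simp add: coset_topology_def topology_inverse')
qed

lemma topspace_coset_topology:
  "topspace (coset_topology G X H) = (\<lambda>x. x <#\<^bsub>G\<^esub> H) ` topspace X"
proof
  show "topspace (coset_topology G X H) \<subseteq> (\<lambda>x. x <#\<^bsub>G\<^esub> H) ` topspace X"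
    using openin_topspace[of "coset_topology G X H"] unfolding openin_coset_topology by blast
  have "{x \<in> topspace X. x <#\<^bsub>G\<^esub> H \<in> (\<lambda>x. x <#\<^bsub>G\<^esub> H) ` topspace X} = topspace X" by blast
  then show "(\<lambda>x. x <#\<^bsub>G\<^esub> H) ` topspace X \<subseteq> topspace (coset_topology G X H)"
    by (intro openin_subset) (simp add: openin_coset_topology)
qed

lemma quotient_map_coset_topology:
  "quotient_map X (coset_topology G X H) (\<lambda>x. x <#\<^bsub>G\<^esub> H)"
  by (simp add: quotient_map_def topspace_coset_topology openin_coset_topology)


section \<open>The split real form of the Lie algebra of type G2\<close>

text \<open>A triple \<open>(x, A, \<xi>)\<close> stands for \<open>x + A + \<xi>\<close> in \<open>V \<oplus> sl(V) \<oplus> V*\<close>, where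
  covectors are given by their coordinates in the dual basis; both \<open>x \<times> y\<close> and
  \<open>\<xi> \<times> \<eta>\<close> are then \<^const>\<open>cross3\<close>, and \<open>\<xi>(x)\<close> is the inner product. The dual
  representation of \<open>A\<close> sends \<open>\<xi>\<close> to \<open>- \<xi> \<circ> A\<close>.\<close>

type_synonym g2_vec = "(real^3) \<times> (real^3^3) \<times> (real^3)"

definition tensor3 :: "real^3 \<Rightarrow> real^3 \<Rightarrow> real^3^3" where
  "tensor3 x \<xi> = (\<chi> i j. x $ i * \<xi> $ j)"

definition g2 :: "g2_vec set" where
  "g2 = {(x, A, \<xi>). trace A = 0}"

definition g2_mixed :: "real^3 \<Rightarrow> real^3 \<Rightarrow> real^3^3" where
  "g2_mixed x \<xi> = 3 *\<^sub>R tensor3 x \<xi> - (\<xi> \<bullet> x) *\<^sub>R mat 1"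

definition g2_bracket :: "g2_vec \<Rightarrow> g2_vec \<Rightarrow> g2_vec" where
  "g2_bracket = (\<lambda>(x, A, \<xi>) (y, B, \<eta>).
     (A *v y - B *v x + 2 *\<^sub>R cross3 \<xi> \<eta>,
      A ** B - B ** A + g2_mixed x \<eta> - g2_mixed y \<xi>,
      - (\<eta> v* A) + \<xi> v* B - 2 *\<^sub>R cross3 x y))"

definition e_low :: "3 \<Rightarrow> g2_vec" where
  "e_low i = (axis i 1, 0, 0)"

definition e_up :: "3 \<Rightarrow> g2_vec" where
  "e_up i = (0, 0, axis i 1)"

text \<open>\<open>e_mix i j\<close> is \<open>e\<^sub>i \<otimes> e\<^sup>j\<close>, with lower index \<open>i\<close> and upper index \<open>j\<close>.\<close>

definition e_mix :: "3 \<Rightarrow> 3 \<Rightarrow> g2_vec" where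
  "e_mix i j = (0, tensor3 (axis i 1) (axis j 1), 0)"

definition g2_a :: "g2_vec set" where
  "g2_a = {(\<Sum>i\<in>UNIV. t i *\<^sub>R e_mix i i) | t. (\<Sum>i\<in>UNIV. t i) = 0}"

definition g2_ev :: "g2_vec set" where
  "g2_ev = {u + v | u v. u \<in> g2_a \<and> v \<in> span {e_low 3, e_up 3, e_mix 1 2, e_mix 2 1}}"

definition g2_l :: "g2_vec set" where
  "g2_l = {u + v | u v. u \<in> g2_a \<and>
     v \<in> span {e_low 1, e_up 2, e_up 3, e_mix 1 2, e_mix 1 3, e_mix 2 3}}"

end

theory Submission
  imports Defs
begin

text \<open>Let \<open>v\<close> be a root vector for the highest root \<open>e\<^sub>1\<^sup>3\<close>, and let \<open>Q\<close> be the
  quadratic form on the Lie algebra given by the Killing form of one of the two simple ideals of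
  \<open>g\<^sub>e\<^sub>v\<close>, extended by zero. Since \<open>L\<close> is connected, \<open>Ad l\<close> multiplies \<open>v\<close> by a
  positive number, and \<open>Q\<close> is invariant under \<open>Ad h\<close> for \<open>h\<close> in \<open>G\<^sub>e\<^sub>v\<close>. So the sign of
  \<open>Q (Ad (k\<inverse>) v)\<close> depends only on the \<open>L\<close>-orbit of the coset of \<open>k\<close>. That orbit is open as
  soon as \<open>Ad (k\<inverse>) l + g\<^sub>e\<^sub>v\<close> is everything, by the open mapping property of submersions.
  Both conditions are open in \<open>Ad (k\<inverse>)\<close>, hence it is enough to find operators with the two
  signs in the closure of \<open>Ad G\<close>. This closure contains \<open>exp (ad x)\<close> for all \<open>x\<close>, and the
  operators \<open>exp (ad e\<^sub>3\<^sup>1) exp (ad e\<^sup>1)\<close> and \<open>exp (ad e\<^sub>3\<^sup>2) exp (ad e\<^sup>1)\<close> give the values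
  1 and -4 of \<open>Q\<close>. In this way neither the exponential map of \<open>G\<close> nor any
  representation besides the adjoint one is needed.\<close>

section \<open>Maps of class \<open>C\<^sup>k\<close>\<close>

text \<open>Why Ad of the inverse: for a point \<open>l k h\<close> of a double coset, Ad of its
  inverse applied to \<open>v\<close> meets the factor from L first, which only rescales
  \<open>v\<close>, and the factor from the even subgroup last, where \<open>Q\<close> absorbs it. A
  quadratic form changes by the square of the scaling factor, so its sign survives. Both signs occur
  because the Killing form of sl(2,R) is indefinite: hyperbolic elements give positive values,
  elliptic ones negative values. The base point itself decides nothing: there \<open>Q v\<close> is
  0, and l and the even subalgebra share the diagonal part. One has to move in directions opposite
  to l; e^1, e_3^1 and e_3^2 are root vectors for negative roots. Since 8 + 6 = 14, transversality
  of l and the even subalgebra is then a square linear system. The analytic obstacle is that the Lie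
  algebra of G is known only through brackets of left-invariant fields in a chart. That this bracket
  is the derivative of Ad rests on the symmetry of second derivatives, which is therefore proved
  first.\<close>

lemma Ck_on_cong:
  assumes "open S" "\<And>x. x \<in> S \<Longrightarrow> f x = g x" "Ck_on k S f"
  shows "Ck_on k S g"
  using assms(2,3)
proof (induction k arbitrary: f g)
  case 0
  then show ?case using continuous_on_cong by fastforce
next
  case (Suc k)
  have D: "(g has_derivative frechet_derivative f (at x)) (at x)" if "x \<in> S" for x
  proof -
    have "(f has_derivative frechet_derivative f (at x)) (at x)"
      using Suc.prems(2) that by (simp add: frechet_derivative_works[symmetric])
    then show ?thesis
      by (rule has_derivative_transform_within_open[OF _ assms(1) that Suc.prems(1)])
  qed
  have E: "frechet_derivative f (at x) = frechet_derivative g (at x)" if "x \<in> S" for x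
    using D[OF that] by (rule frechet_derivative_at)
  have "Ck_on k S (\<lambda>x. frechet_derivative g (at x) v)" for v
    by (rule Suc.IH[of "\<lambda>x. frechet_derivative f (at x) v"]) (use Suc.prems(2) in \<open>simp_all add: E\<close>)
  then show ?case using D unfolding Ck_on.simps differentiable_def by blast
qed

lemma Ck_on_subset: "Ck_on k S f \<Longrightarrow> T \<subseteq> S \<Longrightarrow> Ck_on k T f"
  by (induction k arbitrary: f) (auto intro: continuous_on_subset)

lemma Ck_on_local:
  assumes "\<And>x. x \<in> S \<Longrightarrow> \<exists>U. open U \<and> x \<in> U \<and> Ck_on k U f"
  shows "Ck_on k S f"
  using assms
proof (induction k arbitrary: f)
  case 0
  then have "continuous (at x) f" if "x \<in> S" for x
    using that by (metis Ck_on.simps(1) continuous_on_eq_continuous_at)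
  then show ?case by (simp add: continuous_at_imp_continuous_on)
next
  case (Suc k)
  have "f differentiable (at x)" if "x \<in> S" for x
    using Suc.prems[OF that] unfolding Ck_on.simps by blast
  moreover have "Ck_on k S (\<lambda>x. frechet_derivative f (at x) v)" for v
  proof (rule Suc.IH)
    show "\<exists>U. open U \<and> x \<in> U \<and> Ck_on k U (\<lambda>x. frechet_derivative f (at x) v)" if "x \<in> S" for x
      using Suc.prems[OF that] unfolding Ck_on.simps by blast
  qed
  ultimately show ?case unfolding Ck_on.simps by blast
qed

text \<open>The recursion descends through derivatives only, so monotonicity in the order is an
  induction whose base case is that differentiability implies continuity.\<close>

lemma Ck_on_SucD: "Ck_on (Suc k) S f \<Longrightarrow> Ck_on k S f"
proof (induction k arbitrary: f)
  case 0
  then show ?case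
    by (auto intro!: continuous_at_imp_continuous_on differentiable_imp_continuous_within)
next
  case (Suc k)
  from Suc.prems have 1: "\<forall>x\<in>S. f differentiable (at x)"
    and 2: "\<And>v. Ck_on (Suc k) S (\<lambda>x. frechet_derivative f (at x) v)"
    by (auto simp only: Ck_on.simps)
  show ?case using 1 Suc.IH[OF 2] by (simp only: Ck_on.simps) blast
qed

lemma Ck_on_imp_continuous_on: "Ck_on k S f \<Longrightarrow> continuous_on S f"
  by (induction k) (auto dest: Ck_on_SucD simp del: Ck_on.simps(2))

lemma Ck_on_has_derivative:
  "Ck_on (Suc k) S f \<Longrightarrow> x \<in> S \<Longrightarrow> (f has_derivative frechet_derivative f (at x)) (at x)"
  by (simp add: frechet_derivative_works[symmetric])

text \<open>Allows any explicit derivative formula in place of the choice operator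
  \<open>frechet_derivative\<close>; on an open set the two agree by uniqueness. The closure rules
  below get their inductive step from it.\<close>

lemma Ck_on_SucI:
  assumes "open S" "\<And>x. x \<in> S \<Longrightarrow> (f has_derivative f' x) (at x)"
    and "\<And>v. Ck_on k S (\<lambda>x. f' x v)"
  shows "Ck_on (Suc k) S f"
proof -
  have "f' x = frechet_derivative f (at x)" if "x \<in> S" for x
    using assms(2)[OF that] by (rule frechet_derivative_at)
  then show ?thesis using assms
    by (auto simp: differentiable_def intro!: Ck_on_cong[OF assms(1) _ assms(3)])
qed

lemma Ck_on_const: "Ck_on k S (\<lambda>x. a)"
proof (induction k arbitrary: a)
  case (Suc k)
  show ?case using Suc[of 0] by (simp add: frechet_derivative_const)
qed simp

lemma Ck_on_linear:
  assumes "bounded_linear f" shows "Ck_on k S f"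
proof (rule Ck_on_subset[of _ UNIV])
  show "Ck_on k UNIV f"
  proof (cases k)
    case (Suc j)
    show ?thesis unfolding Suc
      by (rule Ck_on_SucI[where f' = "\<lambda>_. f"])
        (auto simp: bounded_linear_imp_has_derivative[OF assms] Ck_on_const)
  qed (simp add: linear_continuous_on[OF assms])
qed simp

lemma Ck_on_add:
  assumes "open S" "Ck_on k S f" "Ck_on k S g"
  shows "Ck_on k S (\<lambda>x. f x + g x)"
  using assms(2,3)
proof (induction k arbitrary: f g)
  case (Suc k)
  have f': "Ck_on k S (\<lambda>x. frechet_derivative f (at x) v)"
    and g': "Ck_on k S (\<lambda>x. frechet_derivative g (at x) v)" for v
    using Suc.prems by simp_all
  show ?case
    by (rule Ck_on_SucI[OF assms(1) has_derivative_add[OF Ck_on_has_derivative[OF Suc.prems(1)]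
            Ck_on_has_derivative[OF Suc.prems(2)]]])
      (assumption, assumption, rule Suc.IH[OF f' g'])
qed (auto intro: continuous_intros)

lemma Ck_on_sum:
  assumes "open S" "\<And>i. i \<in> I \<Longrightarrow> Ck_on k S (f i)"
  shows "Ck_on k S (\<lambda>x. \<Sum>i\<in>I. f i x)"
  using assms(2)
  by (induction I rule: infinite_finite_induct) (simp_all add: Ck_on_const Ck_on_add[OF assms(1)])

lemma Ck_on_scaleR:
  assumes "open S" "Ck_on k S f" "Ck_on k S g"
  shows "Ck_on k S (\<lambda>x. f x *\<^sub>R g x)"
  using assms(2,3)
proof (induction k arbitrary: f g)
  case (Suc k)
  have f: "Ck_on k S f" and g: "Ck_on k S g" using Suc.prems by (blast dest: Ck_on_SucD)+
  have f': "Ck_on k S (\<lambda>x. frechet_derivative f (at x) v)"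
    and g': "Ck_on k S (\<lambda>x. frechet_derivative g (at x) v)" for v
    using Suc.prems by simp_all
  show ?case
    by (rule Ck_on_SucI[OF assms(1) has_derivative_scaleR[OF Ck_on_has_derivative[OF Suc.prems(1)]
            Ck_on_has_derivative[OF Suc.prems(2)]]])
      (assumption, assumption, rule Ck_on_add[OF assms(1) Suc.IH[OF f g'] Suc.IH[OF f' g]])
qed (auto intro: continuous_intros)

lemma Ck_on_linear_compose:
  assumes "open S" "bounded_linear h" "Ck_on k S f"
  shows "Ck_on k S (\<lambda>x. h (f x))"
  using assms(3)
proof (induction k arbitrary: f)
  case (Suc k)
  have f': "Ck_on k S (\<lambda>x. frechet_derivative f (at x) v)" for v
    using Suc.prems by simp
  show ?case
    by (rule Ck_on_SucI[OF assms(1)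
          bounded_linear.has_derivative[OF assms(2) Ck_on_has_derivative[OF Suc.prems]]])
      (assumption, rule Suc.IH[OF f'])
qed (auto intro: bounded_linear.continuous_on[OF assms(2)])

lemma Ck_on_Pair:
  assumes "open S" "Ck_on k S f" "Ck_on k S g"
  shows "Ck_on k S (\<lambda>x. (f x, g x))"
proof -
  have "bounded_linear (\<lambda>y. (y, 0))" "bounded_linear (\<lambda>y. (0, y))"
    by (intro bounded_linear_Pair bounded_linear_ident bounded_linear_zero)+
  from Ck_on_add[OF assms(1) Ck_on_linear_compose[OF assms(1) this(1) assms(2)]
      Ck_on_linear_compose[OF assms(1) this(2) assms(3)]]
  show ?thesis by simp
qed

text \<open>In the chain rule the derivative of \<open>g\<close> is taken in a direction that varies
  with the point, whereas \<open>Ck_on\<close> speaks of fixed directions. Expanding the direction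
  in the basis turns the derivative into a sum of scalar functions times derivatives in basis
  directions.\<close>

lemma Ck_on_compose:
  assumes "open S" "open T" "f ` S \<subseteq> T" "Ck_on k S f" "Ck_on k T g"
  shows "Ck_on k S (\<lambda>x. g (f x))"
  using assms(4,5)
proof (induction k arbitrary: g)
  case 0
  then show ?case using assms(3) by (auto intro: continuous_on_compose2)
next
  case (Suc k)
  have f: "Ck_on k S f" using Suc.prems by (blast dest: Ck_on_SucD)
  have f': "Ck_on k S (\<lambda>x. frechet_derivative f (at x) v)"
    and g': "Ck_on k T (\<lambda>x. frechet_derivative g (at x) w)" for v w
    using Suc.prems by simp_all
  have lin: "frechet_derivative g (at y) w =
      (\<Sum>i\<in>Basis. (w \<bullet> i) *\<^sub>R frechet_derivative g (at y) i)" if "y \<in> T" for y w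
  proof -
    have "linear (frechet_derivative g (at y))"
      using Suc.prems(2) that by (simp add: linear_frechet_derivative)
    then have "frechet_derivative g (at y) (\<Sum>i\<in>Basis. (w \<bullet> i) *\<^sub>R i) =
        (\<Sum>i\<in>Basis. (w \<bullet> i) *\<^sub>R frechet_derivative g (at y) i)"
      by (simp add: linear_sum linear_scale)
    then show ?thesis by (simp add: euclidean_representation)
  qed
  show ?case
  proof (rule Ck_on_SucI[OF assms(1)])
    fix x assume "x \<in> S"
    then have "f x \<in> T" using assms(3) by auto
    from has_derivative_compose[OF Ck_on_has_derivative[OF Suc.prems(1) \<open>x \<in> S\<close>]
        Ck_on_has_derivative[OF Suc.prems(2) this]]
    show "((\<lambda>x. g (f x)) has_derivative (\<lambda>v. \<Sum>i\<in>Basis.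
        (frechet_derivative f (at x) v \<bullet> i) *\<^sub>R frechet_derivative g (at (f x)) i)) (at x)"
      by (subst (asm) lin[OF \<open>f x \<in> T\<close>])
  next
    fix v
    have "Ck_on k S (\<lambda>x. frechet_derivative f (at x) v \<bullet> i)" for i
      by (rule Ck_on_linear_compose[OF assms(1) bounded_linear_inner_left f'])
    then show "Ck_on k S (\<lambda>x. \<Sum>i\<in>Basis.
        (frechet_derivative f (at x) v \<bullet> i) *\<^sub>R frechet_derivative g (at (f x)) i)"
      by (intro Ck_on_sum[OF assms(1)] Ck_on_scaleR[OF assms(1)] Suc.IH[OF f g'])
  qed
qed

lemma smooth_on_compose:
  assumes "open S" "open T" "f ` S \<subseteq> T" "smooth_on S f" "smooth_on T g"
  shows "smooth_on S (\<lambda>x. g (f x))"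
  using assms Ck_on_compose unfolding smooth_on_def by blast

lemma smooth_on_has_derivative:
  "smooth_on S f \<Longrightarrow> x \<in> S \<Longrightarrow> (f has_derivative frechet_derivative f (at x)) (at x)"
  unfolding smooth_on_def by (blast intro: Ck_on_has_derivative)

lemma smooth_on_frechet_derivative:
  "smooth_on S f \<Longrightarrow> smooth_on S (\<lambda>x. frechet_derivative f (at x) v)"
  unfolding smooth_on_def by (metis Ck_on.simps(2))

lemma smooth_on_imp_continuous_on: "smooth_on S f \<Longrightarrow> continuous_on S f"
  unfolding smooth_on_def by (metis Ck_on_imp_continuous_on)

text \<open>The mean value theorem, used once along \<open>v\<close> and once along
  \<open>w\<close>, evaluates the second difference exactly. The left side is symmetric in
  \<open>v\<close> and \<open>w\<close>, the right side is not; this asymmetry is what yields the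
  equality of mixed derivatives.\<close>

lemma mixed_difference_mean_value:
  fixes f :: "'e::euclidean_space \<Rightarrow> real"
  assumes "smooth_on (ball x r) f" "t > 0" "t * (norm v + norm w) < r"
  shows "\<exists>y. norm (y - x) \<le> t * (norm v + norm w) \<and>
    f (x + t *\<^sub>R v + t *\<^sub>R w) - f (x + t *\<^sub>R v) - f (x + t *\<^sub>R w) + f x =
      t\<^sup>2 * frechet_derivative (\<lambda>y. frechet_derivative f (at y) v) (at y) w"
proof -
  let ?D = "\<lambda>y. frechet_derivative f (at y)"
  have le: "norm (a *\<^sub>R v + b *\<^sub>R w) \<le> t * (norm v + norm w)"
    if "0 \<le> a" "a \<le> t" "0 \<le> b" "b \<le> t" for a b
  proof -
    have "norm (a *\<^sub>R v + b *\<^sub>R w) \<le> a * norm v + b * norm w"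
      using norm_triangle_ineq[of "a *\<^sub>R v" "b *\<^sub>R w"] that by simp
    also have "\<dots> \<le> t * norm v + t * norm w"
      using that by (intro add_mono mult_right_mono) auto
    finally show ?thesis by (simp add: algebra_simps)
  qed
  have mem: "x + a *\<^sub>R v + b *\<^sub>R w \<in> ball x r"
    if "0 \<le> a" "a \<le> t" "0 \<le> b" "b \<le> t" for a b
  proof -
    have "x - (x + a *\<^sub>R v + b *\<^sub>R w) = - (a *\<^sub>R v + b *\<^sub>R w)" by simp
    then have "dist x (x + a *\<^sub>R v + b *\<^sub>R w) = norm (a *\<^sub>R v + b *\<^sub>R w)"
      by (metis dist_norm norm_minus_cancel)
    then show ?thesis using le[OF that] assms(3) by simp
  qed
  have d: "((\<lambda>s. f (x + s *\<^sub>R v + b *\<^sub>R w)) has_real_derivative ?D (x + a *\<^sub>R v + b *\<^sub>R w) v) (at a)"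
    if "0 \<le> a" "a \<le> t" "0 \<le> b" "b \<le> t" for a b
  proof -
    note D = smooth_on_has_derivative[OF assms(1) mem[OF that]]
    have l: "((\<lambda>s. x + s *\<^sub>R v + b *\<^sub>R w) has_derivative (\<lambda>h. h *\<^sub>R v)) (at a)"
      using has_derivative_add_const[OF bounded_linear_imp_has_derivative[OF
          bounded_linear_scaleR_left], of v "x + b *\<^sub>R w"] by (simp add: ac_simps)
    have "((\<lambda>s. f (x + s *\<^sub>R v + b *\<^sub>R w)) has_derivative (\<lambda>h. ?D (x + a *\<^sub>R v + b *\<^sub>R w) (h *\<^sub>R v))) (at a)"
      by (rule has_derivative_compose[where f="\<lambda>s. x + s *\<^sub>R v + b *\<^sub>R w", OF l D])
    moreover have "linear (?D (x + a *\<^sub>R v + b *\<^sub>R w))" using D has_derivative_linear by blast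
    then have "(\<lambda>h. ?D (x + a *\<^sub>R v + b *\<^sub>R w) (h *\<^sub>R v)) = (*) (?D (x + a *\<^sub>R v + b *\<^sub>R w) v)"
      by (simp add: fun_eq_iff linear_cmul[unfolded real_scaleR_def])
    ultimately show ?thesis unfolding has_field_derivative_def by metis
  qed
  \<comment> \<open>The vanishing multiple of \<open>w\<close> is kept, and protected from the
    simplifier below, so that both terms are instances of \<open>d\<close>, with
    \<open>b = t\<close> and with \<open>b = 0\<close>.\<close>
  let ?\<phi> = "\<lambda>s. f (x + s *\<^sub>R v + t *\<^sub>R w) - f (x + s *\<^sub>R v + 0 *\<^sub>R w)"
  have "\<exists>s. 0 < s \<and> s < t \<and>
      ?\<phi> t - ?\<phi> 0 = (t - 0) * (?D (x + s *\<^sub>R v + t *\<^sub>R w) v - ?D (x + s *\<^sub>R v + 0 *\<^sub>R w) v)"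
    by (rule MVT2[OF assms(2)]) (use assms(2) in \<open>auto intro!: derivative_intros d simp del: scaleR_zero_left\<close>)
  then obtain s where s: "0 < s" "s < t" and
    1: "?\<phi> t - ?\<phi> 0 = t * (?D (x + s *\<^sub>R v + t *\<^sub>R w) v - ?D (x + s *\<^sub>R v) v)" by auto
  let ?E = "\<lambda>y. frechet_derivative (\<lambda>y. ?D y v) (at y)"
  have d2: "((\<lambda>b. ?D (x + s *\<^sub>R v + b *\<^sub>R w) v) has_real_derivative ?E (x + s *\<^sub>R v + b *\<^sub>R w) w) (at b)"
    if "0 \<le> b" "b \<le> t" for b
  proof -
    have m: "x + s *\<^sub>R v + b *\<^sub>R w \<in> ball x r" using mem[of s b] s that by simp
    note D = smooth_on_has_derivative[OF smooth_on_frechet_derivative[OF assms(1)] m, of v]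
    have l: "((\<lambda>b. x + s *\<^sub>R v + b *\<^sub>R w) has_derivative (\<lambda>h. h *\<^sub>R w)) (at b)"
      using has_derivative_add_const[OF bounded_linear_imp_has_derivative[OF
          bounded_linear_scaleR_left], of w "x + s *\<^sub>R v"] by (simp add: ac_simps)
    have "((\<lambda>b. ?D (x + s *\<^sub>R v + b *\<^sub>R w) v) has_derivative (\<lambda>h. ?E (x + s *\<^sub>R v + b *\<^sub>R w) (h *\<^sub>R w))) (at b)"
      by (rule has_derivative_compose[where f="\<lambda>b. x + s *\<^sub>R v + b *\<^sub>R w", OF l D])
    moreover have "linear (?E (x + s *\<^sub>R v + b *\<^sub>R w))" using D has_derivative_linear by blast
    then have "(\<lambda>h. ?E (x + s *\<^sub>R v + b *\<^sub>R w) (h *\<^sub>R w)) = (*) (?E (x + s *\<^sub>R v + b *\<^sub>R w) w)"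
      by (simp add: fun_eq_iff linear_cmul[unfolded real_scaleR_def])
    ultimately show ?thesis unfolding has_field_derivative_def by metis
  qed
  have "\<exists>b. 0 < b \<and> b < t \<and>
      ?D (x + s *\<^sub>R v + t *\<^sub>R w) v - ?D (x + s *\<^sub>R v + 0 *\<^sub>R w) v
        = (t - 0) * ?E (x + s *\<^sub>R v + b *\<^sub>R w) w"
    by (rule MVT2[OF assms(2)]) (use d2 in auto)
  then obtain b where b: "0 < b" "b < t" and
    2: "?D (x + s *\<^sub>R v + t *\<^sub>R w) v - ?D (x + s *\<^sub>R v) v = t * ?E (x + s *\<^sub>R v + b *\<^sub>R w) w" by auto
  show ?thesis
    using 1 2 le[of s b] s b
    by (intro exI[of _ "x + s *\<^sub>R v + b *\<^sub>R w"]) (simp add: power2_eq_square algebra_simps)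
qed

text \<open>One and the same second difference equals both mixed derivatives, each at some point
  close to \<open>x\<close>. Continuity at \<open>x\<close> leaves no room for a gap between their
  values there.\<close>

lemma mixed_derivatives_symmetric_real:
  fixes f :: "'e::euclidean_space \<Rightarrow> real"
  assumes "open S" "x \<in> S" "smooth_on S f"
  shows "frechet_derivative (\<lambda>y. frechet_derivative f (at y) v) (at x) w =
         frechet_derivative (\<lambda>y. frechet_derivative f (at y) w) (at x) v" (is "?E v w x = ?E w v x")
proof (rule ccontr)
  assume ne: "?E v w x \<noteq> ?E w v x"
  define e where "e = \<bar>?E v w x - ?E w v x\<bar> / 2"
  have e: "e > 0" using ne by (simp add: e_def)
  have c: "isCont (?E a b) x" for a b
    using smooth_on_imp_continuous_on[OF smooth_on_frechet_derivative[OF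
          smooth_on_frechet_derivative[OF assms(3)]]] assms(1,2)
    by (simp add: continuous_on_eq_continuous_at)
  obtain r0 where r0: "r0 > 0" "ball x r0 \<subseteq> S" using assms(1,2) openE by blast
  obtain r1 where r1: "r1 > 0" "\<And>y. dist y x < r1 \<Longrightarrow> \<bar>?E v w y - ?E v w x\<bar> < e"
    using c[of v w] e unfolding continuous_at_eps_delta by (metis dist_real_def)
  obtain r2 where r2: "r2 > 0" "\<And>y. dist y x < r2 \<Longrightarrow> \<bar>?E w v y - ?E w v x\<bar> < e"
    using c[of w v] e unfolding continuous_at_eps_delta by (metis dist_real_def)
  define r where "r = min r0 (min r1 r2)"
  have r: "r > 0" using r0 r1 r2 by (simp add: r_def)
  have sm: "smooth_on (ball x r) f"
    using assms(3) r0(2) unfolding smooth_on_def r_def by (meson Ck_on_subset min.cobounded1 subset_ball subset_trans)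
  \<comment> \<open>Keeps the displacement \<open>t * (norm v + norm w)\<close> at most
    \<open>r / 2\<close>; the summand 1 avoids division by zero when both directions vanish.\<close>
  define t where "t = r / (2 * (norm v + norm w + 1))"
  have n: "norm v + norm w + 1 > 0" by (simp add: add_nonneg_pos)
  have t: "t > 0" using r n by (simp add: t_def)
  have "t * (norm v + norm w) \<le> t * (norm v + norm w + 1)" using t by simp
  also have "\<dots> = r / 2"
    unfolding t_def using n by (metis nonzero_mult_divide_mult_cancel_right less_irrefl times_divide_eq_left)
  finally have tl: "t * (norm v + norm w) < r" using r by simp
  obtain y where y: "norm (y - x) \<le> t * (norm v + norm w)"
    "f (x + t *\<^sub>R v + t *\<^sub>R w) - f (x + t *\<^sub>R v) - f (x + t *\<^sub>R w) + f x = t\<^sup>2 * ?E v w y"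
    using mixed_difference_mean_value[OF sm t tl] by blast
  obtain z where z: "norm (z - x) \<le> t * (norm w + norm v)"
    "f (x + t *\<^sub>R w + t *\<^sub>R v) - f (x + t *\<^sub>R w) - f (x + t *\<^sub>R v) + f x = t\<^sup>2 * ?E w v z"
    using mixed_difference_mean_value[OF sm t, of w v] tl by (auto simp: add.commute)
  have "t\<^sup>2 * ?E v w y = t\<^sup>2 * ?E w v z"
    using y(2) z(2) by (simp add: algebra_simps)
  then have "?E v w y = ?E w v z" using t by simp
  moreover have "\<bar>?E v w y - ?E v w x\<bar> < e"
    using r1(2)[of y] y(1) tl by (simp add: dist_norm r_def)
  moreover have "\<bar>?E w v z - ?E w v x\<bar> < e"
    using r2(2)[of z] z(1) tl by (simp add: dist_norm r_def add.commute)
  ultimately have "\<bar>?E v w x - ?E w v x\<bar> < e + e" by arith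
  then show False by (simp add: e_def)
qed

lemma smooth_on_linear_compose:
  "open S \<Longrightarrow> bounded_linear h \<Longrightarrow> smooth_on S f \<Longrightarrow> smooth_on S (\<lambda>x. h (f x))"
  unfolding smooth_on_def by (blast intro: Ck_on_linear_compose)

lemma mixed_derivatives_symmetric:
  fixes f :: "'e::euclidean_space \<Rightarrow> 'f::euclidean_space"
  assumes "open S" "x \<in> S" "smooth_on S f"
  shows "frechet_derivative (\<lambda>y. frechet_derivative f (at y) v) (at x) w =
         frechet_derivative (\<lambda>y. frechet_derivative f (at y) w) (at x) v"
proof (rule euclidean_eqI)
  fix i :: 'f
  have D: "frechet_derivative (\<lambda>y. g y \<bullet> i) (at y) u = frechet_derivative g (at y) u \<bullet> i"
    if "smooth_on S g" "y \<in> S" for g :: "'e \<Rightarrow> 'f" and y u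
    using frechet_derivative_at[OF bounded_linear.has_derivative[OF bounded_linear_inner_left
          smooth_on_has_derivative[OF that]], of i] by metis
  have E: "frechet_derivative (\<lambda>y. frechet_derivative (\<lambda>y. f y \<bullet> i) (at y) v) (at x) w =
      frechet_derivative (\<lambda>y. frechet_derivative f (at y) v) (at x) w \<bullet> i" for v w
  proof -
    have "((\<lambda>y. frechet_derivative f (at y) v \<bullet> i) has_derivative
       (\<lambda>w. frechet_derivative (\<lambda>y. frechet_derivative f (at y) v) (at x) w \<bullet> i)) (at x)"
      by (rule bounded_linear.has_derivative[OF bounded_linear_inner_left
          smooth_on_has_derivative[OF smooth_on_frechet_derivative[OF assms(3)] assms(2)]])
    then have "((\<lambda>y. frechet_derivative (\<lambda>y. f y \<bullet> i) (at y) v) has_derivative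
       (\<lambda>w. frechet_derivative (\<lambda>y. frechet_derivative f (at y) v) (at x) w \<bullet> i)) (at x)"
      by (rule has_derivative_transform_within_open[OF _ assms(1,2)]) (simp add: D[OF assms(3)])
    from frechet_derivative_at[OF this] show ?thesis by metis
  qed
  have "smooth_on S (\<lambda>y. f y \<bullet> i)"
    by (rule smooth_on_linear_compose[OF assms(1) bounded_linear_inner_left assms(3)])
  from mixed_derivatives_symmetric_real[OF assms(1,2) this]
  show "frechet_derivative (\<lambda>y. frechet_derivative f (at y) v) (at x) w \<bullet> i =
         frechet_derivative (\<lambda>y. frechet_derivative f (at y) w) (at x) v \<bullet> i"
    by (simp add: E)
qed

section \<open>Manifolds and smooth maps\<close>

lemma smooth_on_subset: "smooth_on S f \<Longrightarrow> T \<subseteq> S \<Longrightarrow> smooth_on T f"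
  unfolding smooth_on_def by (blast intro: Ck_on_subset)

lemma smooth_on_cong:
  "open S \<Longrightarrow> (\<And>x. x \<in> S \<Longrightarrow> f x = g x) \<Longrightarrow> smooth_on S f \<Longrightarrow> smooth_on S g"
  unfolding smooth_on_def using Ck_on_cong[of S f g] by blast

lemma smooth_on_local:
  assumes "\<And>x. x \<in> S \<Longrightarrow> \<exists>U. open U \<and> x \<in> U \<and> smooth_on U f"
  shows "smooth_on S f"
  unfolding smooth_on_def
proof
  fix k
  show "Ck_on k S f"
    by (rule Ck_on_local) (use assms in \<open>unfold smooth_on_def, blast\<close>)
qed

lemma smooth_on_Pair:
  "open S \<Longrightarrow> smooth_on S f \<Longrightarrow> smooth_on S g \<Longrightarrow> smooth_on S (\<lambda>x. (f x, g x))"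
  unfolding smooth_on_def by (blast intro: Ck_on_Pair)

lemma smooth_on_const: "smooth_on S (\<lambda>x. a)"
  unfolding smooth_on_def by (blast intro: Ck_on_const)

lemma smooth_on_linear: "bounded_linear f \<Longrightarrow> smooth_on S f"
  unfolding smooth_on_def by (blast intro: Ck_on_linear)

text \<open>An atlas without the compatibility of its charts. Composition and the chain rule are
  stated at this level, so that a product atlas can be used as soon as its members are charts that
  cover the product.\<close>

definition chart_cover :: "'a topology \<Rightarrow> ('a, 'e::euclidean_space) chart set \<Rightarrow> bool" where
  "chart_cover X A \<longleftrightarrow> (\<forall>c\<in>A. is_chart X c) \<and> (\<Union>c\<in>A. chart_dom c) = topspace X"

lemma chart_coverD: "chart_cover X A \<Longrightarrow> c \<in> A \<Longrightarrow> is_chart X c"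
  by (simp add: chart_cover_def)

lemma chart_cover_obtain:
  assumes "chart_cover X A" "x \<in> topspace X"
  obtains c where "c \<in> A" "x \<in> chart_dom c"
  using assms unfolding chart_cover_def by blast

lemma smooth_mapD:
  "smooth_map X A Y B f \<Longrightarrow> c \<in> A \<Longrightarrow> d \<in> B \<Longrightarrow>
    smooth_on (snd c ` {x \<in> chart_dom c. f x \<in> chart_dom d}) (snd d \<circ> f \<circ> chart_inv c)"
  by (simp add: smooth_map_def)

lemma smooth_atlas_chart_cover: "smooth_atlas X A \<Longrightarrow> chart_cover X A"
  by (simp add: smooth_atlas_def chart_cover_def)

lemma is_chart_inj: "is_chart X c \<Longrightarrow> inj_on (snd c) (chart_dom c)"
  unfolding is_chart_def
  by (metis homeomorphic_imp_injective_map inf.absorb2 openin_subset topspace_subtopology)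

lemma chart_inv_chart: "is_chart X c \<Longrightarrow> x \<in> chart_dom c \<Longrightarrow> chart_inv c (snd c x) = x"
  by (simp add: is_chart_inj)

lemma is_chart_open_image:
  assumes "is_chart X c" "openin X U" "U \<subseteq> chart_dom c"
  shows "open (snd c ` U)"
proof -
  have "openin (subtopology X (chart_dom c)) U"
    using assms by (simp add: openin_open_subtopology is_chart_def)
  then have "openin (top_of_set (snd c ` chart_dom c)) (snd c ` U)"
    using assms(1) homeomorphic_imp_open_map open_map_def unfolding is_chart_def by blast
  then show ?thesis using assms(1) openin_open_trans unfolding is_chart_def by blast
qed

lemma is_chart_continuous:
  assumes "is_chart X c" shows "continuous_map (subtopology X (chart_dom c)) euclidean (snd c)"
  using assms homeomorphic_imp_continuous_map continuous_map_into_fulltopology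
  unfolding is_chart_def by blast

lemma is_chart_open_preimage:
  assumes "is_chart X c" "open V"
  shows "openin X {x \<in> chart_dom c. snd c x \<in> V}"
proof -
  have o: "openin X (chart_dom c)" using assms(1) by (simp add: is_chart_def)
  then have "topspace (subtopology X (chart_dom c)) = chart_dom c"
    by (simp add: inf.absorb2 openin_subset)
  then have "openin (subtopology X (chart_dom c)) {x \<in> chart_dom c. snd c x \<in> V}"
    using openin_continuous_map_preimage[OF is_chart_continuous[OF assms(1)], of V] assms(2)
    by (simp add: open_openin[symmetric])
  then show ?thesis using o openin_trans_full by blast
qed

lemma is_chart_openin: "is_chart X c \<Longrightarrow> openin X (chart_dom c)"
  by (simp add: is_chart_def)

lemma continuous_map_openin_preimage2:
  assumes "continuous_map X Y f" "openin X U" "openin Y V"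
  shows "openin X {x \<in> U. f x \<in> V}"
proof -
  have "{x \<in> U. f x \<in> V} = U \<inter> {x \<in> topspace X. f x \<in> V}"
    using openin_subset[OF assms(2)] by blast
  then show ?thesis using assms by (simp add: openin_Int openin_continuous_map_preimage)
qed

lemma smooth_map_continuous: "smooth_map X A Y B f \<Longrightarrow> continuous_map X Y f"
  by (simp add: smooth_map_def)

lemma chart_image_open:
  assumes "is_chart X c" "is_chart Y d" "continuous_map X Y f"
  shows "open (snd c ` {x \<in> chart_dom c. f x \<in> chart_dom d})"
  by (rule is_chart_open_image[OF assms(1) continuous_map_openin_preimage2[OF assms(3)
          is_chart_openin[OF assms(1)] is_chart_openin[OF assms(2)]]]) blast

text \<open>Smoothness is tested on every pair of charts of \<open>X\<close> and \<open>Z\<close>,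
  but an intermediate chart of \<open>Y\<close> is available only near a given point. Hence the
  argument is local and ends with \<open>smooth_on_local\<close>.\<close>

lemma smooth_map_compose:
  assumes X: "chart_cover X A" and Y: "chart_cover Y B" and Z: "chart_cover Z C"
    and f: "smooth_map X A Y B f" and g: "smooth_map Y B Z C g"
  shows "smooth_map X A Z C (\<lambda>x. g (f x))"
  unfolding smooth_map_def
proof (intro conjI ballI)
  have cf: "continuous_map X Y f" and cg: "continuous_map Y Z g"
    using f g by (simp_all add: smooth_map_def)
  then show cgf: "continuous_map X Z (\<lambda>x. g (f x))"
    using continuous_map_compose[OF cf cg] by (simp add: o_def)
  fix c e assume c: "c \<in> A" and e: "e \<in> C"
  have ic: "is_chart X c" and ie: "is_chart Z e" using c e X Z by (blast intro: chart_coverD)+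
  show "smooth_on (snd c ` {x \<in> chart_dom c. g (f x) \<in> chart_dom e})
      (snd e \<circ> (\<lambda>x. g (f x)) \<circ> chart_inv c)"
  proof (rule smooth_on_local)
    fix y assume "y \<in> snd c ` {x \<in> chart_dom c. g (f x) \<in> chart_dom e}"
    then obtain x where x: "x \<in> chart_dom c" "g (f x) \<in> chart_dom e" "y = snd c x" by blast
    have "f x \<in> topspace Y"
      using cf x(1) openin_subset[OF is_chart_openin[OF ic]] by (auto simp: continuous_map_def)
    then obtain d where d: "d \<in> B" "f x \<in> chart_dom d" by (rule chart_cover_obtain[OF Y])
    have id: "is_chart Y d" by (rule chart_coverD[OF Y d(1)])
    \<comment> \<open>On this open set the single chart \<open>d\<close> serves for the whole
      composite, which therefore factors through coordinates of \<open>Y\<close>.\<close>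
    define W where "W = {x \<in> {x \<in> chart_dom c. f x \<in> chart_dom d}. g (f x) \<in> chart_dom e}"
    have "openin X W" unfolding W_def
      by (intro continuous_map_openin_preimage2[OF cgf] continuous_map_openin_preimage2[OF cf]
          is_chart_openin ic id ie)
    then have oU: "open (snd c ` W)"
      by (rule is_chart_open_image[OF ic]) (auto simp: W_def)
    have 1: "smooth_on (snd c ` W) (snd d \<circ> f \<circ> chart_inv c)"
      by (rule smooth_on_subset[OF smooth_mapD[OF f c d(1)]]) (auto simp: W_def)
    have 2: "smooth_on (snd d ` {x \<in> chart_dom d. g x \<in> chart_dom e}) (snd e \<circ> g \<circ> chart_inv d)"
      by (rule smooth_mapD[OF g d(1) e])
    have sub: "(snd d \<circ> f \<circ> chart_inv c) ` snd c ` W \<subseteq> snd d ` {x \<in> chart_dom d. g x \<in> chart_dom e}"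
      by (auto simp: W_def chart_inv_chart[OF ic])
    have "smooth_on (snd c ` W) (\<lambda>z. (snd e \<circ> g \<circ> chart_inv d) ((snd d \<circ> f \<circ> chart_inv c) z))"
      by (rule smooth_on_compose[OF oU chart_image_open[OF id ie cg] sub 1 2])
    then have "smooth_on (snd c ` W) (snd e \<circ> (\<lambda>x. g (f x)) \<circ> chart_inv c)"
      by (rule smooth_on_cong[OF oU, rotated])
        (auto simp: W_def chart_inv_chart[OF ic] chart_inv_chart[OF id])
    then show "\<exists>U. open U \<and> y \<in> U \<and> smooth_on U (snd e \<circ> (\<lambda>x. g (f x)) \<circ> chart_inv c)"
      using oU x d by (intro exI[of _ "snd c ` W"]) (auto simp: W_def)
  qed
qed

text \<open>In charts the identity is a transition map, so this is exactly the compatibility of the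
  atlas.\<close>

lemma smooth_map_id:
  assumes "smooth_atlas X A" shows "smooth_map X A X A (\<lambda>x. x)"
proof -
  have "{x \<in> chart_dom c. x \<in> chart_dom d} = chart_dom c \<inter> chart_dom d"
    for c d :: "('a,'b) chart" by blast
  then show ?thesis using assms
    by (auto simp: smooth_map_def smooth_atlas_def comp_def)
qed

lemma smooth_map_const:
  assumes "a \<in> topspace Y" shows "smooth_map X A Y B (\<lambda>x. a)"
  using assms by (auto simp: smooth_map_def comp_def smooth_on_const)

section \<open>Product charts, pairings and projections\<close>

lemma chart_inv_map_prod:
  assumes "is_chart X c" "is_chart Y d" "x \<in> chart_dom c" "y \<in> chart_dom d"
  shows "inv_into (chart_dom c \<times> chart_dom d) (map_prod (snd c) (snd d)) (snd c x, snd d y) = (x, y)"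
proof -
  have "inj_on (map_prod (snd c) (snd d)) (chart_dom c \<times> chart_dom d)"
    by (intro map_prod_inj_on is_chart_inj[OF assms(1)] is_chart_inj[OF assms(2)])
  from inv_into_f_f[OF this, of "(x, y)"] show ?thesis using assms by simp
qed

lemma is_chart_prod:
  assumes c: "is_chart X c" and d: "is_chart Y d"
  shows "is_chart (prod_topology X Y) (chart_dom c \<times> chart_dom d, map_prod (snd c) (snd d))"
proof -
  have im: "map_prod (snd c) (snd d) ` (chart_dom c \<times> chart_dom d) =
      (snd c ` chart_dom c) \<times> (snd d ` chart_dom d)" by (rule map_prod_surj_on) auto
  obtain c' where c': "homeomorphic_maps (subtopology X (chart_dom c))
      (top_of_set (snd c ` chart_dom c)) (snd c) c'"
    using c homeomorphic_map_maps unfolding is_chart_def by blast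
  obtain d' where d': "homeomorphic_maps (subtopology Y (chart_dom d))
      (top_of_set (snd d ` chart_dom d)) (snd d) d'"
    using d homeomorphic_map_maps unfolding is_chart_def by blast
  have "homeomorphic_maps (prod_topology (subtopology X (chart_dom c)) (subtopology Y (chart_dom d)))
      (prod_topology (top_of_set (snd c ` chart_dom c)) (top_of_set (snd d ` chart_dom d)))
      (\<lambda>(x, y). (snd c x, snd d y)) (\<lambda>(x, y). (c' x, d' y))"
    by (subst homeomorphic_maps_prod) (use c' d' in blast)
  then have "homeomorphic_map (subtopology (prod_topology X Y) (chart_dom c \<times> chart_dom d))
      (top_of_set ((snd c ` chart_dom c) \<times> (snd d ` chart_dom d))) (map_prod (snd c) (snd d))"
    unfolding homeomorphic_map_maps map_prod_def subtopology_Times[symmetric] prod_topology_euclidean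
    by blast
  then show ?thesis using c d unfolding is_chart_def
    by (simp add: im openin_prod_Times_iff open_Times)
qed

lemma chart_cover_prod:
  assumes "chart_cover X A" "chart_cover Y B"
  shows "chart_cover (prod_topology X Y) (prod_atlas A B)"
proof -
  have "is_chart (prod_topology X Y) p" if "p \<in> prod_atlas A B" for p
  proof -
    from that obtain c d where "c \<in> A" "d \<in> B"
      and p: "p = (chart_dom c \<times> chart_dom d, map_prod (snd c) (snd d))"
      unfolding prod_atlas_def by blast
    then show ?thesis
      unfolding p by (intro is_chart_prod chart_coverD[OF assms(1)] chart_coverD[OF assms(2)])
  qed
  moreover have "(\<Union>p\<in>prod_atlas A B. chart_dom p) = topspace (prod_topology X Y)"
  proof (intro equalityI subsetI)
    fix z assume "z \<in> (\<Union>p\<in>prod_atlas A B. chart_dom p)"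
    then obtain p where "p \<in> prod_atlas A B" "z \<in> chart_dom p" by (rule UN_E)
    then show "z \<in> topspace (prod_topology X Y)"
      using openin_subset[OF is_chart_openin[OF calculation]] by (rule_tac subsetD)
  next
    fix z assume "z \<in> topspace (prod_topology X Y)"
    then have "fst z \<in> topspace X" "snd z \<in> topspace Y" by (simp_all add: mem_Times_iff)
    then obtain c d where "c \<in> A" "d \<in> B" "fst z \<in> chart_dom c" "snd z \<in> chart_dom d"
      using chart_cover_obtain[OF assms(1)] chart_cover_obtain[OF assms(2)] by metis
    then have "(chart_dom c \<times> chart_dom d, map_prod (snd c) (snd d)) \<in> prod_atlas A B"
      "z \<in> chart_dom (chart_dom c \<times> chart_dom d, map_prod (snd c) (snd d))"
      unfolding prod_atlas_def by (blast, simp add: mem_Times_iff)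
    then show "z \<in> (\<Union>p\<in>prod_atlas A B. chart_dom p)" by (rule UN_I)
  qed
  ultimately show ?thesis unfolding chart_cover_def by blast
qed

lemma smooth_map_Pair:
  assumes Z: "chart_cover Z C" and X: "chart_cover X A" and Y: "chart_cover Y B"
    and f: "smooth_map Z C X A f" and g: "smooth_map Z C Y B g"
  shows "smooth_map Z C (prod_topology X Y) (prod_atlas A B) (\<lambda>z. (f z, g z))"
  unfolding smooth_map_def
proof (intro conjI ballI)
  show cfg: "continuous_map Z (prod_topology X Y) (\<lambda>z. (f z, g z))"
    using f g by (simp add: smooth_map_def continuous_map_pairedI)
  fix e p assume e: "e \<in> C" and "p \<in> prod_atlas A B"
  then obtain c d where cd: "c \<in> A" "d \<in> B"
    and p: "p = (chart_dom c \<times> chart_dom d, map_prod (snd c) (snd d))" by (auto simp: prod_atlas_def)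
  have ie: "is_chart Z e" and ic: "is_chart X c" and id: "is_chart Y d"
    using chart_coverD[OF Z e] chart_coverD[OF X cd(1)] chart_coverD[OF Y cd(2)] .
  let ?U = "snd e ` {x \<in> chart_dom e. (f x, g x) \<in> chart_dom p}"
  have oU: "open ?U"
    by (rule chart_image_open[OF ie _ cfg]) (simp only: p is_chart_prod[OF ic id])
  have 1: "smooth_on ?U (snd c \<circ> f \<circ> chart_inv e)"
    by (rule smooth_on_subset[OF smooth_mapD[OF f e cd(1)]]) (auto simp: p)
  have 2: "smooth_on ?U (snd d \<circ> g \<circ> chart_inv e)"
    by (rule smooth_on_subset[OF smooth_mapD[OF g e cd(2)]]) (auto simp: p)
  show "smooth_on ?U (snd p \<circ> (\<lambda>z. (f z, g z)) \<circ> chart_inv e)"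
    using smooth_on_Pair[OF oU 1 2] by (simp add: p comp_def)
qed

text \<open>In coordinates \<open>fst\<close> is the linear first projection followed by a
  transition map of \<open>X\<close>, because the chart on the target is arbitrary.\<close>

lemma smooth_map_fst:
  assumes X: "smooth_atlas X A" and Y: "chart_cover Y B"
  shows "smooth_map (prod_topology X Y) (prod_atlas A B) X A fst"
  unfolding smooth_map_def
proof (intro conjI ballI)
  note X' = smooth_atlas_chart_cover[OF X] and Y' = Y
  show cf: "continuous_map (prod_topology X Y) X fst" by (rule continuous_map_fst)
  fix p e assume "p \<in> prod_atlas A B" and e: "e \<in> A"
  then obtain c d where cd: "c \<in> A" "d \<in> B"
    and p: "p = (chart_dom c \<times> chart_dom d, map_prod (snd c) (snd d))" by (auto simp: prod_atlas_def)
  have ie: "is_chart X e" and ic: "is_chart X c" and id: "is_chart Y d"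
    using e cd chart_coverD[OF X'] chart_coverD[OF Y'] by blast+
  let ?U = "snd p ` {x \<in> chart_dom p. fst x \<in> chart_dom e}"
  have oU: "open ?U"
    by (rule chart_image_open[OF _ ie cf]) (simp only: p is_chart_prod[OF ic id])
  have tr: "smooth_on (snd c ` (chart_dom c \<inter> chart_dom e)) (snd e \<circ> chart_inv c)"
    using X cd e by (auto simp: smooth_atlas_def)
  have oT: "open (snd c ` (chart_dom c \<inter> chart_dom e))"
    by (rule is_chart_open_image[OF ic]) (auto intro: openin_Int is_chart_openin ic ie)
  have sub: "fst ` ?U \<subseteq> snd c ` (chart_dom c \<inter> chart_dom e)" by (auto simp: p)
  have "smooth_on ?U (\<lambda>x. (snd e \<circ> chart_inv c) (fst x))"
    by (rule smooth_on_compose[OF oU oT sub smooth_on_linear[OF bounded_linear_fst] tr])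
  then show "smooth_on ?U (snd e \<circ> fst \<circ> chart_inv p)"
    by (rule smooth_on_cong[OF oU, rotated])
      (auto simp: p chart_inv_map_prod[OF ic id] chart_inv_chart[OF ic])
qed

lemma smooth_map_snd:
  assumes X: "chart_cover X A" and Y: "smooth_atlas Y B"
  shows "smooth_map (prod_topology X Y) (prod_atlas A B) Y B snd"
  unfolding smooth_map_def
proof (intro conjI ballI)
  note Y' = smooth_atlas_chart_cover[OF Y] and X' = X
  show cf: "continuous_map (prod_topology X Y) Y snd" by (rule continuous_map_snd)
  fix p e assume "p \<in> prod_atlas A B" and e: "e \<in> B"
  then obtain c d where cd: "c \<in> A" "d \<in> B"
    and p: "p = (chart_dom c \<times> chart_dom d, map_prod (snd c) (snd d))" by (auto simp: prod_atlas_def)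
  have ie: "is_chart Y e" and ic: "is_chart X c" and id: "is_chart Y d"
    using e cd chart_coverD[OF X'] chart_coverD[OF Y'] by blast+
  let ?U = "snd p ` {x \<in> chart_dom p. snd x \<in> chart_dom e}"
  have oU: "open ?U"
    by (rule chart_image_open[OF _ ie cf]) (simp only: p is_chart_prod[OF ic id])
  have tr: "smooth_on (snd d ` (chart_dom d \<inter> chart_dom e)) (snd e \<circ> chart_inv d)"
    using Y cd e by (auto simp: smooth_atlas_def)
  have oT: "open (snd d ` (chart_dom d \<inter> chart_dom e))"
    by (rule is_chart_open_image[OF id]) (auto intro: openin_Int is_chart_openin id ie)
  have sub: "snd ` ?U \<subseteq> snd d ` (chart_dom d \<inter> chart_dom e)" by (auto simp: p)
  have "smooth_on ?U (\<lambda>x. (snd e \<circ> chart_inv d) (snd x))"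
    by (rule smooth_on_compose[OF oU oT sub smooth_on_linear[OF bounded_linear_snd] tr])
  then show "smooth_on ?U (snd e \<circ> snd \<circ> chart_inv p)"
    by (rule smooth_on_cong[OF oU, rotated])
      (auto simp: p chart_inv_map_prod[OF ic id] chart_inv_chart[OF id])
qed

section \<open>Differentials in charts and the chain rule\<close>

lemma smooth_map_has_derivative:
  assumes "smooth_map X A Y B f" "c \<in> A" "d \<in> B" "p \<in> chart_dom c" "f p \<in> chart_dom d"
  shows "(snd d \<circ> f \<circ> chart_inv c has_derivative differential_in c d f p) (at (snd c p))"
  unfolding differential_in_def
  by (rule smooth_on_has_derivative[OF smooth_mapD[OF assms(1-3)]]) (use assms(4,5) in blast)

lemma differential_in_linear:
  assumes "smooth_map X A Y B f" "c \<in> A" "d \<in> B" "p \<in> chart_dom c" "f p \<in> chart_dom d"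
  shows "bounded_linear (differential_in c d f p)"
  using smooth_map_has_derivative[OF assms] by (rule has_derivative_bounded_linear)

lemma differential_in_eqI:
  "(snd d \<circ> f \<circ> chart_inv c has_derivative f') (at (snd c p)) \<Longrightarrow> differential_in c d f p = f'"
  unfolding differential_in_def by (rule frechet_derivative_at[symmetric])

lemma differential_in_compose:
  assumes X: "chart_cover X A" and Y: "chart_cover Y B"
    and f: "smooth_map X A Y B f" and g: "smooth_map Y B Z C g"
    and c: "c \<in> A" "p \<in> chart_dom c" and d: "d \<in> B" "f p \<in> chart_dom d"
    and e: "e \<in> C" "g (f p) \<in> chart_dom e"
  shows "differential_in c e (\<lambda>x. g (f x)) p v = differential_in d e g (f p) (differential_in c d f p v)"
proof -
  have ic: "is_chart X c" and id: "is_chart Y d"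
    using chart_coverD[OF X c(1)] chart_coverD[OF Y d(1)] .
  let ?U = "snd c ` {x \<in> chart_dom c. f x \<in> chart_dom d}"
  have oU: "open ?U" by (rule chart_image_open[OF ic id smooth_map_continuous[OF f]])
  have p: "(snd d \<circ> f \<circ> chart_inv c) (snd c p) = snd d (f p)"
    using c by (simp add: chart_inv_chart[OF ic])
  have "((\<lambda>x. (snd e \<circ> g \<circ> chart_inv d) ((snd d \<circ> f \<circ> chart_inv c) x)) has_derivative
      (\<lambda>v. differential_in d e g (f p) (differential_in c d f p v))) (at (snd c p))"
    by (rule has_derivative_compose[OF smooth_map_has_derivative[OF f c(1) d(1) c(2) d(2)]])
      (simp only: p smooth_map_has_derivative[OF g d(1) e(1) d(2) e(2)])
  then have "(snd e \<circ> (\<lambda>x. g (f x)) \<circ> chart_inv c has_derivative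
      (\<lambda>v. differential_in d e g (f p) (differential_in c d f p v))) (at (snd c p))"
    by (rule has_derivative_transform_within_open[OF _ oU])
      (use c d in \<open>auto simp: chart_inv_chart[OF ic] chart_inv_chart[OF id]\<close>)
  from differential_in_eqI[OF this] show ?thesis by simp
qed

lemma differential_in_cong:
  assumes "chart_cover X A" "c \<in> A" "p \<in> chart_dom c" "\<And>x. x \<in> chart_dom c \<Longrightarrow> f x = g x"
    and "smooth_map X A Y B f" "d \<in> B" "f p \<in> chart_dom d"
  shows "differential_in c d f p = differential_in c d g p"
proof -
  have ic: "is_chart X c" using assms by (blast intro: chart_coverD)
  have "(snd d \<circ> g \<circ> chart_inv c has_derivative differential_in c d f p) (at (snd c p))"
    by (rule has_derivative_transform_within_open[OF smooth_map_has_derivative[OF assms(5,2,6,3,7)]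
          is_chart_open_image[OF ic is_chart_openin[OF ic]]])
      (use assms in \<open>auto simp: chart_inv_chart[OF ic]\<close>)
  from differential_in_eqI[OF this] show ?thesis by simp
qed

lemma differential_in_id:
  assumes "chart_cover X A" "c \<in> A" "p \<in> chart_dom c"
  shows "differential_in c c (\<lambda>x. x) p v = v"
proof -
  have ic: "is_chart X c" using assms by (blast intro: chart_coverD)
  have "(snd c \<circ> (\<lambda>x. x) \<circ> chart_inv c has_derivative (\<lambda>v. v)) (at (snd c p))"
    by (rule has_derivative_transform_within_open[OF has_derivative_ident
          is_chart_open_image[OF ic is_chart_openin[OF ic]]])
      (use assms in \<open>auto simp: chart_inv_chart[OF ic]\<close>)
  from differential_in_eqI[OF this] show ?thesis by simp
qed

section \<open>The adjoint representation\<close>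

lemma has_derivative_partial:
  fixes F :: "'a::euclidean_space \<times> 'b::euclidean_space \<Rightarrow> 'c::euclidean_space"
  assumes "(F has_derivative F') (at (a, b))"
  shows "((\<lambda>y. F (y, b)) has_derivative (\<lambda>u. F' (u, 0))) (at a)"
    and "((\<lambda>y. F (a, y)) has_derivative (\<lambda>u. F' (0, u))) (at b)"
proof -
  have "((\<lambda>y. (y, b)) has_derivative (\<lambda>u. (u, 0))) (at a)"
    by (intro has_derivative_Pair has_derivative_ident has_derivative_const)
  from has_derivative_compose[OF this assms]
  show "((\<lambda>y. F (y, b)) has_derivative (\<lambda>u. F' (u, 0))) (at a)" .
  have "((\<lambda>y. (a, y)) has_derivative (\<lambda>u. (0, u))) (at b)"
    by (intro has_derivative_Pair has_derivative_ident has_derivative_const)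
  from has_derivative_compose[OF this assms]
  show "((\<lambda>y. F (a, y)) has_derivative (\<lambda>u. F' (0, u))) (at b)" .
qed

text \<open>Here \<open>m\<close> is the multiplication and \<open>K\<close> the conjugation \<open>(g, h) \<mapsto> g h g\<inverse>\<close> of a
  local Lie group; differentiating \<open>g h = (g h g\<inverse>) g\<close> first in \<open>h\<close> and then in \<open>g\<close>
  shows that the derivative of the adjoint representation is the bracket.\<close>

lemma local_lie_group_bracket:
  fixes m K :: "'e::euclidean_space \<times> 'e \<Rightarrow> 'e" and z0 :: 'e
  defines "P \<equiv> \<lambda>w x. frechet_derivative m (at (x, z0)) (0, w)"
  assumes U: "open U" "z0 \<in> U" and M: "open M" and S: "open S"
    and m: "smooth_on M m" and K: "smooth_on S K"
    and mem: "\<And>x. x \<in> U \<Longrightarrow> (x, z0) \<in> S \<and> (x, z0) \<in> M \<and> (z0, x) \<in> M"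
    and unit: "\<And>x. x \<in> U \<Longrightarrow> m (x, z0) = x \<and> m (z0, x) = x"
    and K0: "\<And>x. x \<in> U \<Longrightarrow> K (x, z0) = z0"
    and mK: "\<And>x z. (x, z) \<in> S \<Longrightarrow> (x, z) \<in> M \<Longrightarrow> (K (x, z), x) \<in> M \<and> m (K (x, z), x) = m (x, z)"
  shows "P w z0 = w"
    and "(P w has_derivative frechet_derivative (P w) (at z0)) (at z0)"
    and "((\<lambda>x. frechet_derivative K (at (x, z0)) (0, w)) has_derivative
      (\<lambda>v. frechet_derivative (P w) (at z0) v - frechet_derivative (P v) (at z0) w)) (at z0)"
proof -
  let ?D = "\<lambda>p. frechet_derivative m (at p)"
  let ?K = "\<lambda>w x. frechet_derivative K (at (x, z0)) (0, w)"
  have Dm: "(m has_derivative ?D p) (at p)" if "p \<in> M" for p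
    by (rule smooth_on_has_derivative[OF m that])
  have zz: "(z0, z0) \<in> M" "(z0, z0) \<in> S" using mem[OF U(2)] by simp_all
  have P0: "?D (z0, z0) (0, w) = w" for w
  proof -
    have "((\<lambda>y. m (z0, y)) has_derivative (\<lambda>u. u)) (at z0)"
      by (rule has_derivative_transform_within_open[OF has_derivative_ident U]) (simp add: unit)
    from has_derivative_unique[OF this has_derivative_partial(2)[OF Dm[OF zz(1)]]]
    show ?thesis by metis
  qed
  then show "P w z0 = w" by (simp add: P_def)
  have R0: "?D (z0, z0) (w, 0) = w" for w
  proof -
    have "((\<lambda>y. m (y, z0)) has_derivative (\<lambda>u. u)) (at z0)"
      by (rule has_derivative_transform_within_open[OF has_derivative_ident U]) (simp add: unit)
    from has_derivative_unique[OF this has_derivative_partial(1)[OF Dm[OF zz(1)]]]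
    show ?thesis by metis
  qed
  let ?DD = "\<lambda>u. frechet_derivative (\<lambda>p. ?D p u) (at (z0, z0))"
  have DD: "((\<lambda>p. ?D p u) has_derivative ?DD u) (at (z0, z0))" for u
    by (rule smooth_on_has_derivative[OF smooth_on_frechet_derivative[OF m] zz(1)])
  have dP: "(P w has_derivative (\<lambda>v. ?DD (0, w) (v, 0))) (at z0)" for w
    unfolding P_def by (rule has_derivative_partial(1)[OF DD])
  have fP: "frechet_derivative (P w) (at z0) = (\<lambda>v. ?DD (0, w) (v, 0))" for w
    by (rule frechet_derivative_at[OF dP, symmetric])
  show "(P w has_derivative frechet_derivative (P w) (at z0)) (at z0)"
    unfolding fP by (rule dP)
  \<comment> \<open>Symmetry of second derivatives moves the varying direction to the other slot, so
    that this derivative is expressed by the same mixed derivative \<open>?DD\<close> as that of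
    \<open>P\<close>.\<close>
  have dR: "((\<lambda>x. ?D (z0, x) (u, 0)) has_derivative (\<lambda>v. ?DD (0, v) (u, 0))) (at z0)" for u
    using has_derivative_partial(2)[OF DD, of "(u, 0)"]
      mixed_derivatives_symmetric[OF M zz(1) m, of "(u, 0)"] by simp
  have lin: "linear (?D p)" if "p \<in> M" for p
    using Dm[OF that] has_derivative_linear by blast
  have eq: "P w x = ?D (z0, x) (?K w x, 0)" if x: "x \<in> U" for w x
  proof -
    \<comment> \<open>The identity for \<open>m (K (x, z), x)\<close> holds only where both local
      maps are defined; \<open>?V\<close> is the open set of admissible \<open>z\<close> for the
      fixed \<open>x\<close>.\<close>
    let ?V = "(\<lambda>z. (x, z)) -` (S \<inter> M)"
    have V: "open ?V" by (intro open_vimage open_Int S M continuous_intros)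
    have z: "z0 \<in> ?V" using mem[OF x] by simp
    have 1: "((\<lambda>z. K (x, z)) has_derivative (\<lambda>w. ?K w x)) (at z0)"
      by (rule has_derivative_partial(2)[OF smooth_on_has_derivative[OF K]]) (use mem[OF x] in simp)
    have 2: "((\<lambda>y. m (y, x)) has_derivative (\<lambda>u. ?D (z0, x) (u, 0))) (at (K (x, z0)))"
      unfolding K0[OF x] by (rule has_derivative_partial(1)[OF Dm]) (use mem[OF x] in simp)
    have "((\<lambda>z. m (x, z)) has_derivative (\<lambda>w. ?D (z0, x) (?K w x, 0))) (at z0)"
      by (rule has_derivative_transform_within_open[OF has_derivative_compose[OF 1 2] V z])
        (use mK in auto)
    moreover have "((\<lambda>z. m (x, z)) has_derivative (\<lambda>w. ?D (x, z0) (0, w))) (at z0)"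
      by (rule has_derivative_partial(2)[OF Dm]) (use mem[OF x] in simp)
    ultimately have "(\<lambda>w. ?D (z0, x) (?K w x, 0)) = (\<lambda>w. ?D (x, z0) (0, w))"
      by (rule has_derivative_unique)
    then show ?thesis unfolding P_def by metis
  qed
  have K1: "?K w z0 = w" using eq[OF U(2), of w] R0 P0 by (simp add: P_def)
  let ?K' = "frechet_derivative (?K w) (at z0)"
  have dK: "(?K w has_derivative ?K') (at z0)"
  proof -
    have "(\<lambda>p. frechet_derivative K (at p) (0, w)) differentiable (at (z0, z0))"
      using smooth_on_has_derivative[OF smooth_on_frechet_derivative[OF K] zz(2)]
      unfolding differentiable_def by blast
    then obtain F' where "((\<lambda>p. frechet_derivative K (at p) (0, w)) has_derivative F') (at (z0, z0))"
      unfolding differentiable_def by blast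
    from has_derivative_partial(1)[OF this] show ?thesis
      using frechet_derivative_works unfolding differentiable_def by blast
  qed
  \<comment> \<open>The direction \<open>?K w x\<close> depends on \<open>x\<close>. Expanding it in
    the basis leaves scalar factors times derivatives in fixed directions, to which the product rule
    applies.\<close>
  have sumeq: "P w x = (\<Sum>i\<in>Basis. (?K w x \<bullet> i) *\<^sub>R ?D (z0, x) (i, 0))" if x: "x \<in> U" for x
  proof -
    have l: "linear (\<lambda>u. ?D (z0, x) (u, 0))"
      using has_derivative_linear[OF has_derivative_partial(1)[OF Dm]] mem[OF x] by blast
    have "P w x = ?D (z0, x) (\<Sum>i\<in>Basis. (?K w x \<bullet> i) *\<^sub>R i, 0)"
      using eq[OF x] by (simp add: euclidean_representation)
    also have "\<dots> = (\<Sum>i\<in>Basis. (?K w x \<bullet> i) *\<^sub>R ?D (z0, x) (i, 0))"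
      unfolding linear_sum[OF l] linear_cmul[OF l] ..
    finally show ?thesis .
  qed
  have "((\<lambda>x. \<Sum>i\<in>Basis. (?K w x \<bullet> i) *\<^sub>R ?D (z0, x) (i, 0)) has_derivative
      (\<lambda>v. \<Sum>i\<in>Basis. (?K w z0 \<bullet> i) *\<^sub>R ?DD (0, v) (i, 0) + (?K' v \<bullet> i) *\<^sub>R ?D (z0, z0) (i, 0))) (at z0)"
    by (intro has_derivative_sum has_derivative_scaleR dR
        bounded_linear.has_derivative[OF bounded_linear_inner_left dK])
  then have "(P w has_derivative
      (\<lambda>v. \<Sum>i\<in>Basis. (?K w z0 \<bullet> i) *\<^sub>R ?DD (0, v) (i, 0) + (?K' v \<bullet> i) *\<^sub>R ?D (z0, z0) (i, 0))) (at z0)"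
    by (rule has_derivative_transform_within_open[OF _ U]) (simp add: sumeq)
  then have "frechet_derivative (P w) (at z0) v =
      (\<Sum>i\<in>Basis. (?K w z0 \<bullet> i) *\<^sub>R ?DD (0, v) (i, 0) + (?K' v \<bullet> i) *\<^sub>R ?D (z0, z0) (i, 0))" for v
    by (rule fun_cong[OF frechet_derivative_at[symmetric]])
  then have main: "frechet_derivative (P w) (at z0) v =
      (\<Sum>i\<in>Basis. (w \<bullet> i) *\<^sub>R ?DD (0, v) (i, 0)) + ?K' v" for v
    unfolding K1 R0 sum.distrib euclidean_representation .
  have "(\<Sum>i\<in>Basis. (w \<bullet> i) *\<^sub>R ?DD (0, v) (i, 0)) = frechet_derivative (P v) (at z0) w" for v
  proof -
    have l: "linear (\<lambda>u. ?DD (0, v) (u, 0))" using has_derivative_linear[OF dP] .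
    have "?DD (0, v) (\<Sum>i\<in>Basis. (w \<bullet> i) *\<^sub>R i, 0) = (\<Sum>i\<in>Basis. (w \<bullet> i) *\<^sub>R ?DD (0, v) (i, 0))"
      unfolding linear_sum[OF l] linear_cmul[OF l] ..
    then show ?thesis by (simp add: fP euclidean_representation)
  qed
  then have "?K' v = frechet_derivative (P w) (at z0) v - frechet_derivative (P v) (at z0) w" for v
    using main[of v] by (simp only: algebra_simps)
  then have "?K' = (\<lambda>v. frechet_derivative (P w) (at z0) v - frechet_derivative (P v) (at z0) w)"
    by (rule ext)
  then show "(?K w has_derivative
      (\<lambda>v. frechet_derivative (P w) (at z0) v - frechet_derivative (P v) (at z0) w)) (at z0)"
    using dK by (simp only:)
qed

section \<open>The adjoint representation in a fixed chart at the identity\<close>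

locale lie_group_chart = group G for G :: "('a, 'm) monoid_scheme" (structure) +
  fixes X :: "'a topology" and A :: "('a, 'e::euclidean_space) chart set" and c :: "('a, 'e) chart"
  assumes lie: "lie_group G X A" and chart: "c \<in> A" and one_dom: "\<one> \<in> chart_dom c"
begin

lemma atlas: "smooth_atlas X A"
  using lie by (simp add: lie_group_def smooth_manifold_def)

lemma cover: "chart_cover X A"
  by (rule smooth_atlas_chart_cover[OF atlas])

lemma topspace_eq: "topspace X = carrier G"
  using lie by (simp add: lie_group_def)

lemma is_chart: "is_chart X c"
  by (rule chart_coverD[OF cover chart])

lemma dom_carrier: "g \<in> chart_dom c \<Longrightarrow> g \<in> carrier G"
  using openin_subset[OF is_chart_openin[OF is_chart]] topspace_eq by blast

lemma smooth_map_mult: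
  assumes Z: "chart_cover Z C" and "smooth_map Z C X A f" "smooth_map Z C X A g"
  shows "smooth_map Z C X A (\<lambda>z. f z \<otimes> g z)"
proof -
  have "smooth_map (prod_topology X X) (prod_atlas A A) X A (\<lambda>(x, y). x \<otimes> y)"
    using lie by (simp add: lie_group_def)
  from smooth_map_compose[OF Z chart_cover_prod[OF cover cover] cover
      smooth_map_Pair[OF Z cover cover assms(2,3)] this]
  show ?thesis by simp
qed

lemma smooth_map_inv:
  assumes Z: "chart_cover Z C" and "smooth_map Z C X A f"
  shows "smooth_map Z C X A (\<lambda>z. inv (f z))"
  by (rule smooth_map_compose[OF Z cover cover assms(2)]) (use lie in \<open>simp add: lie_group_def\<close>)

lemma smooth_map_conj:
  "g \<in> carrier G \<Longrightarrow> smooth_map X A X A (\<lambda>x. g \<otimes> x \<otimes> inv g)"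
  by (intro smooth_map_mult cover smooth_map_const smooth_map_id atlas) (simp_all add: topspace_eq)

definition Ad :: "'a \<Rightarrow> 'e \<Rightarrow> 'e" where
  "Ad g = differential_in c c (\<lambda>x. g \<otimes> x \<otimes> inv g) \<one>"

lemma conj_one_dom: "g \<in> carrier G \<Longrightarrow> g \<otimes> \<one> \<otimes> inv g \<in> chart_dom c"
  by (simp add: one_dom)

lemma Ad_bounded_linear: "g \<in> carrier G \<Longrightarrow> bounded_linear (Ad g)"
  unfolding Ad_def by (rule differential_in_linear[OF smooth_map_conj chart chart one_dom conj_one_dom])

lemma Ad_mult:
  assumes "g \<in> carrier G" "h \<in> carrier G"
  shows "Ad (g \<otimes> h) v = Ad g (Ad h v)"
proof -
  have gh: "g \<otimes> h \<in> carrier G" using assms by simp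
  have eq: "Ad (g \<otimes> h) = differential_in c c (\<lambda>x. g \<otimes> (h \<otimes> x \<otimes> inv h) \<otimes> inv g) \<one>"
    unfolding Ad_def
    by (rule differential_in_cong[OF cover chart one_dom _ smooth_map_conj[OF gh] chart conj_one_dom[OF gh]])
      (use assms dom_carrier in \<open>simp add: inv_mult_group m_assoc\<close>)
  have "Ad (g \<otimes> h) v = differential_in c c (\<lambda>x. g \<otimes> x \<otimes> inv g) (h \<otimes> \<one> \<otimes> inv h) (Ad h v)"
    unfolding eq Ad_def[of h]
    by (rule differential_in_compose[OF cover cover smooth_map_conj[OF assms(2)]
          smooth_map_conj[OF assms(1)] chart one_dom chart _ chart])
      (use assms one_dom in simp_all)
  also have "h \<otimes> \<one> \<otimes> inv h = \<one>" using assms by simp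
  finally show ?thesis by (simp add: Ad_def)
qed

lemma Ad_one: "Ad \<one> v = v"
proof -
  have "Ad \<one> = differential_in c c (\<lambda>x. x) \<one>"
    unfolding Ad_def
    by (rule differential_in_cong[OF cover chart one_dom _ smooth_map_conj chart conj_one_dom])
      (simp_all add: dom_carrier)
  then show ?thesis by (simp add: differential_in_id[OF cover chart one_dom])
qed

lemma Ad_inv_cancel:
  assumes "g \<in> carrier G" shows "Ad g (Ad (inv g) v) = v" "Ad (inv g) (Ad g v) = v"
  using assms Ad_mult[of g "inv g" v] Ad_mult[of "inv g" g v] by (simp_all add: Ad_one)

text \<open>The derivative of Ad at the identity is ad, with the bracket of left-invariant fields as
  ad. Multiplication and conjugation are read in the chart and fed to the local computation, where
  \<open>P w\<close> becomes the left-invariant field of \<open>w\<close> and the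
  \<open>z\<close>-derivative of \<open>K\<close> becomes Ad.\<close>

lemma Ad_has_derivative:
  "((\<lambda>x. Ad (chart_inv c x) w) has_derivative (\<lambda>v. lie_bracket G c v w)) (at (snd c \<one>))"
proof -
  let ?p = "(chart_dom c \<times> chart_dom c, map_prod (snd c) (snd c))"
  let ?mul = "\<lambda>z. fst z \<otimes> snd z" and ?con = "\<lambda>z. fst z \<otimes> snd z \<otimes> inv (fst z)"
  let ?z0 = "snd c \<one>" and ?U = "snd c ` chart_dom c"
  let ?M = "snd ?p ` {z \<in> chart_dom ?p. ?mul z \<in> chart_dom c}"
  let ?S = "snd ?p ` {z \<in> chart_dom ?p. ?con z \<in> chart_dom c}"
  define m where "m = snd c \<circ> ?mul \<circ> chart_inv ?p"
  define K where "K = snd c \<circ> ?con \<circ> chart_inv ?p"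
  have pA: "?p \<in> prod_atlas A A" using chart unfolding prod_atlas_def by blast
  note coverX = chart_cover_prod[OF cover cover]
  have fs: "smooth_map (prod_topology X X) (prod_atlas A A) X A fst"
    "smooth_map (prod_topology X X) (prod_atlas A A) X A snd"
    by (rule smooth_map_fst[OF atlas cover], rule smooth_map_snd[OF cover atlas])
  have sm: "smooth_map (prod_topology X X) (prod_atlas A A) X A ?mul"
    by (intro smooth_map_mult coverX fs)
  have sk: "smooth_map (prod_topology X X) (prod_atlas A A) X A ?con"
    by (intro smooth_map_mult smooth_map_inv coverX fs)
  have oU: "open ?U" by (rule is_chart_open_image[OF is_chart is_chart_openin[OF is_chart]]) simp
  have z0: "?z0 \<in> ?U" using one_dom by (rule imageI)
  have ip: "is_chart (prod_topology X X) ?p" by (rule is_chart_prod[OF is_chart is_chart])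
  have oM: "open ?M" by (rule chart_image_open[OF ip is_chart smooth_map_continuous[OF sm]])
  have oS: "open ?S" by (rule chart_image_open[OF ip is_chart smooth_map_continuous[OF sk]])
  have m: "smooth_on ?M m" unfolding m_def by (rule smooth_mapD[OF sm pA chart])
  have K: "smooth_on ?S K" unfolding K_def by (rule smooth_mapD[OF sk pA chart])
  have m_eq: "m (snd c g, snd c h) = snd c (g \<otimes> h)" if "g \<in> chart_dom c" "h \<in> chart_dom c" for g h
    using that by (simp add: m_def chart_inv_map_prod[OF is_chart is_chart])
  have K_eq: "K (snd c g, snd c h) = snd c (g \<otimes> h \<otimes> inv g)"
    if "g \<in> chart_dom c" "h \<in> chart_dom c" for g h
    using that by (simp add: K_def chart_inv_map_prod[OF is_chart is_chart])
  have M_I: "(snd c g, snd c h) \<in> ?M"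
    if "g \<in> chart_dom c" "h \<in> chart_dom c" "g \<otimes> h \<in> chart_dom c" for g h
    by (rule image_eqI[where x="(g, h)"]) (use that in simp_all)
  have S_I: "(snd c g, snd c h) \<in> ?S"
    if "g \<in> chart_dom c" "h \<in> chart_dom c" "g \<otimes> h \<otimes> inv g \<in> chart_dom c" for g h
    by (rule image_eqI[where x="(g, h)"]) (use that in simp_all)
  have mem: "(x, ?z0) \<in> ?S \<and> (x, ?z0) \<in> ?M \<and> (?z0, x) \<in> ?M" if x: "x \<in> ?U" for x
  proof -
    obtain g where g: "g \<in> chart_dom c" "x = snd c g" using x by blast
    show ?thesis unfolding g(2)
      by (intro conjI S_I M_I g(1) one_dom) (use g(1) dom_carrier one_dom in simp_all)
  qed
  have unit: "m (x, ?z0) = x \<and> m (?z0, x) = x" if "x \<in> ?U" for x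
    using that by (auto simp: m_eq one_dom dom_carrier)
  have K0: "K (x, ?z0) = ?z0" if "x \<in> ?U" for x
    using that by (auto simp: K_eq one_dom dom_carrier)
  have mK: "(K (x, z), x) \<in> ?M \<and> m (K (x, z), x) = m (x, z)"
    if S: "(x, z) \<in> ?S" and M: "(x, z) \<in> ?M" for x z
  proof -
    obtain g h where gh: "g \<in> chart_dom c" "h \<in> chart_dom c" "g \<otimes> h \<in> chart_dom c"
      "x = snd c g" "z = snd c h" using M by auto
    obtain g' h' where gh': "g' \<in> chart_dom c" "h' \<in> chart_dom c" "g' \<otimes> h' \<otimes> inv g' \<in> chart_dom c"
      "x = snd c g'" "z = snd c h'" using S by auto
    have "g' = g" "h' = h" using gh gh' chart_inv_chart[OF is_chart] by metis+
    then have con: "g \<otimes> h \<otimes> inv g \<in> chart_dom c" using gh' by simp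
    have "g \<otimes> h \<otimes> inv g \<otimes> g = g \<otimes> h" using gh(1,2) dom_carrier by (simp add: m_assoc)
    then show ?thesis
      unfolding gh(4,5) K_eq[OF gh(1,2)] m_eq[OF gh(1,2)] m_eq[OF con gh(1)]
      using M_I[OF con gh(1)] gh(3) by simp
  qed
  define P where "P = (\<lambda>w x. frechet_derivative m (at (x, ?z0)) (0, w))"
  note local = local_lie_group_bracket[OF oU z0 oM oS m K]
  have L: "P w ?z0 = w"
    "(P w has_derivative frechet_derivative (P w) (at ?z0)) (at ?z0)"
    "((\<lambda>x. frechet_derivative K (at (x, ?z0)) (0, w)) has_derivative
      (\<lambda>v. frechet_derivative (P w) (at ?z0) v - frechet_derivative (P v) (at ?z0) w)) (at ?z0)" for w
    unfolding P_def
    by ((rule local; (rule mem unit K0 mK; assumption)))+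
  have Ad_eq: "frechet_derivative K (at (x, ?z0)) (0, w) = Ad (chart_inv c x) w" if x: "x \<in> ?U" for x
  proof -
    obtain g where g: "g \<in> chart_dom c" "x = snd c g" using x by blast
    have "((\<lambda>z. K (x, z)) has_derivative (\<lambda>w. frechet_derivative K (at (x, ?z0)) (0, w))) (at ?z0)"
      using has_derivative_partial(2)[OF smooth_on_has_derivative[OF K]] mem[OF x] by blast
    then have "(snd c \<circ> (\<lambda>x. g \<otimes> x \<otimes> inv g) \<circ> chart_inv c has_derivative
        (\<lambda>w. frechet_derivative K (at (x, ?z0)) (0, w))) (at ?z0)"
      by (rule has_derivative_transform_within_open[OF _ oU z0])
        (use g in \<open>auto simp: K_eq chart_inv_chart[OF is_chart]\<close>)
    from differential_in_eqI[OF this] show ?thesis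
      by (simp add: Ad_def g chart_inv_chart[OF is_chart])
  qed
  have field_eq: "P w x = left_inv_field G c w x" if x: "x \<in> ?U" for w x
  proof -
    obtain g where g: "g \<in> chart_dom c" "x = snd c g" using x by blast
    have "((\<lambda>z. m (x, z)) has_derivative (\<lambda>w. P w x)) (at ?z0)"
      unfolding P_def using has_derivative_partial(2)[OF smooth_on_has_derivative[OF m]] mem[OF x] by blast
    then have "(snd c \<circ> (\<lambda>h. g \<otimes> h) \<circ> chart_inv c has_derivative (\<lambda>w. P w x)) (at ?z0)"
      by (rule has_derivative_transform_within_open[OF _ oU z0])
        (use g in \<open>auto simp: m_eq chart_inv_chart[OF is_chart]\<close>)
    from differential_in_eqI[OF this] show ?thesis
      by (simp add: left_inv_field_def g chart_inv_chart[OF is_chart])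
  qed
  have dfield: "frechet_derivative (left_inv_field G c w) (at ?z0) = frechet_derivative (P w) (at ?z0)" for w
    by (rule frechet_derivative_at[symmetric],
        rule has_derivative_transform_within_open[OF L(2) oU z0 field_eq])
  have "lie_bracket G c v w = frechet_derivative (P w) (at ?z0) v - frechet_derivative (P v) (at ?z0) w" for v
    unfolding lie_bracket_def vector_field_bracket_def dfield field_eq[OF z0, symmetric] L(1) ..
  then have "(\<lambda>v. lie_bracket G c v w) =
      (\<lambda>v. frechet_derivative (P w) (at ?z0) v - frechet_derivative (P v) (at ?z0) w)" by (rule ext)
  with L(3)[of w] show ?thesis
    by (simp only:) (rule has_derivative_transform_within_open[OF _ oU z0 Ad_eq])
qed

end

section \<open>Connected Lie subgroups\<close>

lemma has_derivative_chart_transform: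
  assumes "is_chart Y d" "p \<in> chart_dom d" "openin Y W" "p \<in> W"
    and "(F has_derivative F') (at (snd d p))"
    and "\<And>x. x \<in> chart_dom d \<Longrightarrow> x \<in> W \<Longrightarrow> F (snd d x) = f x"
  shows "((\<lambda>y. f (chart_inv d y)) has_derivative F') (at (snd d p))"
proof -
  have "open (snd d ` (chart_dom d \<inter> W))"
    by (rule is_chart_open_image[OF assms(1)]) (auto intro: openin_Int is_chart_openin assms(1,3))
  then show ?thesis
    by (rule has_derivative_transform_within_open[OF assms(5)])
      (use assms in \<open>auto simp: chart_inv_chart[OF assms(1)]\<close>)
qed

text \<open>A coordinate ball is connected, so a function with vanishing derivative is constant on
  it. The set \<open>W\<close> serves functions that are differentiable only on part of a chart,
  such as the quotient in \<open>Ad_eigenvector\<close>.\<close>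

lemma locally_constant_of_zero_derivative:
  fixes f :: "'b \<Rightarrow> 'c::real_normed_vector"
  assumes d: "is_chart Y d" and p: "p \<in> chart_dom d" and W: "openin Y W" "p \<in> W"
    and der: "\<And>q. q \<in> chart_dom d \<Longrightarrow> q \<in> W \<Longrightarrow>
      ((\<lambda>y. f (chart_inv d y)) has_derivative (\<lambda>u. 0)) (at (snd d q))"
  shows "\<exists>N. openin Y N \<and> p \<in> N \<and> N \<subseteq> W \<and> (\<forall>q\<in>N. f q = f p)"
proof -
  have "open (snd d ` (chart_dom d \<inter> W))"
    by (rule is_chart_open_image[OF d]) (auto intro: openin_Int is_chart_openin d W(1))
  then obtain r where r: "r > 0" "ball (snd d p) r \<subseteq> snd d ` (chart_dom d \<inter> W)"
    using p W(2) by (meson IntI image_eqI openE)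
  let ?N = "{x \<in> chart_dom d. snd d x \<in> ball (snd d p) r}"
  have sub: "q \<in> W" if "q \<in> ?N" for q
    using that r(2) is_chart_inj[OF d] by (auto dest: inj_onD)
  have const: "f q = f p" if q: "q \<in> ?N" for q
  proof -
    have "f (chart_inv d (snd d q)) = f (chart_inv d (snd d p))"
    proof (rule has_derivative_zero_unique_connected[of "ball (snd d p) r" "\<lambda>y. f (chart_inv d y)"])
      fix y assume "y \<in> ball (snd d p) r"
      then obtain x where "x \<in> chart_dom d" "x \<in> W" "y = snd d x" using r(2) by blast
      then show "((\<lambda>y. f (chart_inv d y)) has_derivative (\<lambda>u. 0)) (at y)" using der by blast
    qed (use q r(1) in simp_all)
    then show ?thesis using q p by (simp add: chart_inv_chart[OF d])
  qed
  show ?thesis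
    by (intro exI[of _ ?N] conjI ballI is_chart_open_preimage[OF d open_ball] const)
      (use p r(1) sub in auto)
qed

text \<open>By local constancy every level set and its complement are open.\<close>

lemma constant_of_zero_derivative:
  fixes f :: "'b \<Rightarrow> 'c::real_normed_vector"
  assumes conn: "connected_space Y" and cov: "chart_cover Y B"
    and der: "\<And>p d. d \<in> B \<Longrightarrow> p \<in> chart_dom d \<Longrightarrow>
      ((\<lambda>y. f (chart_inv d y)) has_derivative (\<lambda>u. 0)) (at (snd d p))"
    and "p \<in> topspace Y" "q \<in> topspace Y"
  shows "f p = f q"
proof -
  have loc: "\<exists>N. openin Y N \<and> x \<in> N \<and> (\<forall>y\<in>N. f y = f x)" if x: "x \<in> topspace Y" for x
  proof -
    obtain d where d: "d \<in> B" "x \<in> chart_dom d" using chart_cover_obtain[OF cov x] .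
    show ?thesis
      using locally_constant_of_zero_derivative[OF chart_coverD[OF cov d(1)] d(2) openin_topspace x, of f]
        der[OF d(1)] by blast
  qed
  let ?E = "{x \<in> topspace Y. f x = f p}"
  have "openin Y ?E"
  proof (subst openin_subopen, safe)
    fix x assume x: "x \<in> topspace Y" "f x = f p"
    obtain N where N: "openin Y N" "x \<in> N" "\<forall>y\<in>N. f y = f x" using loc[OF x(1)] by blast
    have "N \<subseteq> ?E" using N(3) x(2) openin_subset[OF N(1)] by force
    then show "\<exists>N. openin Y N \<and> x \<in> N \<and> N \<subseteq> ?E" using N by blast
  qed
  moreover have "openin Y (topspace Y - ?E)"
  proof (subst openin_subopen, rule ballI)
    fix x assume x: "x \<in> topspace Y - ?E"
    then have "x \<in> topspace Y" by blast
    obtain N where N: "openin Y N" "x \<in> N" "\<forall>y\<in>N. f y = f x"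
      using loc[OF \<open>x \<in> topspace Y\<close>] by blast
    have "N \<subseteq> topspace Y - ?E" using N(3) x openin_subset[OF N(1)] by force
    then show "\<exists>N. openin Y N \<and> x \<in> N \<and> N \<subseteq> topspace Y - ?E" using N by blast
  qed
  ultimately have "?E = {} \<or> ?E = topspace Y"
    using conn unfolding connected_space_clopen_in closedin_def by blast
  moreover have "p \<in> ?E" using assms(4) by simp
  ultimately have "q \<in> ?E" using assms(5) by blast
  then show ?thesis by simp
qed

section \<open>The adjoint action of a connected Lie subgroup\<close>

locale connected_lie_subgroup = lie_group_chart G X A c
  for G :: "('a, 'm) monoid_scheme" (structure) and X
    and A :: "('a, 'e::euclidean_space) chart set" and c +
  fixes \<hh> :: "'e set" and H :: "'a set" and Y :: "'a topology"
    and B :: "('a, 'f::euclidean_space) chart set"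
  assumes sub: "connected_lie_subgroup_with_algebra G X A c \<hh> H Y B"
begin

lemma H_subgroup: "subgroup H G"
  using sub by (simp add: connected_lie_subgroup_with_algebra_def lie_subgroup_def)

lemma H_carrier: "h \<in> H \<Longrightarrow> h \<in> carrier G"
  by (rule subgroup.mem_carrier[OF H_subgroup])

lemma H_lie: "lie_group (G\<lparr>carrier := H\<rparr>) Y B"
  using sub by (simp add: connected_lie_subgroup_with_algebra_def lie_subgroup_def)

lemma H_connected: "connected_space Y"
  using sub by (simp add: connected_lie_subgroup_with_algebra_def)

lemma H_topspace: "topspace Y = H"
  using H_lie by (simp add: lie_group_def)

lemma H_atlas: "smooth_atlas Y B"
  using H_lie by (simp add: lie_group_def smooth_manifold_def)

lemma H_cover: "chart_cover Y B"
  by (rule smooth_atlas_chart_cover[OF H_atlas])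

lemma H_incl: "smooth_map Y B X A (\<lambda>x. x)"
  using sub
  by (simp add: connected_lie_subgroup_with_algebra_def lie_subgroup_def immersion_def)

lemma H_algebra: "d \<in> B \<Longrightarrow> \<one> \<in> chart_dom d \<Longrightarrow> range (differential_in d c (\<lambda>x. x) \<one>) = \<hh>"
  using sub by (simp add: connected_lie_subgroup_with_algebra_def)

lemma H_one: "\<one> \<in> H"
  by (rule subgroup.one_closed[OF H_subgroup])

lemma H_dom: "d \<in> B \<Longrightarrow> h \<in> chart_dom d \<Longrightarrow> h \<in> H"
  using openin_subset[OF is_chart_openin[OF chart_coverD[OF H_cover]]] H_topspace by blast

lemma H_one_chart:
  obtains d where "d \<in> B" "\<one> \<in> chart_dom d"
  using chart_cover_obtain[OF H_cover] H_one H_topspace by blast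

lemma H_smooth_map_mult:
  assumes "smooth_map Y B Y B f" "smooth_map Y B Y B g"
  shows "smooth_map Y B Y B (\<lambda>z. f z \<otimes> g z)"
proof -
  obtain d where "d \<in> B" "\<one> \<in> chart_dom d" by (rule H_one_chart)
  then interpret H: lie_group_chart "G\<lparr>carrier := H\<rparr>" Y B d
    using H_lie by (intro lie_group_chart.intro lie_group_chart_axioms.intro) (simp_all add: lie_group_def)
  show ?thesis using H.smooth_map_mult[OF H_cover assms] by simp
qed

lemma H_smooth_map_const: "h \<in> H \<Longrightarrow> smooth_map Y B Y B (\<lambda>x. h)"
  by (rule smooth_map_const) (simp add: H_topspace)

text \<open>Where \<open>\<tau>\<close> passes through the identity, the derivative of Ad after
  \<open>\<tau>\<close> is ad of the velocity of \<open>\<tau>\<close>. This velocity lies in the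
  subalgebra because \<open>\<tau>\<close> factors through the inclusion of \<open>H\<close>. The
  map \<open>Z\<close> is the same for all \<open>w\<close>. Translations by the inverse of
  \<open>p\<close> reduce every other point to this case.\<close>

lemma Ad_translate_has_derivative:
  assumes \<tau>: "smooth_map Y B Y B \<tau>" and d: "d \<in> B" "p \<in> chart_dom d" and p: "\<tau> p = \<one>"
  shows "\<exists>Z. (\<forall>u. Z u \<in> \<hh>) \<and> (\<forall>w. ((\<lambda>y. Ad (\<tau> (chart_inv d y)) w) has_derivative
      (\<lambda>u. lie_bracket G c (Z u) w)) (at (snd d p)))"
proof -
  obtain d1 where d1: "d1 \<in> B" "\<one> \<in> chart_dom d1" by (rule H_one_chart)
  have \<tau>X: "smooth_map Y B X A \<tau>"
    by (rule smooth_map_compose[OF H_cover H_cover cover \<tau> H_incl])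
  let ?Z = "differential_in d c \<tau> p"
  have "?Z u = differential_in d1 c (\<lambda>x. x) \<one> (differential_in d d1 \<tau> p u)" for u
    using differential_in_compose[OF H_cover H_cover \<tau> H_incl d d1(1) _ chart] d1(2) one_dom p
    by simp
  then have Z: "?Z u \<in> \<hh>" for u using H_algebra[OF d1] by blast
  have "((\<lambda>y. Ad (\<tau> (chart_inv d y)) w) has_derivative (\<lambda>u. lie_bracket G c (?Z u) w)) (at (snd d p))"
    for w
  proof -
    have id: "is_chart Y d" by (rule chart_coverD[OF H_cover d(1)])
    have v: "(snd c \<circ> \<tau> \<circ> chart_inv d) (snd d p) = snd c \<one>"
      using d(2) p by (simp add: chart_inv_chart[OF id])
    have 1: "(snd c \<circ> \<tau> \<circ> chart_inv d has_derivative ?Z) (at (snd d p))"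
      by (rule smooth_map_has_derivative[OF \<tau>X d(1) chart d(2)]) (simp add: p one_dom)
    have "((\<lambda>x. Ad (chart_inv c x) w) has_derivative (\<lambda>v. lie_bracket G c v w))
        (at ((snd c \<circ> \<tau> \<circ> chart_inv d) (snd d p)))"
      unfolding v by (rule Ad_has_derivative)
    from has_derivative_compose[OF 1 this]
    show ?thesis
    proof (rule has_derivative_chart_transform[OF id d(2), rotated 2])
      show "openin Y {x \<in> topspace Y. \<tau> x \<in> chart_dom c}"
        by (rule openin_continuous_map_preimage[OF smooth_map_continuous[OF \<tau>X] is_chart_openin[OF is_chart]])
      show "p \<in> {x \<in> topspace Y. \<tau> x \<in> chart_dom c}"
        using H_dom[OF d] p one_dom by (simp add: H_topspace)
    qed (simp add: chart_inv_chart[OF id] chart_inv_chart[OF is_chart])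
  qed
  with Z show ?thesis by blast
qed

text \<open>From \<open>h = (h p^-1) p\<close>. The bracket acts on the moved vector
  \<open>Ad p w\<close>, the form needed for functions that are infinitesimally invariant at every
  vector.\<close>

lemma Ad_right_has_derivative:
  assumes d: "d \<in> B" "p \<in> chart_dom d"
  shows "\<exists>Z. (\<forall>u. Z u \<in> \<hh>) \<and> (\<forall>w. ((\<lambda>y. Ad (chart_inv d y) w) has_derivative
      (\<lambda>u. lie_bracket G c (Z u) (Ad p w))) (at (snd d p)))"
proof -
  have id: "is_chart Y d" by (rule chart_coverD[OF H_cover d(1)])
  have pH: "p \<in> H" by (rule H_dom[OF d])
  have ip: "inv p \<in> H" by (rule subgroup.m_inv_closed[OF H_subgroup pH])
  have \<tau>: "smooth_map Y B Y B (\<lambda>h. h \<otimes> inv p)"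
    by (intro H_smooth_map_mult smooth_map_id H_atlas H_smooth_map_const ip)
  obtain Z where Z: "\<And>u. Z u \<in> \<hh>" "\<And>w. ((\<lambda>y. Ad (chart_inv d y \<otimes> inv p) w) has_derivative
      (\<lambda>u. lie_bracket G c (Z u) w)) (at (snd d p))"
    using Ad_translate_has_derivative[OF \<tau> d] H_carrier[OF pH] by auto
  have "((\<lambda>y. Ad (chart_inv d y) w) has_derivative (\<lambda>u. lie_bracket G c (Z u) (Ad p w))) (at (snd d p))"
    for w
  proof (rule has_derivative_chart_transform[OF id d(2) openin_topspace _ Z(2)])
    fix x assume "x \<in> chart_dom d"
    then have "x \<in> carrier G" "chart_inv d (snd d x) = x"
      using H_dom[OF d(1)] H_carrier chart_inv_chart[OF id] by blast+
    then show "Ad (chart_inv d (snd d x) \<otimes> inv p) (Ad p w) = Ad x w"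
      using H_carrier[OF pH] by (simp add: Ad_mult[symmetric] m_assoc)
  qed (simp add: pH H_topspace)
  with Z(1) show ?thesis by blast
qed

text \<open>From \<open>h = p (p^-1 h)\<close>. The bracket acts on the original vector
  \<open>w\<close>, the form needed when only one particular vector is known to be an
  eigenvector.\<close>

lemma Ad_left_has_derivative:
  assumes d: "d \<in> B" "p \<in> chart_dom d"
  shows "\<exists>Z. (\<forall>u. Z u \<in> \<hh>) \<and> (\<forall>w. ((\<lambda>y. Ad (chart_inv d y) w) has_derivative
      (\<lambda>u. Ad p (lie_bracket G c (Z u) w))) (at (snd d p)))"
proof -
  have id: "is_chart Y d" by (rule chart_coverD[OF H_cover d(1)])
  have pH: "p \<in> H" by (rule H_dom[OF d])
  have ip: "inv p \<in> H" by (rule subgroup.m_inv_closed[OF H_subgroup pH])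
  have \<tau>: "smooth_map Y B Y B (\<lambda>h. inv p \<otimes> h)"
    by (intro H_smooth_map_mult smooth_map_id H_atlas H_smooth_map_const ip)
  obtain Z where Z: "\<And>u. Z u \<in> \<hh>" "\<And>w. ((\<lambda>y. Ad (inv p \<otimes> chart_inv d y) w) has_derivative
      (\<lambda>u. lie_bracket G c (Z u) w)) (at (snd d p))"
    using Ad_translate_has_derivative[OF \<tau> d] H_carrier[OF pH] by auto
  have "((\<lambda>y. Ad (chart_inv d y) w) has_derivative (\<lambda>u. Ad p (lie_bracket G c (Z u) w))) (at (snd d p))"
    for w
  proof (rule has_derivative_chart_transform[OF id d(2) openin_topspace])
    show "((\<lambda>y. Ad p (Ad (inv p \<otimes> chart_inv d y) w)) has_derivative
        (\<lambda>u. Ad p (lie_bracket G c (Z u) w))) (at (snd d p))"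
      by (rule bounded_linear.has_derivative[OF Ad_bounded_linear[OF H_carrier[OF pH]] Z(2)])
    fix x assume "x \<in> chart_dom d"
    then have "x \<in> carrier G" "chart_inv d (snd d x) = x"
      using H_dom[OF d(1)] H_carrier chart_inv_chart[OF id] by blast+
    then show "Ad p (Ad (inv p \<otimes> chart_inv d (snd d x)) w) = Ad x w"
      using H_carrier[OF pH] by (simp add: Ad_mult[symmetric] m_assoc[symmetric])
  qed (simp add: pH H_topspace)
  with Z(1) show ?thesis by blast
qed

text \<open>At \<open>p\<close> the derivative of \<open>Q (Ad h w)\<close> is \<open>Q'\<close> at
  \<open>Ad p w\<close> in the direction of a bracket with \<open>Ad p w\<close>, which vanishes by
  assumption; connectedness does the rest.\<close>

lemma Ad_invariant:
  assumes Q: "\<And>w. (Q has_derivative Q' w) (at w)"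
    and inv: "\<And>v w. v \<in> \<hh> \<Longrightarrow> Q' w (lie_bracket G c v w) = 0" and h: "h \<in> H"
  shows "Q (Ad h w) = Q w"
proof -
  have "Q (Ad h w) = Q (Ad \<one> w)"
  proof (rule constant_of_zero_derivative[OF H_connected H_cover])
    fix p d assume d: "d \<in> B" "p \<in> chart_dom d"
    obtain Z where Z: "\<And>u. Z u \<in> \<hh>" "((\<lambda>y. Ad (chart_inv d y) w) has_derivative
      (\<lambda>u. lie_bracket G c (Z u) (Ad p w))) (at (snd d p))"
      using Ad_right_has_derivative[OF d] by blast
    have v: "Ad (chart_inv d (snd d p)) w = Ad p w"
      using d(2) by (simp add: chart_inv_chart[OF chart_coverD[OF H_cover d(1)]])
    from has_derivative_compose[OF Z(2), of Q "Q' (Ad p w)"]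
    show "((\<lambda>y. Q (Ad (chart_inv d y) w)) has_derivative (\<lambda>u. 0)) (at (snd d p))"
      using Q[of "Ad p w"] inv[OF Z(1)] by (simp add: v)
  qed (simp_all add: H_topspace H_one h)
  then show ?thesis by (simp add: Ad_one)
qed

text \<open>Instead of integrating the eigenvalue \<open>lam\<close>, one divides
  \<open>Ad h v\<close> by its inner product with \<open>v\<close>. Where this inner product is
  positive, the quotient has derivative zero, so the line of \<open>Ad h v\<close> is locally fixed
  and the factor stays positive. The elements with a positive factor thus form an open subgroup, and
  an open subgroup of a connected group is everything.\<close>

lemma Ad_eigenvector:
  assumes eig: "\<And>z. z \<in> \<hh> \<Longrightarrow> lie_bracket G c z v = lam z *\<^sub>R v" and v: "v \<noteq> 0" and h: "h \<in> H"
  shows "\<exists>r>0. Ad h v = r *\<^sub>R v"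
proof -
  let ?Z = "{h \<in> H. \<exists>r>0. Ad h v = r *\<^sub>R v}"
  let ?n = "\<lambda>h. v \<bullet> Ad h v"
  have vv: "v \<bullet> v > 0" using v by simp
  have nbhd: "\<exists>N. openin Y N \<and> p \<in> N \<and> N \<subseteq> ?Z" if p: "p \<in> ?Z" for p
  proof -
    obtain d where d: "d \<in> B" "p \<in> chart_dom d"
      using chart_cover_obtain[OF H_cover] p H_topspace by blast
    have id: "is_chart Y d" by (rule chart_coverD[OF H_cover d(1)])
    obtain r where r: "r > 0" "Ad p v = r *\<^sub>R v" using p by blast
    have der: "\<exists>l. ((\<lambda>y. Ad (chart_inv d y) v) has_derivative (\<lambda>u. l u *\<^sub>R Ad q v)) (at (snd d q))"
      if q: "q \<in> chart_dom d" for q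
    proof -
      obtain Z where Z: "\<And>u. Z u \<in> \<hh>" "((\<lambda>y. Ad (chart_inv d y) v) has_derivative
        (\<lambda>u. Ad q (lie_bracket G c (Z u) v))) (at (snd d q))"
        using Ad_left_has_derivative[OF d(1) q] by blast
      have "linear (Ad q)"
        by (intro bounded_linear.linear Ad_bounded_linear H_carrier H_dom[OF d(1) q])
      then show ?thesis using Z(2) eig[OF Z(1)] by (auto simp: linear_cmul)
    qed
    have cont: "continuous_on (snd d ` chart_dom d) (\<lambda>y. Ad (chart_inv d y) v)"
      by (rule continuous_at_imp_continuous_on) (use der has_derivative_continuous in blast)
    have od: "open (snd d ` chart_dom d)" by (rule is_chart_open_image[OF id is_chart_openin[OF id]]) simp
    let ?V = "{y \<in> snd d ` chart_dom d. ?n (chart_inv d y) > 0}"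
    have "continuous_on (snd d ` chart_dom d) (\<lambda>y. ?n (chart_inv d y))"
      by (intro continuous_on_inner continuous_on_const cont)
    then have "open ((\<lambda>y. ?n (chart_inv d y)) -` {0<..} \<inter> snd d ` chart_dom d)"
      unfolding continuous_on_open_vimage[OF od] using open_greaterThan by blast
    moreover have "(\<lambda>y. ?n (chart_inv d y)) -` {0<..} \<inter> snd d ` chart_dom d = ?V" by blast
    ultimately have "open ?V" by simp
    then have oW: "openin Y {x \<in> chart_dom d. snd d x \<in> ?V}" by (rule is_chart_open_preimage[OF id])
    have W: "x \<in> {x \<in> chart_dom d. snd d x \<in> ?V} \<longleftrightarrow> x \<in> chart_dom d \<and> ?n x > 0" for x
      using chart_inv_chart[OF id, of x] by auto
    have pW: "p \<in> {x \<in> chart_dom d. snd d x \<in> ?V}"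
      unfolding W using d(2) r vv by simp
    \<comment> \<open>Numerator and denominator have the same logarithmic derivative
      \<open>l\<close>, so the two terms of the product rule cancel.\<close>
    have "((\<lambda>y. Ad (chart_inv d y) v /\<^sub>R ?n (chart_inv d y)) has_derivative (\<lambda>u. 0)) (at (snd d q))"
      if q: "q \<in> chart_dom d" "q \<in> {x \<in> chart_dom d. snd d x \<in> ?V}" for q
    proof -
      have nq: "?n q > 0" using q W by blast
      obtain l where l: "((\<lambda>y. Ad (chart_inv d y) v) has_derivative (\<lambda>u. l u *\<^sub>R Ad q v)) (at (snd d q))"
        using der[OF q(1)] by blast
      have 1: "((\<lambda>y. ?n (chart_inv d y)) has_derivative (\<lambda>u. v \<bullet> (l u *\<^sub>R Ad q v))) (at (snd d q))"
        by (rule bounded_linear.has_derivative[OF bounded_linear_inner_right l])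
      have e: "Ad (chart_inv d (snd d q)) v = Ad q v" using q(1) by (simp add: chart_inv_chart[OF id])
      have "((\<lambda>y. inverse (?n (chart_inv d y))) has_derivative
          (\<lambda>u. - (inverse (?n q) * (v \<bullet> (l u *\<^sub>R Ad q v)) * inverse (?n q)))) (at (snd d q))"
        using Deriv.has_derivative_inverse[OF _ 1] nq by (simp add: e)
      from has_derivative_scaleR[OF this l]
      show ?thesis
        using nq by (simp add: e field_simps)
    qed
    from locally_constant_of_zero_derivative[OF id d(2) oW pW, of "\<lambda>h. Ad h v /\<^sub>R ?n h", OF this]
    obtain N where N: "openin Y N" "p \<in> N" "N \<subseteq> {x \<in> chart_dom d. snd d x \<in> ?V}"
      "\<And>q. q \<in> N \<Longrightarrow> Ad q v /\<^sub>R ?n q = Ad p v /\<^sub>R ?n p" by blast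
    have "q \<in> ?Z" if q: "q \<in> N" for q
    proof -
      have nq: "?n q > 0" "q \<in> chart_dom d" using N(3) q W by blast+
      have "Ad p v /\<^sub>R ?n p = v /\<^sub>R (v \<bullet> v)" using r by simp
      then have "Ad q v /\<^sub>R ?n q = v /\<^sub>R (v \<bullet> v)" using N(4)[OF q] by simp
      then have "?n q *\<^sub>R (Ad q v /\<^sub>R ?n q) = ?n q *\<^sub>R (v /\<^sub>R (v \<bullet> v))" by simp
      then have "Ad q v = (?n q / (v \<bullet> v)) *\<^sub>R v" using nq by (simp add: divide_inverse)
      moreover have "?n q / (v \<bullet> v) > 0" using nq vv by simp
      ultimately show ?thesis using H_dom[OF d(1) nq(2)] by blast
    qed
    then show ?thesis using N(1,2) by blast
  qed
  have ZI: "inv a \<otimes> b \<in> ?Z" if "a \<in> ?Z" "b \<in> ?Z" for a b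
  proof -
    obtain r s where rs: "r > 0" "s > 0" "Ad a v = r *\<^sub>R v" "Ad b v = s *\<^sub>R v" "a \<in> H" "b \<in> H"
      using \<open>a \<in> ?Z\<close> \<open>b \<in> ?Z\<close> by blast
    have ac: "a \<in> carrier G" "b \<in> carrier G" using rs H_carrier by blast+
    have lin: "linear (Ad (inv a))" by (intro bounded_linear.linear Ad_bounded_linear) (simp add: ac)
    have "r *\<^sub>R Ad (inv a) v = v"
      using Ad_inv_cancel(2)[OF ac(1), of v] rs(3) by (simp add: linear_cmul[OF lin])
    then have "Ad (inv a) v = (1 / r) *\<^sub>R v" using rs(1)
      by (metis inverse_eq_divide less_irrefl scaleR_left_imp_eq scaleR_one scaleR_scaleR right_inverse)
    then have "Ad (inv a \<otimes> b) v = (s / r) *\<^sub>R v"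
      using ac rs(4) by (simp add: Ad_mult linear_cmul[OF lin])
    moreover have "inv a \<otimes> b \<in> H"
      using rs H_subgroup by (simp add: subgroup.m_closed subgroup.m_inv_closed)
    moreover have "s / r > 0" using rs by simp
    ultimately show ?thesis by blast
  qed
  have oneZ: "\<one> \<in> ?Z" using H_one by (auto simp: Ad_one intro!: exI[of _ 1])
  have oZ: "openin Y ?Z"
    by (subst openin_subopen) (use nbhd in blast)
  \<comment> \<open>An open subgroup is closed: the translate of \<open>?Z\<close> by
    \<open>q\<close> is an open neighbourhood of \<open>q\<close> that misses
    \<open>?Z\<close>.\<close>
  moreover have "openin Y (topspace Y - ?Z)"
  proof (subst openin_subopen, rule ballI)
    fix q assume q: "q \<in> topspace Y - ?Z"
    then have qH: "q \<in> H" by (simp add: H_topspace)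
    have iq: "inv q \<in> H" by (rule subgroup.m_inv_closed[OF H_subgroup qH])
    have qc: "q \<in> carrier G" by (rule H_carrier[OF qH])
    have "smooth_map Y B Y B (\<lambda>h. inv q \<otimes> h)"
      by (intro H_smooth_map_mult smooth_map_id H_atlas H_smooth_map_const iq)
    from openin_continuous_map_preimage[OF smooth_map_continuous[OF this] oZ]
    have "openin Y {x \<in> topspace Y. inv q \<otimes> x \<in> ?Z}" .
    moreover have "q \<in> {x \<in> topspace Y. inv q \<otimes> x \<in> ?Z}"
      using oneZ q qc by simp
    moreover have "{x \<in> topspace Y. inv q \<otimes> x \<in> ?Z} \<subseteq> topspace Y - ?Z"
    proof
      fix x assume "x \<in> {x \<in> topspace Y. inv q \<otimes> x \<in> ?Z}"
      then have x: "x \<in> topspace Y" "inv q \<otimes> x \<in> ?Z" by blast+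
      have xc: "x \<in> carrier G" using x(1) H_carrier by (simp add: H_topspace)
      have "x \<notin> ?Z"
      proof
        assume xZ: "x \<in> ?Z"
        \<comment> \<open>If \<open>x\<close> lay both in \<open>?Z\<close> and in its translate by
          \<open>q\<close>, then \<open>q = x (q^-1 x)^-1\<close> would lie in
          \<open>?Z\<close>.\<close>
        from ZI[OF ZI[OF xZ oneZ] ZI[OF x(2) oneZ]]
        have "inv (inv x \<otimes> \<one>) \<otimes> (inv (inv q \<otimes> x) \<otimes> \<one>) \<in> ?Z" .
        also have "inv (inv x \<otimes> \<one>) \<otimes> (inv (inv q \<otimes> x) \<otimes> \<one>) = q"
          using xc qc by (simp add: inv_mult_group m_assoc[symmetric])
        finally show False using q by blast
      qed
      then show "x \<in> topspace Y - ?Z" using x(1) by blast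
    qed
    ultimately show "\<exists>T. openin Y T \<and> q \<in> T \<and> T \<subseteq> topspace Y - ?Z" by blast
  qed
  ultimately have "?Z = {} \<or> ?Z = topspace Y"
    using H_connected openin_subset[OF oZ] unfolding connected_space_clopen_in closedin_def by blast
  then show ?thesis using oneZ h H_topspace by blast
qed

end

section \<open>Open orbits and the closure of the adjoint group\<close>

context lie_group_chart
begin

text \<open>The map \<open>(l, h) \<mapsto> k l k^-1 h\<close> on the product of \<open>L\<close>
  and \<open>H\<close> sends the pair of identities to the identity. Its differential there is
  \<open>(a, b) \<mapsto> Ad k a + b\<close> on the two subalgebras, hence surjective by
  \<open>trans\<close>, and the open mapping property puts a neighbourhood into the image. Working
  in charts of the subgroups themselves takes care of a topology on \<open>L\<close> or
  \<open>H\<close> that is finer than the one induced from \<open>G\<close>.\<close>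

lemma transversal_imp_nhd:
  assumes "connected_lie_subgroup_with_algebra G X A c \<ll> L XL (AL :: ('a, 'f::euclidean_space) chart set)"
    and "connected_lie_subgroup_with_algebra G X A c \<hh> H Y (B :: ('a, 'h::euclidean_space) chart set)"
    and k: "k \<in> carrier G"
    and trans: "\<And>y. \<exists>a\<in>\<ll>. \<exists>b\<in>\<hh>. y = Ad k a + b"
  shows "\<exists>W. openin X W \<and> \<one> \<in> W \<and> W \<subseteq> {k \<otimes> l \<otimes> inv k \<otimes> h | l h. l \<in> L \<and> h \<in> H}"
proof -
  interpret L: connected_lie_subgroup G X A c \<ll> L XL AL by unfold_locales (rule assms(1))
  interpret H: connected_lie_subgroup G X A c \<hh> H Y B by unfold_locales (rule assms(2))
  obtain d1 where d1: "d1 \<in> AL" "\<one> \<in> chart_dom d1" by (rule L.H_one_chart)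
  obtain d2 where d2: "d2 \<in> B" "\<one> \<in> chart_dom d2" by (rule H.H_one_chart)
  have i1: "is_chart XL d1" by (rule chart_coverD[OF L.H_cover d1(1)])
  have i2: "is_chart Y d2" by (rule chart_coverD[OF H.H_cover d2(1)])
  let ?p = "(chart_dom d1 \<times> chart_dom d2, map_prod (snd d1) (snd d2))"
  have pA: "?p \<in> prod_atlas AL B" using d1 d2 unfolding prod_atlas_def by blast
  have ip: "is_chart (prod_topology XL Y) ?p" by (rule is_chart_prod[OF i1 i2])
  have cp: "chart_cover (prod_topology XL Y) (prod_atlas AL B)"
    by (rule chart_cover_prod[OF L.H_cover H.H_cover])
  let ?\<phi> = "\<lambda>z. k \<otimes> fst z \<otimes> inv k \<otimes> snd z"
  have f1: "smooth_map (prod_topology XL Y) (prod_atlas AL B) X A fst"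
    by (rule smooth_map_compose[OF cp L.H_cover cover smooth_map_fst[OF L.H_atlas H.H_cover] L.H_incl])
  have f2: "smooth_map (prod_topology XL Y) (prod_atlas AL B) X A snd"
    by (rule smooth_map_compose[OF cp H.H_cover cover smooth_map_snd[OF L.H_cover H.H_atlas] H.H_incl])
  have s\<phi>: "smooth_map (prod_topology XL Y) (prod_atlas AL B) X A ?\<phi>"
    by (intro smooth_map_mult cp f1 f2 smooth_map_const) (use k in \<open>simp_all add: topspace_eq\<close>)
  let ?T = "snd ?p ` {z \<in> chart_dom ?p. ?\<phi> z \<in> chart_dom c}"
  define F where "F = snd c \<circ> ?\<phi> \<circ> chart_inv ?p"
  have F_eq: "F (snd d1 l, snd d2 h) = snd c (k \<otimes> l \<otimes> inv k \<otimes> h)"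
    if "l \<in> chart_dom d1" "h \<in> chart_dom d2" for l h
    using that by (simp add: F_def chart_inv_map_prod[OF i1 i2])
  have oT: "open ?T" by (rule chart_image_open[OF ip is_chart smooth_map_continuous[OF s\<phi>]])
  have sF: "smooth_on ?T F" unfolding F_def by (rule smooth_mapD[OF s\<phi> pA chart])
  let ?a = "(snd d1 \<one>, snd d2 \<one>)"
  have aT: "?a \<in> ?T"
    by (rule image_eqI[where x="(\<one>, \<one>)"]) (use d1 d2 k one_dom in simp_all)
  define F' where "F' = frechet_derivative F (at ?a)"
  have dF: "(F has_derivative F') (at ?a)"
    unfolding F'_def by (rule smooth_on_has_derivative[OF sF aT])
  have linF: "linear F'" using dF has_derivative_linear by blast
  have Fa: "F ?a = snd c \<one>" using F_eq[OF d1(2) d2(2)] k by simp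
  have od1: "open (snd d1 ` chart_dom d1)" by (rule is_chart_open_image[OF i1 is_chart_openin[OF i1]]) simp
  have od2: "open (snd d2 ` chart_dom d2)" by (rule is_chart_open_image[OF i2 is_chart_openin[OF i2]]) simp
  have F1: "F' (u, 0) = Ad k (differential_in d1 c (\<lambda>x. x) \<one> u)" for u
  proof -
    have "((\<lambda>y. F (y, snd d2 \<one>)) has_derivative (\<lambda>u. F' (u, 0))) (at (snd d1 \<one>))"
      by (rule has_derivative_partial(1)[OF dF])
    then have "(snd c \<circ> (\<lambda>l. k \<otimes> l \<otimes> inv k) \<circ> chart_inv d1 has_derivative (\<lambda>u. F' (u, 0))) (at (snd d1 \<one>))"
    proof (rule has_derivative_transform_within_open[OF _ od1 imageI[OF d1(2)]])
      fix y assume "y \<in> snd d1 ` chart_dom d1"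
      then obtain l where l: "l \<in> chart_dom d1" "y = snd d1 l" by blast
      have "l \<in> carrier G" by (rule L.H_carrier[OF L.H_dom[OF d1(1) l(1)]])
      then show "F (y, snd d2 \<one>) = (snd c \<circ> (\<lambda>l. k \<otimes> l \<otimes> inv k) \<circ> chart_inv d1) y"
        using l(1) k by (simp add: l(2) F_eq[OF l(1) d2(2)] chart_inv_chart[OF i1])
    qed
    from differential_in_eqI[OF this]
    have "F' (u, 0) = differential_in d1 c (\<lambda>l. k \<otimes> l \<otimes> inv k) \<one> u" by simp
    also have "\<dots> = Ad k (differential_in d1 c (\<lambda>x. x) \<one> u)"
      unfolding Ad_def
      by (rule differential_in_compose[OF L.H_cover cover L.H_incl smooth_map_conj[OF k]
            d1 chart one_dom chart conj_one_dom[OF k]])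
    finally show ?thesis .
  qed
  have F2: "F' (0, u) = differential_in d2 c (\<lambda>x. x) \<one> u" for u
  proof -
    have "((\<lambda>y. F (snd d1 \<one>, y)) has_derivative (\<lambda>u. F' (0, u))) (at (snd d2 \<one>))"
      by (rule has_derivative_partial(2)[OF dF])
    then have "(snd c \<circ> (\<lambda>x. x) \<circ> chart_inv d2 has_derivative (\<lambda>u. F' (0, u))) (at (snd d2 \<one>))"
    proof (rule has_derivative_transform_within_open[OF _ od2 imageI[OF d2(2)]])
      fix y assume "y \<in> snd d2 ` chart_dom d2"
      then obtain h where h: "h \<in> chart_dom d2" "y = snd d2 h" by blast
      have "h \<in> carrier G" by (rule H.H_carrier[OF H.H_dom[OF d2(1) h(1)]])
      then show "F (snd d1 \<one>, y) = (snd c \<circ> (\<lambda>x. x) \<circ> chart_inv d2) y"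
        using h(1) k by (simp add: h(2) F_eq[OF d1(2) h(1)] chart_inv_chart[OF i2])
    qed
    from differential_in_eqI[OF this] show ?thesis by simp
  qed
  have "surj F'"
  proof (unfold surj_def, rule allI)
    fix y
    obtain a b where ab: "a \<in> \<ll>" "b \<in> \<hh>" "y = Ad k a + b" using trans by blast
    obtain u where u: "a = differential_in d1 c (\<lambda>x. x) \<one> u" using L.H_algebra[OF d1] ab(1) by blast
    obtain v where v: "b = differential_in d2 c (\<lambda>x. x) \<one> v" using H.H_algebra[OF d2] ab(2) by blast
    have "F' (u, v) = F' (u, 0) + F' (0, v)" using linear_add[OF linF, of "(u, 0)" "(0, v)"] by simp
    then show "\<exists>x. y = F' x" using F1 F2 ab(3) u v by metis
  qed
  from linear_surjective_right_inverse[OF linF this]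
  obtain R where R: "linear R" "F' \<circ> R = id" by blast
  have int: "F ?a \<in> interior (F ` ?T)"
    by (rule sussmann_open_mapping[OF oT smooth_on_imp_continuous_on[OF sF] aT dF _ R(2) order_refl])
      (use R(1) linear_conv_bounded_linear aT oT in \<open>auto simp: interior_open simp del: snd_conv fst_conv\<close>)
  let ?W = "{x \<in> chart_dom c. snd c x \<in> interior (F ` ?T)}"
  have "openin X ?W" by (rule is_chart_open_preimage[OF is_chart open_interior])
  moreover have "\<one> \<in> ?W" using int Fa one_dom by simp
  moreover have "?W \<subseteq> {k \<otimes> l \<otimes> inv k \<otimes> h | l h. l \<in> L \<and> h \<in> H}"
  proof
    fix x assume x: "x \<in> ?W"
    then have "snd c x \<in> F ` ?T" using interior_subset by blast
    then obtain t where t: "t \<in> ?T" "snd c x = F t" by blast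
    obtain l h where lh: "l \<in> chart_dom d1" "h \<in> chart_dom d2"
      "k \<otimes> l \<otimes> inv k \<otimes> h \<in> chart_dom c" "t = (snd d1 l, snd d2 h)"
      using t(1) by auto
    have "snd c x = snd c (k \<otimes> l \<otimes> inv k \<otimes> h)" using t(2) lh by (simp add: F_eq)
    then have "x = k \<otimes> l \<otimes> inv k \<otimes> h"
      using x lh(3) is_chart_inj[OF is_chart] by (auto dest: inj_onD)
    then show "x \<in> {k \<otimes> l \<otimes> inv k \<otimes> h | l h. l \<in> L \<and> h \<in> H}"
      using L.H_dom[OF d1(1) lh(1)] H.H_dom[OF d2(1) lh(2)] by blast
  qed
  ultimately show ?thesis by blast
qed

text \<open>Homogeneity spreads the neighbourhood of the identity: for \<open>x = l k^-1 h\<close>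
  the map \<open>y \<mapsto> k l^-1 y h^-1\<close> sends \<open>x\<close> to the identity, and it
  pulls \<open>k l' k^-1 h'\<close> back to \<open>(l l') k^-1 (h' h)\<close>, which is again in the
  double coset.\<close>

lemma transversal_imp_double_coset_open:
  assumes L: "connected_lie_subgroup_with_algebra G X A c \<ll> L XL (AL :: ('a, 'f::euclidean_space) chart set)"
    and H: "connected_lie_subgroup_with_algebra G X A c \<hh> H Y (B :: ('a, 'h::euclidean_space) chart set)"
    and k: "k \<in> carrier G"
    and trans: "\<And>y. \<exists>a\<in>\<ll>. \<exists>b\<in>\<hh>. y = Ad k a + b"
  shows "openin X {l \<otimes> inv k \<otimes> h | l h. l \<in> L \<and> h \<in> H}"
proof (subst openin_subopen, rule ballI)
  have sL: "subgroup L G" and sH: "subgroup H G"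
    using L H by (simp_all add: connected_lie_subgroup_with_algebra_def lie_subgroup_def)
  obtain W where W: "openin X W" "\<one> \<in> W" "W \<subseteq> {k \<otimes> l \<otimes> inv k \<otimes> h | l h. l \<in> L \<and> h \<in> H}"
    using transversal_imp_nhd[OF assms] by blast
  let ?E = "{l \<otimes> inv k \<otimes> h | l h. l \<in> L \<and> h \<in> H}"
  fix x assume "x \<in> ?E"
  then obtain l h where lh: "l \<in> L" "h \<in> H" "x = l \<otimes> inv k \<otimes> h" by blast
  have lc: "l \<in> carrier G" and hc: "h \<in> carrier G"
    using lh subgroup.mem_carrier[OF sL] subgroup.mem_carrier[OF sH] by blast+
  let ?\<tau> = "\<lambda>y. k \<otimes> inv l \<otimes> y \<otimes> inv h"
  have "smooth_map X A X A ?\<tau>"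
    by (intro smooth_map_mult cover smooth_map_const smooth_map_id atlas)
      (use k lc hc in \<open>simp_all add: topspace_eq\<close>)
  from openin_continuous_map_preimage[OF smooth_map_continuous[OF this] W(1)]
  have "openin X {y \<in> topspace X. ?\<tau> y \<in> W}" .
  moreover have "?\<tau> x = \<one>"
  proof -
    have "?\<tau> x = k \<otimes> (inv l \<otimes> l) \<otimes> inv k \<otimes> (h \<otimes> inv h)"
      using k lc hc by (simp only: lh(3) m_assoc m_closed inv_closed)
    then show ?thesis using k lc hc by simp
  qed
  then have "x \<in> {y \<in> topspace X. ?\<tau> y \<in> W}" using W(2) k lc hc by (simp add: topspace_eq lh(3))
  moreover have "{y \<in> topspace X. ?\<tau> y \<in> W} \<subseteq> ?E"
  proof
    fix y assume "y \<in> {y \<in> topspace X. ?\<tau> y \<in> W}"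
    then have y: "y \<in> carrier G" "?\<tau> y \<in> W" by (simp_all add: topspace_eq)
    then obtain l' h' where lh': "l' \<in> L" "h' \<in> H" "?\<tau> y = k \<otimes> l' \<otimes> inv k \<otimes> h'"
      using W(3) by blast
    have lc': "l' \<in> carrier G" and hc': "h' \<in> carrier G"
      using lh' subgroup.mem_carrier[OF sL] subgroup.mem_carrier[OF sH] by blast+
    have "y = l \<otimes> inv k \<otimes> ?\<tau> y \<otimes> h"
    proof -
      have "l \<otimes> inv k \<otimes> ?\<tau> y \<otimes> h = l \<otimes> (inv k \<otimes> k) \<otimes> inv l \<otimes> y \<otimes> (inv h \<otimes> h)"
        using k lc hc y(1) by (simp only: m_assoc m_closed inv_closed)
      then show ?thesis using k lc hc y(1) by simp
    qed
    also have "\<dots> = (l \<otimes> l') \<otimes> inv k \<otimes> (h' \<otimes> h)"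
    proof -
      have "l \<otimes> inv k \<otimes> (k \<otimes> l' \<otimes> inv k \<otimes> h') \<otimes> h = l \<otimes> (inv k \<otimes> k) \<otimes> l' \<otimes> inv k \<otimes> (h' \<otimes> h)"
        using k lc hc lc' hc' by (simp only: m_assoc m_closed inv_closed)
      then show ?thesis using k lc hc lc' hc' by (simp add: lh'(3))
    qed
    finally show "y \<in> ?E"
      using subgroup.m_closed[OF sL lh(1) lh'(1)] subgroup.m_closed[OF sH lh'(2) lh(2)] by blast
  qed
  ultimately show "\<exists>T. openin X T \<and> x \<in> T \<and> T \<subseteq> ?E" by blast
qed

text \<open>Membership in the operator-norm closure of the image of Ad, spelled out by a bound since
  operators are plain functions here. The operator-norm bound gives uniformity in \<open>w\<close>,
  which the persistence of transversality requires.\<close>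

definition Ad_limit :: "('e \<Rightarrow> 'e) \<Rightarrow> bool" where
  "Ad_limit M \<longleftrightarrow> bounded_linear M \<and>
    (\<forall>\<epsilon>>0. \<exists>g\<in>carrier G. \<forall>w. norm (Ad g w - M w) \<le> \<epsilon> * norm w)"

text \<open>The error splits as \<open>Ad g (Ad h w - N w) + (Ad g (N w) - M (N w))\<close>, and
  each part gets half of \<open>\<epsilon>\<close>. The order of choices matters: \<open>g\<close>
  comes first, because its norm bound enters the accuracy demanded of \<open>h\<close>.\<close>

lemma Ad_limit_compose:
  assumes M: "Ad_limit M" and N: "Ad_limit N"
  shows "Ad_limit (\<lambda>w. M (N w))"
  unfolding Ad_limit_def
proof (intro conjI allI impI)
  have bM: "bounded_linear M" and bN: "bounded_linear N" using M N by (simp_all add: Ad_limit_def)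
  then show "bounded_linear (\<lambda>w. M (N w))" by (rule bounded_linear_compose)
  fix \<epsilon> :: real assume e: "\<epsilon> > 0"
  obtain CN where CN: "CN > 0" "\<And>w. norm (N w) \<le> norm w * CN"
    using bounded_linear.pos_bounded[OF bN] by blast
  have "\<epsilon> / (2 * CN) > 0" using e CN(1) by simp
  then obtain g where g: "g \<in> carrier G" "\<And>w. norm (Ad g w - M w) \<le> \<epsilon> / (2 * CN) * norm w"
    using M unfolding Ad_limit_def by blast
  obtain C where C: "C > 0" "\<And>w. norm (Ad g w) \<le> norm w * C"
    using bounded_linear.pos_bounded[OF Ad_bounded_linear[OF g(1)]] by blast
  have "\<epsilon> / (2 * C) > 0" using e C(1) by simp
  then obtain h where h: "h \<in> carrier G" "\<And>w. norm (Ad h w - N w) \<le> \<epsilon> / (2 * C) * norm w"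
    using N unfolding Ad_limit_def by blast
  have "norm (Ad (g \<otimes> h) w - M (N w)) \<le> \<epsilon> * norm w" for w
  proof -
    have "Ad (g \<otimes> h) w - M (N w) = Ad g (Ad h w - N w) + (Ad g (N w) - M (N w))"
      using Ad_mult[OF g(1) h(1)] bounded_linear.linear[OF Ad_bounded_linear[OF g(1)]]
      by (simp add: linear_diff)
    then have "norm (Ad (g \<otimes> h) w - M (N w)) \<le> norm (Ad g (Ad h w - N w)) + norm (Ad g (N w) - M (N w))"
      by (simp only: norm_triangle_ineq)
    also have "norm (Ad g (Ad h w - N w)) \<le> (\<epsilon> / (2 * C) * norm w) * C"
      using C(2)[of "Ad h w - N w"] mult_right_mono[OF h(2)[of w], of C] C(1) by linarith
    also have "\<dots> = \<epsilon> / 2 * norm w" using C(1) by simp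
    also have "norm (Ad g (N w) - M (N w)) \<le> \<epsilon> / (2 * CN) * (norm w * CN)"
      using g(2)[of "N w"] mult_left_mono[OF CN(2)[of w], of "\<epsilon> / (2 * CN)"] e CN(1)
      by (meson divide_nonneg_pos less_imp_le mult_pos_pos order_trans zero_less_numeral)
    also have "\<dots> = \<epsilon> / 2 * norm w" using CN(1) by simp
    finally show ?thesis by (simp add: field_simps)
  qed
  then show "\<exists>g\<in>carrier G. \<forall>w. norm (Ad g w - M (N w)) \<le> \<epsilon> * norm w"
    using g(1) h(1) by blast
qed

text \<open>Linearity in the second argument is inherited from the operators Ad by uniqueness of the
  derivative, rather than computed from the coordinate formula of the bracket.\<close>

lemma linear_lie_bracket: "linear (\<lambda>w. lie_bracket G c v w)"
proof -
  let ?z0 = "snd c \<one>" and ?U = "snd c ` chart_dom c"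
  have oU: "open ?U" by (rule is_chart_open_image[OF is_chart is_chart_openin[OF is_chart]]) simp
  have z0: "?z0 \<in> ?U" using one_dom by (rule imageI)
  have lin: "linear (Ad (chart_inv c x))" if "x \<in> ?U" for x
    using that dom_carrier
    by (auto intro!: bounded_linear.linear Ad_bounded_linear simp: chart_inv_chart[OF is_chart])
  show ?thesis
  proof (rule linearI)
    fix a b
    have "((\<lambda>x. Ad (chart_inv c x) (a + b)) has_derivative
        (\<lambda>v. lie_bracket G c v a + lie_bracket G c v b)) (at ?z0)"
      by (rule has_derivative_transform_within_open[OF
            has_derivative_add[OF Ad_has_derivative Ad_has_derivative] oU z0])
        (simp add: linear_add[OF lin])
    from has_derivative_unique[OF Ad_has_derivative this]
    show "lie_bracket G c v (a + b) = lie_bracket G c v a + lie_bracket G c v b" by (rule fun_cong)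
  next
    fix r b
    have "((\<lambda>x. Ad (chart_inv c x) (r *\<^sub>R b)) has_derivative (\<lambda>v. r *\<^sub>R lie_bracket G c v b)) (at ?z0)"
      by (rule has_derivative_transform_within_open[OF
            has_derivative_scaleR_right[OF Ad_has_derivative] oU z0])
        (simp add: linear_cmul[OF lin])
    from has_derivative_unique[OF Ad_has_derivative this]
    show "lie_bracket G c v (r *\<^sub>R b) = r *\<^sub>R lie_bracket G c v b" by (rule fun_cong)
  qed
qed

text \<open>The element with coordinates \<open>x / n\<close> relative to the identity agrees with
  \<open>1 + ad x / n\<close> up to \<open>o(1/n)\<close>. Differentiability of Ad gives this for
  each fixed vector; uniformity comes from applying it to the finitely many basis vectors.\<close>

lemma Ad_near_identity:
  assumes "\<epsilon> > 0"
  shows "\<exists>N. \<forall>n\<ge>N. n > 0 \<and> (\<exists>g\<in>carrier G. \<forall>w.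
    norm (Ad g w - w - (1 / real n) *\<^sub>R lie_bracket G c x w) \<le> \<epsilon> / real n * norm w)"
proof -
  let ?z0 = "snd c \<one>" and ?U = "snd c ` chart_dom c"
  have oU: "open ?U" by (rule is_chart_open_image[OF is_chart is_chart_openin[OF is_chart]]) simp
  have z0: "?z0 \<in> ?U" using one_dom by (rule imageI)
  \<comment> \<open>Summing the errors over the basis costs the factor \<open>DIM('e)\<close>, and
    the displacement contributes \<open>norm x / n\<close>; the 1 covers
    \<open>x = 0\<close>.\<close>
  define \<eta> where "\<eta> = \<epsilon> / (real DIM('e) * (norm x + 1))"
  have n1: "norm x + 1 > 0" by (simp add: add_nonneg_pos)
  have \<eta>: "\<eta> > 0" using assms n1 by (simp add: \<eta>_def)
  have "\<exists>\<delta>>0. \<forall>y. norm (y - ?z0) < \<delta> \<longrightarrow>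
      norm (Ad (chart_inv c y) b - b - lie_bracket G c (y - ?z0) b) \<le> \<eta> * norm (y - ?z0)" for b
    using Ad_has_derivative[of b] \<eta> one_dom
    unfolding has_derivative_at_alt by (auto simp: chart_inv_chart[OF is_chart] Ad_one)
  then obtain \<delta> where \<delta>: "\<And>b. \<delta> b > 0" "\<And>b y. norm (y - ?z0) < \<delta> b \<Longrightarrow>
      norm (Ad (chart_inv c y) b - b - lie_bracket G c (y - ?z0) b) \<le> \<eta> * norm (y - ?z0)" by metis
  obtain r where r: "r > 0" "ball ?z0 r \<subseteq> ?U" using oU z0 openE by blast
  \<comment> \<open>One radius for all basis vectors, small enough that \<open>x / n\<close> stays
    inside the chart.\<close>
  define \<rho> where "\<rho> = Min (insert r (\<delta> ` Basis))"
  have \<rho>: "\<rho> > 0" "\<rho> \<le> r" "\<And>b. b \<in> Basis \<Longrightarrow> \<rho> \<le> \<delta> b"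
    unfolding \<rho>_def using \<delta>(1) r(1) by (auto simp del: Min_insert)
  obtain N where N: "real N > norm x / \<rho>" using reals_Archimedean2 by blast
  have lin: "linear (\<lambda>v. lie_bracket G c v b)" for b
    using has_derivative_linear[OF Ad_has_derivative] .
  show ?thesis
  proof (intro exI[of _ "Suc N"] allI impI)
    fix n assume n: "n \<ge> Suc N"
    let ?y = "?z0 + (1 / real n) *\<^sub>R x"
    have np: "real n > 0" using n by simp
    have "norm x / \<rho> < real n" using N n by linarith
    then have "norm x / real n < \<rho>" using np \<rho>(1) by (simp add: field_simps)
    then have small: "norm (?y - ?z0) < \<rho>" using np by (simp add: field_simps)
    have "?y \<in> ball ?z0 r" using small \<rho>(2) by (simp add: dist_norm)
    then obtain g where g: "g \<in> chart_dom c" "?y = snd c g" using r(2) by blast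
    then have gy: "chart_inv c ?y = g" by (simp add: chart_inv_chart[OF is_chart])
    have gc: "g \<in> carrier G" by (rule dom_carrier[OF g(1)])
    let ?T = "\<lambda>w. Ad g w - w - (1 / real n) *\<^sub>R lie_bracket G c x w"
    have b: "norm (?T b) \<le> \<eta> * (norm x / real n)" if "b \<in> Basis" for b
      using \<delta>(2)[of ?y b] small \<rho>(3)[OF that] by (simp add: gy linear_cmul[OF lin])
    have "norm (?T w) \<le> \<epsilon> / real n * norm w" for w
    proof -
      have linT: "linear ?T"
      proof -
        show ?thesis
          by (intro linear_compose_sub linear_compose_scale_right linear_id[unfolded id_def] linear_lie_bracket
              bounded_linear.linear[OF Ad_bounded_linear[OF gc]])
      qed
      have "?T w = ?T (\<Sum>i\<in>Basis. (w \<bullet> i) *\<^sub>R i)" by (simp only: euclidean_representation)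
      also have "\<dots> = (\<Sum>i\<in>Basis. (w \<bullet> i) *\<^sub>R ?T i)"
        by (rule trans[OF linear_sum[OF linT]]) (rule sum.cong[OF refl], rule linear_cmul[OF linT])
      finally have "norm (?T w) \<le> (\<Sum>i\<in>Basis. norm ((w \<bullet> i) *\<^sub>R ?T i))"
        by (simp only: norm_sum)
      also have "\<dots> \<le> (\<Sum>i\<in>(Basis::'e set). norm w * (\<eta> * (norm x / real n)))"
        by (rule sum_mono) (simp only: norm_scaleR, intro mult_mono b,
            auto simp: Basis_le_norm)
      also have "\<dots> = norm w / real n * (real DIM('e) * \<eta> * norm x)" by simp
      also have "\<dots> \<le> norm w / real n * (real DIM('e) * \<eta> * (norm x + 1))"
        using \<eta> by (intro mult_left_mono) auto
      also have "real DIM('e) * \<eta> * (norm x + 1) = \<epsilon>" using n1 by (simp add: \<eta>_def)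
      finally show ?thesis by (simp add: mult.commute)
    qed
    then show "n > 0 \<and> (\<exists>g\<in>carrier G. \<forall>w. norm (Ad g w - w - (1 / real n) *\<^sub>R lie_bracket G c x w) \<le> \<epsilon> / real n * norm w)"
      using gc np by auto
  qed
qed

lemma Ad_pow: "g \<in> carrier G \<Longrightarrow> Ad (g [^] Suc n) w = Ad g (Ad (g [^] n) w)"
  by (subst nat_pow_Suc2) (simp_all add: Ad_mult)

text \<open>\<open>E\<close> is the one-parameter group \<open>t \<mapsto> exp (t ad x)\<close>; it is approximated by the powers
  \<open>Ad (g\<^sub>n)\<^sup>n\<close>, where \<open>g\<^sub>n\<close> has coordinates \<open>x/n\<close>, so that no exponential map
  of the group is needed.\<close>

lemma Ad_limit_one_parameter:
  fixes E :: "real \<Rightarrow> 'e \<Rightarrow> 'e"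
  assumes lin: "\<And>t. linear (E t)" and E0: "\<And>w. E 0 w = w" and Eadd: "\<And>s t w. E (s + t) w = E s (E t w)"
    and bd: "\<And>t w. 0 \<le> t \<Longrightarrow> t \<le> 1 \<Longrightarrow> norm (E t w) \<le> C * norm w"
    and deriv: "\<And>t w. 0 \<le> t \<Longrightarrow> t \<le> 1 \<Longrightarrow>
      norm (E t w - w - t *\<^sub>R lie_bracket G c x w) \<le> C * t\<^sup>2 * norm w"
  shows "Ad_limit (E 1)"
  unfolding Ad_limit_def
proof (intro conjI allI impI)
  show "bounded_linear (E 1)" using lin linear_conv_bounded_linear by blast
  fix e :: real assume e: "e > 0"
  obtain K0 where K0: "K0 > 0" "\<And>w. norm (lie_bracket G c x w) \<le> norm w * K0"
    using bounded_linear.pos_bounded linear_lie_bracket linear_conv_bounded_linear by metis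
  define C' where "C' = \<bar>C\<bar> + 1"
  have C': "C' > 0" "C \<le> C'" by (auto simp: C'_def)
  define K where "K = K0 + 1"
  \<comment> \<open>Read off from the final bound \<open>2 * \<eta> * C' * exp K\<close>. The cap at
    1 lets \<open>K = K0 + 1\<close> absorb the approximation error in the norm estimate of
    \<open>Ad g\<close>.\<close>
  define \<eta> where "\<eta> = min 1 (e / (2 * C' * exp K))"
  have \<eta>: "\<eta> > 0" "\<eta> \<le> 1" "2 * \<eta> * C' * exp K \<le> e"
    using e C' by (auto simp: \<eta>_def min_def field_simps)
  obtain N where N: "\<And>n. n \<ge> N \<Longrightarrow> n > 0 \<and> (\<exists>g\<in>carrier G. \<forall>w.
    norm (Ad g w - w - (1 / real n) *\<^sub>R lie_bracket G c x w) \<le> \<eta> / real n * norm w)"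
    using Ad_near_identity[OF \<eta>(1)] by blast
  obtain M where M: "real M > C' / \<eta>" using reals_Archimedean2 by blast
  define n where "n = max N (max M 1)"
  have n: "n \<ge> N" "real n > C' / \<eta>" "n \<ge> 1" using M by (auto simp: n_def)
  then have np: "real n > 0" by simp
  obtain g where g: "g \<in> carrier G" "\<And>w.
    norm (Ad g w - w - (1 / real n) *\<^sub>R lie_bracket G c x w) \<le> \<eta> / real n * norm w"
    using N[OF n(1)] by blast
  have t: "0 \<le> 1 / real n" "1 / real n \<le> 1" using n by simp_all
  have E1: "norm (E (1 / real n) w - w - (1 / real n) *\<^sub>R lie_bracket G c x w) \<le> \<eta> / real n * norm w" for w
  proof -
    have "C' / real n \<le> \<eta>" using n(2) \<eta>(1) np by (simp add: field_simps)
    then have "C' * (1 / real n)\<^sup>2 \<le> \<eta> / real n"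
      using np by (simp add: power2_eq_square divide_right_mono flip: divide_divide_eq_left)
    moreover have "C * (1 / real n)\<^sup>2 \<le> C' * (1 / real n)\<^sup>2" using C' by (intro mult_right_mono) auto
    ultimately have "C * (1 / real n)\<^sup>2 * norm w \<le> \<eta> / real n * norm w"
      by (intro mult_right_mono) auto
    then show ?thesis using deriv[OF t, of w] by linarith
  qed
  have PE: "norm (Ad g w - E (1 / real n) w) \<le> 2 * \<eta> / real n * norm w" for w
  proof -
    have "Ad g w - E (1 / real n) w = (Ad g w - w - (1 / real n) *\<^sub>R lie_bracket G c x w)
        - (E (1 / real n) w - w - (1 / real n) *\<^sub>R lie_bracket G c x w)" by simp
    then have "norm (Ad g w - E (1 / real n) w) \<le> \<eta> / real n * norm w + \<eta> / real n * norm w"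
      by (metis norm_triangle_le_diff add_mono g(2) E1)
    then show ?thesis by (simp add: field_simps)
  qed
  have P: "norm (Ad g w) \<le> (1 + K / real n) * norm w" for w
  proof -
    have "Ad g w = (Ad g w - w - (1 / real n) *\<^sub>R lie_bracket G c x w) +
        (w + (1 / real n) *\<^sub>R lie_bracket G c x w)" by simp
    then have "norm (Ad g w) \<le> \<eta> / real n * norm w + norm (w + (1 / real n) *\<^sub>R lie_bracket G c x w)"
      by (metis norm_triangle_le add_right_mono g(2))
    also have "norm (w + (1 / real n) *\<^sub>R lie_bracket G c x w) \<le>
        norm w + (1 / real n) * norm (lie_bracket G c x w)"
      by (rule norm_triangle_le) simp
    also have "(1 / real n) * norm (lie_bracket G c x w) \<le> (1 / real n) * (norm w * K0)"
      by (intro mult_left_mono K0(2)) simp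
    also have "\<eta> / real n * norm w \<le> 1 / real n * norm w"
      using \<eta>(2) np by (intro mult_right_mono divide_right_mono) auto
    finally show ?thesis by (simp add: K_def algebra_simps add_divide_distrib)
  qed
  \<comment> \<open>Telescoping: the error after \<open>k + 1\<close> steps is \<open>Ad g\<close>
    applied to the error after \<open>k\<close> steps, plus the one-step error at
    \<open>E (k/n) w\<close>. The power bounds the growth under \<open>Ad g\<close>, and
    \<open>C'\<close> bounds \<open>E\<close> on the unit interval.\<close>
  have iter: "norm (Ad (g [^] k) w - E (real k / real n) w)
      \<le> real k * (2 * \<eta> / real n) * C' * (1 + K / real n) ^ k * norm w" if "k \<le> n" for k w
    using that
  proof (induction k)
    case 0
    then show ?case by (simp add: Ad_one E0)
  next
    case (Suc k)
    let ?q = "1 + K / real n" and ?b = "2 * \<eta> / real n"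
    have q: "?q \<ge> 1" using np K0(1) by (simp add: K_def)
    have b: "?b \<ge> 0" using \<eta> by simp
    have la: "linear (Ad g)" by (intro bounded_linear.linear Ad_bounded_linear g(1))
    have "real (Suc k) / real n = 1 / real n + real k / real n" by (simp add: add_divide_distrib)
    then have "E (real (Suc k) / real n) w = E (1 / real n) (E (real k / real n) w)"
      by (simp only: Eadd)
    then have "Ad (g [^] Suc k) w - E (real (Suc k) / real n) w =
        Ad g (Ad (g [^] k) w - E (real k / real n) w) +
        (Ad g (E (real k / real n) w) - E (1 / real n) (E (real k / real n) w))"
      unfolding Ad_pow[OF g(1)] linear_diff[OF la] by simp
    then have "norm (Ad (g [^] Suc k) w - E (real (Suc k) / real n) w) \<le>
        norm (Ad g (Ad (g [^] k) w - E (real k / real n) w)) +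
        norm (Ad g (E (real k / real n) w) - E (1 / real n) (E (real k / real n) w))"
      by (simp only: norm_triangle_ineq)
    also have "norm (Ad g (Ad (g [^] k) w - E (real k / real n) w)) \<le>
        ?q * (real k * ?b * C' * ?q ^ k * norm w)"
      using P[of "Ad (g [^] k) w - E (real k / real n) w"] mult_left_mono[OF Suc.IH, of ?q] q Suc.prems
      by linarith
    also have "norm (Ad g (E (real k / real n) w) - E (1 / real n) (E (real k / real n) w)) \<le>
        ?b * norm (E (real k / real n) w)" by (rule PE)
    also have "\<dots> \<le> ?b * (C' * norm w)"
    proof (rule mult_left_mono[OF _ b])
      have "norm (E (real k / real n) w) \<le> C * norm w" by (rule bd) (use Suc.prems np in auto)
      also have "\<dots> \<le> C' * norm w" using C'(2) by (intro mult_right_mono) auto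
      finally show "norm (E (real k / real n) w) \<le> C' * norm w" .
    qed
    also have "?b * (C' * norm w) \<le> ?q ^ Suc k * (?b * (C' * norm w))"
    proof -
      have "1 \<le> ?q ^ Suc k" by (rule one_le_power[OF q])
      moreover have "0 \<le> ?b * (C' * norm w)" using b C'(1) by (intro mult_nonneg_nonneg) auto
      ultimately show ?thesis using mult_right_mono[of 1 "?q ^ Suc k" "?b * (C' * norm w)"] by simp
    qed
    also have "?q * (real k * ?b * C' * ?q ^ k * norm w) + ?q ^ Suc k * (?b * (C' * norm w)) =
        real (Suc k) * ?b * C' * ?q ^ Suc k * norm w"
    proof -
      have "q * (real k * b * C' * q ^ k * norm w) + q ^ Suc k * (b * (C' * norm w)) =
        real (Suc k) * b * C' * q ^ Suc k * norm w" for q b :: real by (simp add: algebra_simps)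
      then show ?thesis .
    qed
    finally show ?case by simp
  qed
  have "norm (Ad (g [^] n) w - E 1 w) \<le> e * norm w" for w
  proof -
    have "norm (Ad (g [^] n) w - E 1 w) \<le> (2 * \<eta> * C') * (1 + K / real n) ^ n * norm w"
      using iter[of n w] np by simp
    also have "\<dots> \<le> (2 * \<eta> * C') * exp K * norm w"
    proof (intro mult_right_mono mult_left_mono)
      have "(1 + K / real n) ^ n \<le> exp (K / real n) ^ n"
        using K0(1) np by (intro power_mono exp_ge_add_one_self) (simp add: K_def)
      also have "\<dots> = exp K" using np by (simp flip: exp_of_nat_mult)
      finally show "(1 + K / real n) ^ n \<le> exp K" .
    qed (use \<eta> C' in auto)
    also have "\<dots> \<le> e * norm w" using \<eta>(3) by (intro mult_right_mono) auto
    finally show ?thesis .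
  qed
  then show "\<exists>g\<in>carrier G. \<forall>w. norm (Ad g w - E 1 w) \<le> e * norm w"
    using g(1) by (intro bexI[of _ "g [^] n"]) auto
qed

text \<open>Since the fourth power of ad \<open>x\<close> vanishes, the exponential series is a
  cubic polynomial, and the group law and the two estimates asked of a one-parameter group become
  elementary.\<close>

lemma Ad_limit_exp_nilpotent:
  defines "D \<equiv> \<lambda>x w. lie_bracket G c x w"
  assumes nil: "\<And>w. D x (D x (D x (D x w))) = 0"
  shows "Ad_limit (\<lambda>w. w + D x w + (1 / 2) *\<^sub>R D x (D x w) + (1 / 6) *\<^sub>R D x (D x (D x w)))"
proof -
  let ?D = "D x"
  have l: "linear ?D" unfolding D_def by (rule linear_lie_bracket)
  note ls = linear_add[OF l] linear_cmul[OF l] linear_0[OF l]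
  define E where "E = (\<lambda>t w. w + t *\<^sub>R ?D w + (t\<^sup>2 / 2) *\<^sub>R ?D (?D w) + (t ^ 3 / 6) *\<^sub>R ?D (?D (?D w)))"
  obtain K where K: "K > 0" "\<And>w. norm (?D w) \<le> norm w * K"
    using bounded_linear.pos_bounded l linear_conv_bounded_linear by metis
  have D2: "norm (?D (?D w)) \<le> norm w * K\<^sup>2" for w
    using order_trans[OF K(2)[of "?D w"] mult_right_mono[OF K(2)[of w]]] K(1)
    by (simp add: power2_eq_square mult.assoc)
  have D3: "norm (?D (?D (?D w))) \<le> norm w * K ^ 3" for w
    using order_trans[OF K(2)[of "?D (?D w)"] mult_right_mono[OF D2[of w]]] K(1)
    by (simp add: power3_eq_cube power2_eq_square mult.assoc)
  \<comment> \<open>A single constant for both estimates: \<open>1 + K\<close> covers the terms up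
    to first order, \<open>K\<^sup>2 + K ^ 3\<close> the remainder.\<close>
  let ?C = "1 + K + K\<^sup>2 + K ^ 3"
  have tail: "norm ((t\<^sup>2 / 2) *\<^sub>R ?D (?D w) + (t ^ 3 / 6) *\<^sub>R ?D (?D (?D w))) \<le> (K\<^sup>2 + K ^ 3) * t\<^sup>2 * norm w"
    if t: "0 \<le> t" "t \<le> 1" for t w
  proof -
    have "norm ((t\<^sup>2 / 2) *\<^sub>R ?D (?D w)) \<le> t\<^sup>2 * (norm w * K\<^sup>2)"
      unfolding norm_scaleR using t by (intro mult_mono D2) auto
    moreover have "norm ((t ^ 3 / 6) *\<^sub>R ?D (?D (?D w))) \<le> t\<^sup>2 * (norm w * K ^ 3)"
    proof -
      have "t ^ 3 \<le> t\<^sup>2" using t by (simp add: power_decreasing)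
      then have "t ^ 3 / 6 \<le> t\<^sup>2" using t zero_le_power[OF t(1), of 3] by linarith
      then show ?thesis unfolding norm_scaleR using t by (intro mult_mono D3) auto
    qed
    ultimately show ?thesis
      using norm_triangle_ineq[of "(t\<^sup>2 / 2) *\<^sub>R ?D (?D w)" "(t ^ 3 / 6) *\<^sub>R ?D (?D (?D w))"]
      by (simp add: algebra_simps)
  qed
  have "Ad_limit (E 1)"
  proof (rule Ad_limit_one_parameter[where C = ?C and x = x])
    show "linear (E t)" for t
      by (rule linearI) (simp_all add: E_def ls algebra_simps)
    show "E 0 w = w" for w by (simp add: E_def)
    \<comment> \<open>Products of total degree above three die by nilpotency, and the coefficients
      that remain are those of the binomial formula.\<close>
    show "E (s + t) w = E s (E t w)" for s t w
    proof -
      have "E s (E t w) = w + (s + t) *\<^sub>R ?D w + (s\<^sup>2 / 2 + s * t + t\<^sup>2 / 2) *\<^sub>R ?D (?D w) +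
          (s ^ 3 / 6 + s\<^sup>2 / 2 * t + s * (t\<^sup>2 / 2) + t ^ 3 / 6) *\<^sub>R ?D (?D (?D w))"
        by (simp add: E_def ls nil scaleR_add_right scaleR_add_left)
      moreover have "s\<^sup>2 / 2 + s * t + t\<^sup>2 / 2 = (s + t)\<^sup>2 / 2"
        "s ^ 3 / 6 + s\<^sup>2 / 2 * t + s * (t\<^sup>2 / 2) + t ^ 3 / 6 = (s + t) ^ 3 / 6"
        by (simp_all add: field_simps power2_eq_square power3_eq_cube)
      ultimately show ?thesis by (simp only: E_def)
    qed
    fix t :: real and w assume t: "0 \<le> t" "t \<le> 1"
    have t2: "t\<^sup>2 \<le> 1" using t by (simp add: power_le_one)
    have "norm (t *\<^sub>R ?D w) \<le> 1 * (norm w * K)"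
      unfolding norm_scaleR using t by (intro mult_mono K(2)) auto
    moreover have "(K\<^sup>2 + K ^ 3) * t\<^sup>2 * norm w \<le> (K\<^sup>2 + K ^ 3) * 1 * norm w"
      using K(1) t2 by (intro mult_right_mono mult_left_mono) auto
    moreover have "norm (E t w) \<le> norm w + norm (t *\<^sub>R ?D w) +
        norm ((t\<^sup>2 / 2) *\<^sub>R ?D (?D w) + (t ^ 3 / 6) *\<^sub>R ?D (?D (?D w)))"
      using norm_triangle_ineq[of "w + t *\<^sub>R ?D w"
          "(t\<^sup>2 / 2) *\<^sub>R ?D (?D w) + (t ^ 3 / 6) *\<^sub>R ?D (?D (?D w))"]
        norm_triangle_ineq[of w "t *\<^sub>R ?D w"] by (simp add: E_def add.assoc)
    ultimately show "norm (E t w) \<le> ?C * norm w"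
      using tail[OF t, of w] by (simp add: algebra_simps)
    have "E t w - w - t *\<^sub>R lie_bracket G c x w = (t\<^sup>2 / 2) *\<^sub>R ?D (?D w) + (t ^ 3 / 6) *\<^sub>R ?D (?D (?D w))"
      by (simp add: E_def D_def)
    then show "norm (E t w - w - t *\<^sub>R lie_bracket G c x w) \<le> ?C * t\<^sup>2 * norm w"
      using tail[OF t, of w] mult_right_mono[of "K\<^sup>2 + K ^ 3" ?C "t\<^sup>2 * norm w"] K(1)
      by (simp add: mult.assoc)
  qed
  then show ?thesis by (simp add: E_def)
qed

text \<open>Surjectivity of \<open>(a, b) \<mapsto> N a + b\<close> on the two subspaces is
  witnessed by a linear right inverse \<open>R\<close> with values in them. Replacing
  \<open>N\<close> by a nearby \<open>Ad k\<close> turns the identity \<open>T (R y) = y\<close>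
  into an operator \<open>?S\<close> that differs from the identity by at most one half in norm; it
  is injective, hence onto in finite dimension, and \<open>R\<close> again supplies witnesses in the
  subspaces.\<close>

lemma Ad_limit_open_condition:
  assumes N: "Ad_limit N" and sub: "subspace \<ll>" "subspace \<hh>"
    and trans: "\<And>y. \<exists>a\<in>\<ll>. \<exists>b\<in>\<hh>. y = N a + b"
    and Q: "isCont Q (N v)" and S: "open S" "Q (N v) \<in> S"
  shows "\<exists>k\<in>carrier G. (\<forall>y. \<exists>a\<in>\<ll>. \<exists>b\<in>\<hh>. y = Ad k a + b) \<and> Q (Ad k v) \<in> S"
proof -
  have lN: "linear N" using N by (simp add: Ad_limit_def bounded_linear.linear)
  define T where "T = (\<lambda>p. N (fst p) + snd p)"
  have lT: "linear T"
    by (rule linearI) (simp_all add: T_def linear_add[OF lN] linear_cmul[OF lN] algebra_simps)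
  obtain R where R: "range R \<subseteq> \<ll> \<times> \<hh>" "linear R" "\<And>y. y \<in> T ` (\<ll> \<times> \<hh>) \<Longrightarrow> T (R y) = y"
    using linear_exists_right_inverse_on[OF lT subspace_Times[OF sub]] by blast
  have TR: "T (R y) = y" for y
  proof (rule R(3))
    obtain a b where "a \<in> \<ll>" "b \<in> \<hh>" "y = N a + b" using trans by blast
    then show "y \<in> T ` (\<ll> \<times> \<hh>)" by (intro image_eqI[of _ _ "(a, b)"]) (simp_all add: T_def)
  qed
  have bR: "bounded_linear R" using R(2) linear_conv_bounded_linear by blast
  obtain C where C: "C > 0" "\<And>y. norm (R y) \<le> norm y * C"
    using bounded_linear.pos_bounded[OF bR] by blast
  have "\<forall>\<^sub>F w in nhds (N v). Q w \<in> S"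
    using Q S by (metis continuous_at topological_tendstoD eventually_nhds_conv_at)
  then obtain \<delta> where \<delta>: "\<delta> > 0" "\<And>w. dist w (N v) < \<delta> \<Longrightarrow> Q w \<in> S"
    unfolding eventually_nhds_metric by blast
  \<comment> \<open>The first bound keeps \<open>?S\<close> invertible, the second keeps
    \<open>Ad k v\<close> within the distance \<open>\<delta>\<close> on which \<open>Q\<close>
    stays in \<open>S\<close>.\<close>
  define \<epsilon> where "\<epsilon> = min (1 / (2 * C)) (\<delta> / (2 * (norm v + 1)))"
  have nv: "norm v + 1 > 0" by (simp add: add_nonneg_pos)
  have \<epsilon>: "\<epsilon> > 0" "\<epsilon> * C \<le> 1 / 2" "\<epsilon> * (norm v + 1) \<le> \<delta> / 2"
  proof -
    have "\<epsilon> \<le> 1 / 2 / C" "\<epsilon> \<le> \<delta> / 2 / (norm v + 1)" by (auto simp: \<epsilon>_def)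
    then show "\<epsilon> * C \<le> 1 / 2" "\<epsilon> * (norm v + 1) \<le> \<delta> / 2"
      using C(1) nv by (simp_all only: pos_le_divide_eq)
    show "\<epsilon> > 0" using C(1) \<delta>(1) nv by (simp add: \<epsilon>_def)
  qed
  obtain k where k: "k \<in> carrier G" "\<And>w. norm (Ad k w - N w) \<le> \<epsilon> * norm w"
    using N \<epsilon>(1) unfolding Ad_limit_def by blast
  have lk: "linear (Ad k)" by (intro bounded_linear.linear Ad_bounded_linear k(1))
  let ?S = "\<lambda>y. Ad k (fst (R y)) + snd (R y)"
  have lS: "linear ?S"
    by (rule linearI)
      (simp_all add: linear_add[OF R(2)] linear_cmul[OF R(2)] linear_add[OF lk] linear_cmul[OF lk] algebra_simps)
  have near: "norm (?S y - y) \<le> 1 / 2 * norm y" for y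
  proof -
    have "?S y - y = Ad k (fst (R y)) - N (fst (R y))" using TR[of y] by (simp add: T_def algebra_simps)
    then have "norm (?S y - y) \<le> \<epsilon> * norm (fst (R y))" using k(2) by metis
    also have "\<dots> \<le> \<epsilon> * (norm y * C)"
      using \<epsilon>(1) C(2)[of y] norm_fst_le[of "fst (R y)" "snd (R y)"] by (intro mult_left_mono) auto
    also have "\<dots> \<le> 1 / 2 * norm y" using mult_right_mono[OF \<epsilon>(2), of "norm y"] by (simp add: ac_simps)
    finally show ?thesis .
  qed
  have "inj ?S"
  proof (subst linear_injective_0[OF lS], intro allI impI)
    fix y assume "?S y = 0"
    then show "y = 0" using near[of y] by simp
  qed
  then have surj: "surj ?S" by (rule linear_injective_imp_surjective[OF lS]) simp
  have "\<exists>a\<in>\<ll>. \<exists>b\<in>\<hh>. y = Ad k a + b" for y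
  proof -
    obtain x where x: "y = ?S x" by (rule surjE[OF surj])
    have "R x \<in> \<ll> \<times> \<hh>" using R(1) by (rule subsetD) (rule rangeI)
    then have "fst (R x) \<in> \<ll>" "snd (R x) \<in> \<hh>" by (simp_all add: mem_Times_iff)
    then show ?thesis using x by (intro bexI)
  qed
  moreover have "Q (Ad k v) \<in> S"
  proof (rule \<delta>(2))
    have "norm (Ad k v - N v) \<le> \<epsilon> * norm v" by (rule k(2))
    also have "\<dots> \<le> \<epsilon> * (norm v + 1)" using \<epsilon>(1) by (intro mult_left_mono) auto
    also have "\<dots> < \<delta>" using \<epsilon>(3) \<delta>(1) by linarith
    finally show "dist (Ad k v) (N v) < \<delta>" by (simp add: dist_norm)
  qed
  ultimately show ?thesis using k(1) by blast
qed

text \<open>Openness of an orbit in the coset topology means openness of its preimage in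
  \<open>G\<close>; this preimage is the double coset of \<open>g\<close>.\<close>

lemma double_coset_preimage:
  assumes L: "subgroup L G" and H: "subgroup H G" and g: "g \<in> carrier G"
  defines "\<O> \<equiv> orbit (G\<lparr>carrier := L\<rparr>) (\<lambda>l C. l <# C) (g <# H)"
  shows "{x \<in> carrier G. x <# H \<in> \<O>} = {l \<otimes> g \<otimes> h | l h. l \<in> L \<and> h \<in> H}"
    and "\<O> \<subseteq> (\<lambda>x. x <# H) ` carrier G"
proof -
  have O: "\<O> = {(l \<otimes> g) <# H | l. l \<in> L}"
    unfolding \<O>_def orbit_def
    using lcos_m_assoc[OF subgroup.subset[OF H] subgroup.mem_carrier[OF L] g] by auto
  show "\<O> \<subseteq> (\<lambda>x. x <# H) ` carrier G"
    unfolding O using g subgroup.mem_carrier[OF L] by auto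
  show "{x \<in> carrier G. x <# H \<in> \<O>} = {l \<otimes> g \<otimes> h | l h. l \<in> L \<and> h \<in> H}"
  proof (intro equalityI subsetI)
    fix x assume "x \<in> {x \<in> carrier G. x <# H \<in> \<O>}"
    then obtain l where l: "l \<in> L" "x \<in> carrier G" "x <# H = (l \<otimes> g) <# H" unfolding O by blast
    have "x \<in> (l \<otimes> g) <# H" using lcos_self[OF l(2) H] l(3) by simp
    then show "x \<in> {l \<otimes> g \<otimes> h | l h. l \<in> L \<and> h \<in> H}"
      using l(1) unfolding l_coset_def by blast
  next
    fix x assume "x \<in> {l \<otimes> g \<otimes> h | l h. l \<in> L \<and> h \<in> H}"
    then obtain l h where lh: "l \<in> L" "h \<in> H" "x = l \<otimes> g \<otimes> h" by blast
    have c: "l \<otimes> g \<in> carrier G" "x \<in> carrier G"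
      using lh g subgroup.mem_carrier[OF L] subgroup.mem_carrier[OF H] by simp_all
    have "x \<in> (l \<otimes> g) <# H" using lh unfolding l_coset_def by blast
    from l_repr_independence[OF this c(1) H] have "x <# H = (l \<otimes> g) <# H" by simp
    then show "x \<in> {x \<in> carrier G. x <# H \<in> \<O>}" unfolding O using lh(1) c(2) by blast
  qed
qed

text \<open>The sign of \<open>Q (Ad (g\<inverse>) v)\<close> is constant on the double cosets of \<open>L\<close> and \<open>H\<close>.\<close>

lemma two_open_orbits:
  assumes L: "connected_lie_subgroup_with_algebra G X A c \<ll> L XL (AL :: ('a, 'f::euclidean_space) chart set)"
    and H: "connected_lie_subgroup_with_algebra G X A c \<hh> H Y (B :: ('a, 'h::euclidean_space) chart set)"
    and sub: "subspace \<ll>" "subspace \<hh>"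
    and v: "v \<noteq> 0" "\<And>z. z \<in> \<ll> \<Longrightarrow> lie_bracket G c z v = lam z *\<^sub>R v"
    and Q: "\<And>w. (Q has_derivative Q' w) (at w)" "\<And>z w. z \<in> \<hh> \<Longrightarrow> Q' w (lie_bracket G c z w) = 0"
    and hom: "\<And>r w. Q (r *\<^sub>R w) = r\<^sup>2 * (Q w :: real)"
    and N1: "Ad_limit N1" "\<And>y. \<exists>a\<in>\<ll>. \<exists>b\<in>\<hh>. y = N1 a + b" "Q (N1 v) > 0"
    and N2: "Ad_limit N2" "\<And>y. \<exists>a\<in>\<ll>. \<exists>b\<in>\<hh>. y = N2 a + b" "Q (N2 v) < 0"
  shows "\<exists>O1 O2. O1 \<in> orbits (G\<lparr>carrier := L\<rparr>) (lcosets H) (\<lambda>l C. l <# C) \<and>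
                 O2 \<in> orbits (G\<lparr>carrier := L\<rparr>) (lcosets H) (\<lambda>l C. l <# C) \<and>
                 O1 \<noteq> O2 \<and> openin (coset_topology G X H) O1 \<and> openin (coset_topology G X H) O2"
proof -
  interpret L: connected_lie_subgroup G X A c \<ll> L XL AL by unfold_locales (rule L)
  interpret H: connected_lie_subgroup G X A c \<hh> H Y B by unfold_locales (rule H)
  have QH: "Q (Ad h w) = Q w" if "h \<in> H" for h w
    by (rule H.Ad_invariant[OF Q(1)]) (use Q(2) that in blast)+
  have vL: "\<exists>r>0. Ad l v = r *\<^sub>R v" if "l \<in> L" for l
    by (rule L.Ad_eigenvector[OF v(2)]) (use v(1) that in blast)+
  have Qc: "isCont Q w" for w using Q(1) has_derivative_continuous by blast
  obtain k1 where k1: "k1 \<in> carrier G" "\<And>y. \<exists>a\<in>\<ll>. \<exists>b\<in>\<hh>. y = Ad k1 a + b" "Q (Ad k1 v) > 0"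
    using Ad_limit_open_condition[where Q = Q and v = v and S = "{0<..}", OF N1(1) sub N1(2) Qc] N1(3) by auto
  obtain k2 where k2: "k2 \<in> carrier G" "\<And>y. \<exists>a\<in>\<ll>. \<exists>b\<in>\<hh>. y = Ad k2 a + b" "Q (Ad k2 v) < 0"
    using Ad_limit_open_condition[where Q = Q and v = v and S = "{..<0}", OF N2(1) sub N2(2) Qc] N2(3) by auto
  \<comment> \<open>The coset of the inverse of \<open>k\<close>, so that the operator applied to
    \<open>v\<close> is \<open>Ad k\<close> itself.\<close>
  define Ob where "Ob = (\<lambda>k. orbit (G\<lparr>carrier := L\<rparr>) (\<lambda>l C. l <# C) (inv k <# H))"
  have mem: "Ob k \<in> orbits (G\<lparr>carrier := L\<rparr>) (lcosets H) (\<lambda>l C. l <# C)" if "k \<in> carrier G" for k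
    using that unfolding Ob_def orbits_def LCOSETS_def by auto
  have pre: "{x \<in> carrier G. x <# H \<in> Ob k} = {l \<otimes> inv k \<otimes> h | l h. l \<in> L \<and> h \<in> H}"
    "Ob k \<subseteq> (\<lambda>x. x <# H) ` carrier G" if "k \<in> carrier G" for k
    unfolding Ob_def using double_coset_preimage[OF L.H_subgroup H.H_subgroup inv_closed[OF that]] by blast+
  have op: "openin (coset_topology G X H) (Ob k)"
    if "k \<in> carrier G" "\<And>y. \<exists>a\<in>\<ll>. \<exists>b\<in>\<hh>. y = Ad k a + b" for k
    unfolding openin_coset_topology topspace_eq
    using pre[OF that(1)] transversal_imp_double_coset_open[OF L H that] by simp
  have "Ob k1 \<noteq> Ob k2"
  proof
    assume eq: "Ob k1 = Ob k2"
    have "inv k1 \<in> {l \<otimes> inv k1 \<otimes> h | l h. l \<in> L \<and> h \<in> H}"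
      using k1(1) L.H_one H.H_one by (auto intro!: exI[of _ \<one>])
    then have "inv k1 \<in> {l \<otimes> inv k2 \<otimes> h | l h. l \<in> L \<and> h \<in> H}"
      using pre(1)[OF k1(1)] pre(1)[OF k2(1)] eq by simp
    then obtain l h where lh: "l \<in> L" "h \<in> H" "inv k1 = l \<otimes> inv k2 \<otimes> h" by blast
    have lc: "l \<in> carrier G" and hc: "h \<in> carrier G" using lh L.H_carrier H.H_carrier by blast+
    have "k1 = inv (inv k1)" using k1(1) by simp
    also have "\<dots> = inv (l \<otimes> inv k2 \<otimes> h)" by (simp only: lh(3))
    also have "\<dots> = inv h \<otimes> (k2 \<otimes> inv l)" using k2(1) lc hc by (simp add: inv_mult_group)
    \<comment> \<open>In this order of factors the element of \<open>L\<close> acts on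
      \<open>v\<close> first and the element of \<open>H\<close> acts last, where \<open>Q\<close>
      does not see it.\<close>
    finally have k1_eq: "k1 = inv h \<otimes> (k2 \<otimes> inv l)" .
    have "Ad k1 v = Ad (inv h) (Ad k2 (Ad (inv l) v))"
      unfolding k1_eq using k2(1) lc hc by (simp add: Ad_mult)
    then have "Q (Ad k1 v) = Q (Ad k2 (Ad (inv l) v))"
      by (simp only: QH[OF subgroup.m_inv_closed[OF H.H_subgroup lh(2)]])
    moreover obtain r where r: "r > 0" "Ad (inv l) v = r *\<^sub>R v"
      using vL[OF subgroup.m_inv_closed[OF L.H_subgroup lh(1)]] by blast
    moreover have "Ad k2 (r *\<^sub>R v) = r *\<^sub>R Ad k2 v"
      by (intro linear_cmul bounded_linear.linear Ad_bounded_linear k2(1))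
    ultimately have "Q (Ad k1 v) = r\<^sup>2 * Q (Ad k2 v)" by (simp only: hom)
    moreover have "r\<^sup>2 * Q (Ad k2 v) < 0" using r(1) k2(3) by (simp add: mult_pos_neg)
    ultimately show False using k1(3) by linarith
  qed
  then show ?thesis using mem[OF k1(1)] mem[OF k2(1)] op[OF k1(1,2)] op[OF k2(1,2)] by blast
qed

end

section \<open>Coordinates on the split Lie algebra of type G2\<close>

text \<open>The entry \<open>(3, 3)\<close> is missing: it is determined by the trace condition.\<close>

definition g2_of :: "real \<Rightarrow> real \<Rightarrow> real \<Rightarrow> real \<Rightarrow>
    real \<Rightarrow> real \<Rightarrow> real \<Rightarrow> real \<Rightarrow> real \<Rightarrow>
        real \<Rightarrow> real \<Rightarrow>
    real \<Rightarrow> real \<Rightarrow> real \<Rightarrow> g2_vec" where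
  "g2_of x1 x2 x3 a11 a12 a13 a21 a22 a23 a31 a32 k1 k2 k3 =
    (vector [x1, x2, x3], vector [vector [a11, a12, a13], vector [a21, a22, a23], vector [a31, a32,
        - a11 - a22]],
     vector [k1, k2, k3])"

lemma g2_of_in_g2: "g2_of x1 x2 x3 a11 a12 a13 a21 a22 a23 a31 a32 k1 k2 k3 \<in> g2"
  by (simp add: g2_of_def g2_def trace_def sum_3)

lemma g2_of_cases:
  assumes "w \<in> g2"
  obtains x1 x2 x3 a11 a12 a13 a21 a22 a23 a31 a32 k1 k2 k3 where "w = g2_of x1 x2 x3 a11 a12 a13
      a21 a22 a23 a31 a32 k1 k2 k3"
proof
  obtain x A \<xi> where w: "w = (x, A, \<xi>)" by (cases w)
  have "A $ 1 $ 1 + A $ 2 $ 2 + A $ 3 $ 3 = 0" using assms by (simp add: w g2_def trace_def sum_3)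
  then have "A $ 3 $ 3 = - A $ 1 $ 1 - A $ 2 $ 2" by linarith
  then show "w = g2_of (fst w $ 1) (fst w $ 2) (fst w $ 3) (fst (snd w) $ 1 $ 1) (fst (snd w) $ 1 $
      2)
      (fst (snd w) $ 1 $ 3) (fst (snd w) $ 2 $ 1) (fst (snd w) $ 2 $ 2) (fst (snd w) $ 2 $ 3)
      (fst (snd w) $ 3 $ 1) (fst (snd w) $ 3 $ 2) (snd (snd w) $ 1) (snd (snd w) $ 2) (snd (snd w)
          $ 3)"
    by (simp add: w g2_of_def vec_eq_iff forall_3)
qed

text \<open>The bracket as polynomials in the fourteen coordinates. Nilpotency, invariance and the
  exponentials below all reduce to simplification with this formula.\<close>

lemma g2_bracket_g2_of:
  "g2_bracket (g2_of x1 x2 x3 a11 a12 a13 a21 a22 a23 a31 a32 k1 k2 k3)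
      (g2_of y1 y2 y3 b11 b12 b13 b21 b22 b23 b31 b32 l1 l2 l3) =
    g2_of (a11 * y1 + a12 * y2 + a13 * y3 - (b11 * x1 + b12 * x2 + b13 * x3) + 2 * (k2 * l3 - k3 *
        l2))
      (a21 * y1 + a22 * y2 + a23 * y3 - (b21 * x1 + b22 * x2 + b23 * x3) + 2 * (k3 * l1 - k1 * l3))
      (a31 * y1 + a32 * y2 + (- a11 - a22) * y3 - (b31 * x1 + b32 * x2 + (- b11 - b22) * x3) + 2 *
          (k1 * l2 - k2 * l1))
      (a11 * b11 + a12 * b21 + a13 * b31 - (b11 * a11 + b12 * a21 + b13 * a31) + 3 * x1 * l1 - 3 *
          y1 * k1 - (x1 * l1 + x2 * l2 + x3 * l3) + (y1 * k1 + y2 * k2 + y3 * k3))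
      (a11 * b12 + a12 * b22 + a13 * b32 - (b11 * a12 + b12 * a22 + b13 * a32) + 3 * x1 * l2 - 3 *
          y1 * k2)
      (a11 * b13 + a12 * b23 + a13 * (- b11 - b22) - (b11 * a13 + b12 * a23 + b13 * (- a11 - a22))
          + 3 * x1 * l3 - 3 * y1 * k3)
      (a21 * b11 + a22 * b21 + a23 * b31 - (b21 * a11 + b22 * a21 + b23 * a31) + 3 * x2 * l1 - 3 *
          y2 * k1)
      (a21 * b12 + a22 * b22 + a23 * b32 - (b21 * a12 + b22 * a22 + b23 * a32) + 3 * x2 * l2 - 3 *
          y2 * k2 - (x1 * l1 + x2 * l2 + x3 * l3) + (y1 * k1 + y2 * k2 + y3 * k3))
      (a21 * b13 + a22 * b23 + a23 * (- b11 - b22) - (b21 * a13 + b22 * a23 + b23 * (- a11 - a22))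
          + 3 * x2 * l3 - 3 * y2 * k3)
      (a31 * b11 + a32 * b21 + (- a11 - a22) * b31 - (b31 * a11 + b32 * a21 + (- b11 - b22) * a31)
          + 3 * x3 * l1 - 3 * y3 * k1)
      (a31 * b12 + a32 * b22 + (- a11 - a22) * b32 - (b31 * a12 + b32 * a22 + (- b11 - b22) * a32)
          + 3 * x3 * l2 - 3 * y3 * k2)
      (k1 * b11 + k2 * b21 + k3 * b31 - (l1 * a11 + l2 * a21 + l3 * a31) - 2 * (x2 * y3 - x3 * y2))
      (k1 * b12 + k2 * b22 + k3 * b32 - (l1 * a12 + l2 * a22 + l3 * a32) - 2 * (x3 * y1 - x1 * y3))
      (k1 * b13 + k2 * b23 + k3 * (- b11 - b22) - (l1 * a13 + l2 * a23 + l3 * (- a11 - a22)) - 2 *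
          (x1 * y2 - x2 * y1))"
  by (simp add: g2_of_def g2_bracket_def g2_mixed_def tensor3_def cross3_def mat_def vec_eq_iff
      forall_3
      matrix_vector_mult_def matrix_matrix_mult_def vector_matrix_mult_def inner_vec_def sum_3
          algebra_simps)

lemma g2_of_add: "g2_of x1 x2 x3 a11 a12 a13 a21 a22 a23 a31 a32 k1 k2 k3 + g2_of y1 y2 y3 b11 b12
    b13 b21 b22 b23 b31 b32 l1 l2 l3 = g2_of (x1 + y1) (x2 + y2) (x3 + y3) (a11 + b11) (a12 + b12)
        (a13 + b13) (a21 + b21) (a22 + b22) (a23 + b23) (a31 + b31) (a32 + b32) (k1 + l1) (k2 + l2)
            (k3 + l3)"
  by (simp add: g2_of_def vec_eq_iff forall_3)

lemma g2_of_scaleR: "r *\<^sub>R g2_of x1 x2 x3 a11 a12 a13 a21 a22 a23 a31 a32 k1 k2 k3 = g2_of (r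
    * x1) (r * x2) (r * x3) (r * a11) (r * a12) (r * a13) (r * a21) (r * a22) (r * a23) (r * a31)
        (r * a32) (r * k1) (r * k2) (r * k3)"
  by (simp add: g2_of_def vec_eq_iff forall_3 algebra_simps)

lemma g2_of_eq_iff: "g2_of x1 x2 x3 a11 a12 a13 a21 a22 a23 a31 a32 k1 k2 k3 = g2_of y1 y2 y3 b11
    b12 b13 b21 b22 b23 b31 b32 l1 l2 l3 \<longleftrightarrow>
    x1 = y1 \<and> x2 = y2 \<and> x3 = y3 \<and> a11 = b11 \<and> a12 = b12 \<and> a13 = b13 \<and>
        a21 = b21 \<and> a22 = b22 \<and> a23 = b23 \<and> a31 = b31 \<and> a32 = b32 \<and> k1 =
            l1 \<and> k2 = l2 \<and> k3 = l3"
  by (auto simp: g2_of_def vec_eq_iff forall_3)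

lemma e_low_1: "e_low 1 = g2_of 1 0 0 0 0 0 0 0 0 0 0 0 0 0"
  by (simp add: g2_of_def e_low_def e_up_def e_mix_def tensor3_def vec_eq_iff forall_3 axis_def)

lemma e_low_3: "e_low 3 = g2_of 0 0 1 0 0 0 0 0 0 0 0 0 0 0"
  by (simp add: g2_of_def e_low_def e_up_def e_mix_def tensor3_def vec_eq_iff forall_3 axis_def)

lemma e_up_1: "e_up 1 = g2_of 0 0 0 0 0 0 0 0 0 0 0 1 0 0"
  by (simp add: g2_of_def e_low_def e_up_def e_mix_def tensor3_def vec_eq_iff forall_3 axis_def)

lemma e_up_2: "e_up 2 = g2_of 0 0 0 0 0 0 0 0 0 0 0 0 1 0"
  by (simp add: g2_of_def e_low_def e_up_def e_mix_def tensor3_def vec_eq_iff forall_3 axis_def)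

lemma e_up_3: "e_up 3 = g2_of 0 0 0 0 0 0 0 0 0 0 0 0 0 1"
  by (simp add: g2_of_def e_low_def e_up_def e_mix_def tensor3_def vec_eq_iff forall_3 axis_def)

lemma e_mix_12: "e_mix 1 2 = g2_of 0 0 0 0 1 0 0 0 0 0 0 0 0 0"
  by (simp add: g2_of_def e_low_def e_up_def e_mix_def tensor3_def vec_eq_iff forall_3 axis_def)

lemma e_mix_21: "e_mix 2 1 = g2_of 0 0 0 0 0 0 1 0 0 0 0 0 0 0"
  by (simp add: g2_of_def e_low_def e_up_def e_mix_def tensor3_def vec_eq_iff forall_3 axis_def)

lemma e_mix_13: "e_mix 1 3 = g2_of 0 0 0 0 0 1 0 0 0 0 0 0 0 0"
  by (simp add: g2_of_def e_low_def e_up_def e_mix_def tensor3_def vec_eq_iff forall_3 axis_def)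

lemma e_mix_23: "e_mix 2 3 = g2_of 0 0 0 0 0 0 0 0 1 0 0 0 0 0"
  by (simp add: g2_of_def e_low_def e_up_def e_mix_def tensor3_def vec_eq_iff forall_3 axis_def)

lemma e_mix_31: "e_mix 3 1 = g2_of 0 0 0 0 0 0 0 0 0 1 0 0 0 0"
  by (simp add: g2_of_def e_low_def e_up_def e_mix_def tensor3_def vec_eq_iff forall_3 axis_def)

lemma e_mix_32: "e_mix 3 2 = g2_of 0 0 0 0 0 0 0 0 0 0 1 0 0 0"
  by (simp add: g2_of_def e_low_def e_up_def e_mix_def tensor3_def vec_eq_iff forall_3 axis_def)

lemma g2_a_eq: "g2_a = {g2_of 0 0 0 s 0 0 0 t 0 0 0 0 0 0 | s t. True}"
proof -
  have eq: "(\<Sum>i\<in>UNIV. t i *\<^sub>R e_mix i i) = g2_of 0 0 0 (t 1) 0 0 0 (t 2) 0 0 0 0 0 0"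
    if "(\<Sum>i\<in>UNIV. t i) = 0" for t :: "3 \<Rightarrow> real"
  proof -
    have "t 3 = - t 1 - t 2" using that by (simp add: sum_3)
    then show ?thesis
      by (simp add: sum_3 g2_of_def e_mix_def tensor3_def vec_eq_iff forall_3 axis_def)
  qed
  show ?thesis
  proof (intro equalityI subsetI)
    fix u assume "u \<in> g2_a"
    then show "u \<in> {g2_of 0 0 0 s 0 0 0 t 0 0 0 0 0 0 | s t. True}" unfolding g2_a_def using eq
        by blast
  next
    fix u assume "u \<in> {g2_of 0 0 0 s 0 0 0 t 0 0 0 0 0 0 | s t. True}"
    then obtain s t where u: "u = g2_of 0 0 0 s 0 0 0 t 0 0 0 0 0 0" by blast
    define f where "f = (\<lambda>i::3. if i = 1 then s else if i = 2 then t else - s - t)"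
    have f: "(\<Sum>i\<in>UNIV. f i) = 0" "f 1 = s" "f 2 = t" by (simp_all add: f_def sum_3)
    show "u \<in> g2_a" unfolding g2_a_def using eq[OF f(1)] f u by (intro CollectI exI[of _ f])
        simp
  qed
qed

lemma g2_of_zero: "0 = g2_of 0 0 0 0 0 0 0 0 0 0 0 0 0 0"
  by (simp add: g2_of_def zero_prod_def vec_eq_iff forall_3)

lemma g2_of_diff: "g2_of x1 x2 x3 a11 a12 a13 a21 a22 a23 a31 a32 k1 k2 k3 - g2_of y1 y2 y3 b11 b12
    b13 b21 b22 b23 b31 b32 l1 l2 l3 = g2_of (x1 - y1) (x2 - y2) (x3 - y3) (a11 - b11) (a12 - b12)
        (a13 - b13) (a21 - b21) (a22 - b22) (a23 - b23) (a31 - b31) (a32 - b32) (k1 - l1) (k2 - l2)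
            (k3 - l3)"
  by (simp add: g2_of_def vec_eq_iff forall_3)

lemma g2_of_sel:
  "fst (g2_of x1 x2 x3 a11 a12 a13 a21 a22 a23 a31 a32 k1 k2 k3) $ 3 = x3"
  "fst (snd (g2_of x1 x2 x3 a11 a12 a13 a21 a22 a23 a31 a32 k1 k2 k3)) $ 1 $ 1 = a11"
  "fst (snd (g2_of x1 x2 x3 a11 a12 a13 a21 a22 a23 a31 a32 k1 k2 k3)) $ 3 $ 3 = - a11 - a22"
  "snd (snd (g2_of x1 x2 x3 a11 a12 a13 a21 a22 a23 a31 a32 k1 k2 k3)) $ 3 = k3"
  by (simp_all add: g2_of_def)

lemma g2_l_eq: "g2_l = {g2_of x1 0 0 a11 a12 a13 0 a22 a23 0 0 0 k2 k3 | x1 a11 a12 a13 a22 a23 k2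
    k3. True}"
proof -
  have sp: "span {e_low 1, e_up 2, e_up 3, e_mix 1 2, e_mix 1 3, e_mix 2 3} =
      {g2_of x1 0 0 0 a12 a13 0 0 a23 0 0 0 k2 k3 | x1 a12 a13 a23 k2 k3. True}" (is "span ?S = ?T")
  proof
    show "?T \<subseteq> span ?S"
    proof
      fix u assume "u \<in> ?T"
      then obtain x1 a12 a13 a23 k2 k3 where u: "u = g2_of x1 0 0 0 a12 a13 0 0 a23 0 0 0 k2 k3" by
          blast
      have "u = x1 *\<^sub>R e_low 1 + k2 *\<^sub>R e_up 2 + k3 *\<^sub>R e_up 3 + a12 *\<^sub>R
          e_mix 1 2 + a13 *\<^sub>R e_mix 1 3 + a23 *\<^sub>R e_mix 2 3"
        by (simp add: u e_low_1 e_up_2 e_up_3 e_mix_12 e_mix_13 e_mix_23 g2_of_scaleR g2_of_add)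
      also have "\<dots> \<in> span ?S" by (intro span_add span_scale span_base) auto
      finally show "u \<in> span ?S" .
    qed
    show "span ?S \<subseteq> ?T"
    proof (rule span_minimal)
      show "?S \<subseteq> ?T" unfolding e_low_1 e_up_2 e_up_3 e_mix_12 e_mix_13 e_mix_23 by blast
      show "subspace ?T"
        by (rule subspaceI) (auto simp: g2_of_add g2_of_scaleR g2_of_eq_iff g2_of_zero)
    qed
  qed
  show ?thesis
  proof (intro equalityI subsetI)
    fix u assume "u \<in> g2_l"
    then obtain s t x1 a12 a13 a23 k2 k3 where "u = g2_of 0 0 0 s 0 0 0 t 0 0 0 0 0 0 + g2_of x1 0
        0 0 a12 a13 0 0 a23 0 0 0 k2 k3"
      unfolding g2_l_def g2_a_eq sp by blast
    then show "u \<in> {g2_of x1 0 0 a11 a12 a13 0 a22 a23 0 0 0 k2 k3 | x1 a11 a12 a13 a22 a23 k2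
        k3. True}" unfolding g2_of_add add_0_left add_0_right by blast
  next
    fix u assume "u \<in> {g2_of x1 0 0 a11 a12 a13 0 a22 a23 0 0 0 k2 k3 | x1 a11 a12 a13 a22 a23
        k2 k3. True}"
    then obtain x1 a11 a12 a13 a22 a23 k2 k3 where u: "u = g2_of x1 0 0 a11 a12 a13 0 a22 a23 0 0 0
        k2 k3" by blast
    have "u = g2_of 0 0 0 a11 0 0 0 a22 0 0 0 0 0 0 + g2_of x1 0 0 0 a12 a13 0 0 a23 0 0 0 k2 k3"
        by (simp add: u g2_of_add)
    then show "u \<in> g2_l" unfolding g2_l_def g2_a_eq sp by blast
  qed
qed

lemma g2_ev_eq: "g2_ev = {g2_of 0 0 x3 a11 a12 0 a21 a22 0 0 0 0 0 k3 | x3 a11 a12 a21 a22 k3.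
    True}"
proof -
  have sp: "span {e_low 3, e_up 3, e_mix 1 2, e_mix 2 1} =
      {g2_of 0 0 x3 0 a12 0 a21 0 0 0 0 0 0 k3 | x3 a12 a21 k3. True}" (is "span ?S = ?T")
  proof
    show "?T \<subseteq> span ?S"
    proof
      fix u assume "u \<in> ?T"
      then obtain x3 a12 a21 k3 where u: "u = g2_of 0 0 x3 0 a12 0 a21 0 0 0 0 0 0 k3" by blast
      have "u = x3 *\<^sub>R e_low 3 + k3 *\<^sub>R e_up 3 + a12 *\<^sub>R e_mix 1 2 + a21
          *\<^sub>R e_mix 2 1"
        by (simp add: u e_low_3 e_up_3 e_mix_12 e_mix_21 g2_of_scaleR g2_of_add)
      also have "\<dots> \<in> span ?S" by (intro span_add span_scale span_base) auto
      finally show "u \<in> span ?S" .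
    qed
    show "span ?S \<subseteq> ?T"
    proof (rule span_minimal)
      show "?S \<subseteq> ?T" unfolding e_low_3 e_up_3 e_mix_12 e_mix_21 by blast
      show "subspace ?T"
        by (rule subspaceI) (auto simp: g2_of_add g2_of_scaleR g2_of_eq_iff g2_of_zero)
    qed
  qed
  show ?thesis
  proof (intro equalityI subsetI)
    fix u assume "u \<in> g2_ev"
    then obtain s t x3 a12 a21 k3 where "u = g2_of 0 0 0 s 0 0 0 t 0 0 0 0 0 0 + g2_of 0 0 x3 0 a12
        0 a21 0 0 0 0 0 0 k3"
      unfolding g2_ev_def g2_a_eq sp by blast
    then show "u \<in> {g2_of 0 0 x3 a11 a12 0 a21 a22 0 0 0 0 0 k3 | x3 a11 a12 a21 a22 k3. True}"
        unfolding g2_of_add add_0_left add_0_right by blast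
  next
    fix u assume "u \<in> {g2_of 0 0 x3 a11 a12 0 a21 a22 0 0 0 0 0 k3 | x3 a11 a12 a21 a22 k3.
        True}"
    then obtain x3 a11 a12 a21 a22 k3 where u: "u = g2_of 0 0 x3 a11 a12 0 a21 a22 0 0 0 0 0 k3" by
        blast
    have "u = g2_of 0 0 0 a11 0 0 0 a22 0 0 0 0 0 0 + g2_of 0 0 x3 0 a12 0 a21 0 0 0 0 0 0 k3" by
        (simp add: u g2_of_add)
    then show "u \<in> g2_ev" unfolding g2_ev_def g2_a_eq sp by blast
  qed
qed

lemma g2_bracket_in_g2: "v \<in> g2 \<Longrightarrow> w \<in> g2 \<Longrightarrow> g2_bracket v w
    \<in> g2"
  by (elim g2_of_cases) (simp add: g2_bracket_g2_of g2_of_in_g2)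

lemma subspace_g2: "subspace g2"
  by (rule subspaceI) (auto simp: g2_of_in_g2 g2_of_zero g2_of_add g2_of_scaleR elim!: g2_of_cases)

lemma g2_l_subset: "g2_l \<subseteq> g2" and g2_ev_subset: "g2_ev \<subseteq> g2"
  by (auto simp: g2_l_eq g2_ev_eq g2_of_in_g2)

lemma subspace_g2_l: "subspace g2_l"
  unfolding g2_l_eq by (rule subspaceI) (auto simp: g2_of_zero g2_of_add g2_of_scaleR g2_of_eq_iff)

lemma subspace_g2_ev: "subspace g2_ev"
  unfolding g2_ev_eq by (rule subspaceI) (auto simp: g2_of_zero g2_of_add g2_of_scaleR g2_of_eq_iff)

section \<open>Highest root, invariant form and exponentials of negative root vectors\<close>

lemma e_in_g2: "e_up 1 \<in> g2" "e_mix 1 3 \<in> g2" "e_mix 3 1 \<in> g2" "e_mix 3 2 \<in> g2"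
  by (simp_all add: e_up_1 e_mix_13 e_mix_31 e_mix_32 g2_of_in_g2)

text \<open>The positive root vectors in \<open>g2_l\<close> annihilate the highest root vector, and
  the diagonal part acts by the root, the difference of its first and third entries.\<close>

lemma g2_l_highest_root:
  "z \<in> g2_l \<Longrightarrow> g2_bracket z (e_mix 1 3) = (fst (snd z) $ 1 $ 1 - fst (snd z) $ 3
      $ 3) *\<^sub>R e_mix 1 3"
  by (auto simp: g2_l_eq e_mix_13 g2_bracket_g2_of g2_of_scaleR g2_of_eq_iff g2_of_sel)

text \<open>This is the Killing form, up to scaling, of the ideal of \<^const>\<open>g2_ev\<close> containing
  \<open>e\<^sub>3\<close>, extended by zero on its orthogonal complement.\<close>

definition g2_form :: "g2_vec \<Rightarrow> g2_vec \<Rightarrow> real" where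
  "g2_form u v = fst (snd u) $ 3 $ 3 * fst (snd v) $ 3 $ 3 +
     2 * (fst u $ 3 * snd (snd v) $ 3 + fst v $ 3 * snd (snd u) $ 3)"

text \<open>The projection onto the ideal containing e_3, along the complement where the third
  coordinates and the (3,3) entry vanish, commutes with ad of \<open>g2_ev\<close>. So this is
  invariance of the Killing form of the ideal. Up to the factor 2, the left side is the derivative
  of the quadratic form along the bracket.\<close>

lemma g2_form_invariant:
  assumes "z \<in> g2_ev" "w \<in> g2" shows "g2_form w (g2_bracket z w) = 0"
proof -
  obtain x1 x2 x3 a11 a12 a13 a21 a22 a23 a31 a32 k1 k2 k3 where w: "w = g2_of x1 x2 x3 a11 a12 a13
      a21 a22 a23 a31 a32 k1 k2 k3" using assms(2) by (rule g2_of_cases)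
  obtain y3 b11 b12 b21 b22 l3 where z: "z = g2_of 0 0 y3 b11 b12 0 b21 b22 0 0 0 0 0 l3"
    using assms(1) unfolding g2_ev_eq by blast
  show ?thesis by (simp add: g2_form_def w z g2_bracket_g2_of g2_of_sel algebra_simps)
qed

text \<open>The exponential series of ad \<open>u\<close> stopped after the cubic term, exact for
  the three vectors in \<open>g2_nilpotent\<close>. The cubic term is indispensable for e^1: its
  root string e_1^3, e^3, e_2, e_2^1 has four members.\<close>

definition g2_exp :: "g2_vec \<Rightarrow> g2_vec \<Rightarrow> g2_vec" where
  "g2_exp u v = v + g2_bracket u v + (1 / 2) *\<^sub>R g2_bracket u (g2_bracket u v) +
     (1 / 6) *\<^sub>R g2_bracket u (g2_bracket u (g2_bracket u v))"

lemma g2_nilpotent: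
  assumes "u \<in> {e_up 1, e_mix 3 1, e_mix 3 2}" "v \<in> g2"
  shows "g2_bracket u (g2_bracket u (g2_bracket u (g2_bracket u v))) = 0"
proof -
  obtain x1 x2 x3 a11 a12 a13 a21 a22 a23 a31 a32 k1 k2 k3 where v: "v = g2_of x1 x2 x3 a11 a12 a13
      a21 a22 a23 a31 a32 k1 k2 k3" using assms(2) by (rule g2_of_cases)
  show ?thesis
    using assms(1) by (auto simp: v e_up_1 e_mix_31 e_mix_32 g2_bracket_g2_of g2_of_eq_iff
        g2_of_zero)
qed

lemma g2_exp_up_1: "g2_exp (e_up 1) (g2_of x1 x2 x3 a11 a12 a13 a21 a22 a23 a31 a32 k1 k2 k3) =
    g2_of x1 (x2 - a13 - 2 * k3) (x3 + a12 + 2 * k2) (- 2 * x1 + a11) a12 a13 (- 3 * x2 + a13 + a21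
        + 3 * k3) (x1 + a22) a23 (- 3 * x3 - a12 + a31 - 3 * k2) a32 (- x1 + a11 + k1) (a12 + k2)
            (a13 + k3)"
  by (simp add: g2_exp_def e_up_1 g2_bracket_g2_of g2_of_scaleR g2_of_add g2_of_eq_iff)

lemma g2_exp_mix_31: "g2_exp (e_mix 3 1) (g2_of x1 x2 x3 a11 a12 a13 a21 a22 a23 a31 a32 k1 k2 k3) =
    g2_of x1 x2 (x1 + x3) (a11 - a13) a12 a13 (a21 - a23) a22 a23 (2 * a11 - a13 + a22 + a31) (a12
        + a32) (k1 - k3) k2 k3"
  by (simp add: g2_exp_def e_mix_31 g2_bracket_g2_of g2_of_scaleR g2_of_add g2_of_eq_iff)

lemma g2_exp_mix_32: "g2_exp (e_mix 3 2) (g2_of x1 x2 x3 a11 a12 a13 a21 a22 a23 a31 a32 k1 k2 k3) =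
    g2_of x1 x2 (x2 + x3) a11 (a12 - a13) a13 a21 (a22 - a23) a23 (a21 + a31) (a11 + 2 * a22 - a23
        + a32) k1 (k2 - k3) k3"
  by (simp add: g2_exp_def e_mix_32 g2_bracket_g2_of g2_of_scaleR g2_of_add g2_of_eq_iff)

lemma g2_ev_memI:
  "x1 = 0 \<Longrightarrow> x2 = 0 \<Longrightarrow> a13 = 0 \<Longrightarrow> a23 = 0
      \<Longrightarrow> a31 = 0 \<Longrightarrow> a32 = 0 \<Longrightarrow> k1 = 0
          \<Longrightarrow> k2 = 0 \<Longrightarrow>
    g2_of x1 x2 x3 a11 a12 a13 a21 a22 a23 a31 a32 k1 k2 k3 \<in> g2_ev"
  unfolding g2_ev_eq by blast

text \<open>Modulo \<open>g2_ev\<close> there are eight equations for the eight coordinates of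
  \<open>a\<close>. Their solvability for every \<open>y\<close> shows that the transformed copy of
  \<open>g2_l\<close> is a linear complement of \<open>g2_ev\<close>.\<close>

lemma g2_transversal_31:
  assumes "y \<in> g2"
  shows "\<exists>a\<in>g2_l. \<exists>b\<in>g2_ev. y = g2_exp (e_mix 3 1) (g2_exp (e_up 1) a) + b"
proof -
  obtain x1 x2 x3 a11 a12 a13 a21 a22 a23 a31 a32 k1 k2 k3 where y: "y = g2_of x1 x2 x3 a11 a12 a13
      a21 a22 a23 a31 a32 k1 k2 k3" using assms by (rule g2_of_cases)
  \<comment> \<open>obtained by solving for the eight coordinates that vanish on \<^const>\<open>g2_ev\<close>\<close>
  define a where "a = g2_of x1 0 0 (x1 - 1 / 2 * x2 + k1 + 1 / 2 * a13) a32 a13 0 (x1 + x2 - 2 * k1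
      + 3 * k2 + a31 - 2 * a32) a23 0 0 0 (k2 - a32) (- 1 / 2 * x2 - 1 / 2 * a13)"
  have "a \<in> g2_l" unfolding a_def g2_l_eq by blast
  moreover have "y - g2_exp (e_mix 3 1) (g2_exp (e_up 1) a) \<in> g2_ev"
    unfolding y a_def g2_exp_up_1 g2_exp_mix_31 g2_of_diff by (rule g2_ev_memI) simp_all
  ultimately show ?thesis by (metis add.commute diff_add_cancel)
qed

lemma g2_transversal_32:
  assumes "y \<in> g2"
  shows "\<exists>a\<in>g2_l. \<exists>b\<in>g2_ev. y = g2_exp (e_mix 3 2) (g2_exp (e_up 1) a) + b"
proof -
  obtain x1 x2 x3 a11 a12 a13 a21 a22 a23 a31 a32 k1 k2 k3 where y: "y = g2_of x1 x2 x3 a11 a12 a13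
      a21 a22 a23 a31 a32 k1 k2 k3" using assms by (rule g2_of_cases)
  \<comment> \<open>obtained by solving for the eight coordinates that vanish on \<^const>\<open>g2_ev\<close>\<close>
  define a where "a = g2_of x1 0 0 (x1 + k1) (3 / 2 * k2 + a13 + 1 / 2 * a31) a13 0 (- 1 / 2 * x1 -
      1 / 2 * k1 + 1 / 2 * a23 + 1 / 2 * a32) a23 0 0 0 (- 1 / 2 * x2 - 1 / 2 * k2 - 1 / 2 * a13 -
          1 / 2 * a31) (- 1 / 2 * x2 - 1 / 2 * a13)"
  have "a \<in> g2_l" unfolding a_def g2_l_eq by blast
  moreover have "y - g2_exp (e_mix 3 2) (g2_exp (e_up 1) a) \<in> g2_ev"
    unfolding y a_def g2_exp_up_1 g2_exp_mix_32 g2_of_diff by (rule g2_ev_memI) simp_all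
  ultimately show ?thesis by (metis add.commute diff_add_cancel)
qed

text \<open>The exponential of ad e^1 turns e_1^3 into e_1^3 + e^3 - e_2 + e_2^1, whose component in
  the ideal is the nilpotent e^3. Next, e_3^1 produces e_3^3 - e_1^1 out of e_1^3, which makes that
  component hyperbolic, whereas e_3^2 turns -e_2 into -e_2 - e_3, so that the component becomes the
  elliptic e^3 - e_3.\<close>

lemma g2_form_values:
  "g2_form (g2_exp (e_mix 3 1) (g2_exp (e_up 1) (e_mix 1 3))) (g2_exp (e_mix 3 1) (g2_exp (e_up 1)
      (e_mix 1 3))) = 1"
  "g2_form (g2_exp (e_mix 3 2) (g2_exp (e_up 1) (e_mix 1 3))) (g2_exp (e_mix 3 2) (g2_exp (e_up 1)
      (e_mix 1 3))) = - 4"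
  by (simp_all add: e_mix_13 g2_exp_up_1 g2_exp_mix_31 g2_exp_mix_32 g2_form_def g2_of_sel)

section \<open>Two open orbits\<close>

theorem corollary2:
  fixes G :: "('a, 'm) monoid_scheme"
    and X :: "'a topology" and A :: "('a, 'e::euclidean_space) chart set"
    and c :: "('a, 'e) chart" and \<theta> :: "g2_vec \<Rightarrow> 'e"
    and L :: "'a set" and XL :: "'a topology" and AL :: "('a, 'f::euclidean_space) chart set"
    and Gev :: "'a set" and Xev :: "'a topology" and Aev :: "('a, 'h::euclidean_space) chart set"
  assumes "lie_group G X A" and "simply_connected_space X"
    and "c \<in> A" and "\<one>\<^bsub>G\<^esub> \<in> chart_dom c" and "lie_algebra_iso g2 g2_bracket G c \<theta>"
    and "connected_lie_subgroup_with_algebra G X A c (\<theta> ` g2_l) L XL AL"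
    and "connected_lie_subgroup_with_algebra G X A c (\<theta> ` g2_ev) Gev Xev Aev"
  shows "\<exists>O1 O2. O1 \<in> orbits (G\<lparr>carrier := L\<rparr>) (lcosets\<^bsub>G\<^esub> Gev) (\<lambda>l C. l <#\<^bsub>G\<^esub> C) \<and>
                 O2 \<in> orbits (G\<lparr>carrier := L\<rparr>) (lcosets\<^bsub>G\<^esub> Gev) (\<lambda>l C. l <#\<^bsub>G\<^esub> C) \<and>
                 O1 \<noteq> O2 \<and>
                 openin (coset_topology G X Gev) O1 \<and> openin (coset_topology G X Gev) O2"
proof -
  interpret lie_group_chart G X A c
    using assms(1,3,4)
    by (intro lie_group_chart.intro lie_group_chart_axioms.intro) (simp_all add: lie_group_def)
  have lin: "linear \<theta>" and bij: "bij_betw \<theta> g2 UNIV"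
    and br: "\<And>u v. u \<in> g2 \<Longrightarrow> v \<in> g2 \<Longrightarrow> \<theta> (g2_bracket u v) = lie_bracket G c (\<theta> u) (\<theta> v)"
    using assms(5) unfolding lie_algebra_iso_def by blast+
  \<comment> \<open>\<open>\<theta>\<close> is injective only on \<open>g2\<close>, so its inverse
    is taken as a linear left inverse on \<open>g2\<close> with values in \<open>g2\<close>.\<close>
  obtain \<phi> where \<phi>: "range \<phi> \<subseteq> g2" "linear \<phi>" "\<And>v. v \<in> g2 \<Longrightarrow> \<phi> (\<theta> v) = v"
    using linear_exists_left_inverse_on[OF lin subspace_g2 bij_betw_imp_inj_on[OF bij]] by blast
  have \<phi>_g2: "\<phi> y \<in> g2" for y using \<phi>(1) by blast
  have \<theta>\<phi>: "\<theta> (\<phi> y) = y" for y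
  proof -
    have "y \<in> \<theta> ` g2" using bij_betw_imp_surj_on[OF bij] by simp
    then show ?thesis using \<phi>(3) by fastforce
  qed
  \<comment> \<open>The exponential of ad \<open>u\<close>, carried by \<open>\<theta>\<close> to
    the model space in which Ad acts.\<close>
  let ?N = "\<lambda>u y. \<theta> (g2_exp u (\<phi> y))"
  have exp_g2: "g2_exp u v \<in> g2" if "u \<in> g2" "v \<in> g2" for u v
    unfolding g2_exp_def
    by (intro subspace_add[OF subspace_g2] subspace_scale[OF subspace_g2] g2_bracket_in_g2 that)
  have limit: "Ad_limit (?N u)" if u: "u \<in> {e_up 1, e_mix 3 1, e_mix 3 2}" for u
  proof -
    have ug: "u \<in> g2" using u e_in_g2 by blast
    have D: "lie_bracket G c (\<theta> u) (\<theta> v) = \<theta> (g2_bracket u v)" if "v \<in> g2" for v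
      using br[OF ug that] by simp
    note gb = g2_bracket_in_g2[OF ug]
    have "lie_bracket G c (\<theta> u) (lie_bracket G c (\<theta> u) (lie_bracket G c (\<theta> u)
        (lie_bracket G c (\<theta> u) w))) = 0" for w
    proof -
      have "lie_bracket G c (\<theta> u) (lie_bracket G c (\<theta> u) (lie_bracket G c (\<theta> u)
        (lie_bracket G c (\<theta> u) (\<theta> (\<phi> w))))) = 0"
        by (simp add: D gb \<phi>_g2 g2_nilpotent[OF u] linear_0[OF lin] del: \<theta>\<phi>)
      then show ?thesis by (simp only: \<theta>\<phi>)
    qed
    from Ad_limit_exp_nilpotent[OF this]
    have "Ad_limit (\<lambda>w. w + lie_bracket G c (\<theta> u) w + (1 / 2) *\<^sub>R lie_bracket G c (\<theta> u) (lie_bracket G c (\<theta> u) w)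
      + (1 / 6) *\<^sub>R lie_bracket G c (\<theta> u) (lie_bracket G c (\<theta> u) (lie_bracket G c (\<theta> u) w)))" .
    also have "(\<lambda>w. w + lie_bracket G c (\<theta> u) w + (1 / 2) *\<^sub>R lie_bracket G c (\<theta> u) (lie_bracket G c (\<theta> u) w)
      + (1 / 6) *\<^sub>R lie_bracket G c (\<theta> u) (lie_bracket G c (\<theta> u) (lie_bracket G c (\<theta> u) w))) = ?N u"
    proof
      fix w
      have "\<theta> (\<phi> w) + lie_bracket G c (\<theta> u) (\<theta> (\<phi> w))
          + (1 / 2) *\<^sub>R lie_bracket G c (\<theta> u) (lie_bracket G c (\<theta> u) (\<theta> (\<phi> w)))
          + (1 / 6) *\<^sub>R lie_bracket G c (\<theta> u) (lie_bracket G c (\<theta> u) (lie_bracket G c (\<theta> u) (\<theta> (\<phi> w)))) = ?N u w"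
        unfolding g2_exp_def linear_add[OF lin] linear_cmul[OF lin] by (simp only: D gb \<phi>_g2)
      then show "w + lie_bracket G c (\<theta> u) w + (1 / 2) *\<^sub>R lie_bracket G c (\<theta> u) (lie_bracket G c (\<theta> u) w)
        + (1 / 6) *\<^sub>R lie_bracket G c (\<theta> u) (lie_bracket G c (\<theta> u) (lie_bracket G c (\<theta> u) w)) = ?N u w"
        by (simp only: \<theta>\<phi>)
    qed
    finally show ?thesis .
  qed
  let ?M = "\<lambda>u y. ?N u (?N (e_up 1) y)"
  have M: "Ad_limit (?M u)" if "u \<in> {e_up 1, e_mix 3 1, e_mix 3 2}" for u
    by (rule Ad_limit_compose[OF limit[OF that] limit]) simp
  have M_\<theta>: "?M u (\<theta> v) = \<theta> (g2_exp u (g2_exp (e_up 1) v))" if "v \<in> g2" for u v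
    using that by (simp add: \<phi>(3) exp_g2 e_in_g2)
  have trans: "\<exists>a\<in>\<theta> ` g2_l. \<exists>b\<in>\<theta> ` g2_ev. y = ?M u a + b"
    if "\<And>y. y \<in> g2 \<Longrightarrow> \<exists>a\<in>g2_l. \<exists>b\<in>g2_ev. y = g2_exp u (g2_exp (e_up 1) a) + b" for u y
  proof -
    obtain a b where ab: "a \<in> g2_l" "b \<in> g2_ev" "\<phi> y = g2_exp u (g2_exp (e_up 1) a) + b"
      using \<open>\<And>y. y \<in> g2 \<Longrightarrow> \<exists>a\<in>g2_l. \<exists>b\<in>g2_ev. y = g2_exp u (g2_exp (e_up 1) a) + b\<close>[OF \<phi>_g2] by blast
    have "\<theta> (\<phi> y) = ?M u (\<theta> a) + \<theta> b"
      unfolding ab(3) linear_add[OF lin] M_\<theta>[OF subsetD[OF g2_l_subset ab(1)]] ..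
    then have "y = ?M u (\<theta> a) + \<theta> b" by (simp only: \<theta>\<phi>)
    then show ?thesis using ab(1,2) by blast
  qed
  \<comment> \<open>The quadratic form transported to the model space, with its derivative by
    polarization of the symmetric \<open>g2_form\<close>.\<close>
  let ?Q = "\<lambda>w. g2_form (\<phi> w) (\<phi> w)" and ?Q' = "\<lambda>w u. 2 * g2_form (\<phi> w) (\<phi> u)"
  have bl: "bounded_linear \<phi>" using \<phi>(2) linear_conv_bounded_linear by blast
  have comp: "bounded_linear (\<lambda>w. fst (snd (\<phi> w)) $ 3 $ 3)" "bounded_linear (\<lambda>w. fst (\<phi> w) $ 3)"
    "bounded_linear (\<lambda>w. snd (snd (\<phi> w)) $ 3)"
    by (intro bounded_linear_compose[OF bounded_linear_vec_nth] bounded_linear_compose[OF bounded_linear_fst]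
        bounded_linear_compose[OF bounded_linear_snd] bl)+
  have Q: "(?Q has_derivative ?Q' w) (at w)" for w
  proof -
    note d = comp[THEN bounded_linear_imp_has_derivative, of "at w"]
    have "((\<lambda>w. fst (snd (\<phi> w)) $ 3 $ 3 * fst (snd (\<phi> w)) $ 3 $ 3 +
        4 * (fst (\<phi> w) $ 3 * snd (snd (\<phi> w)) $ 3)) has_derivative
      (\<lambda>u. fst (snd (\<phi> w)) $ 3 $ 3 * fst (snd (\<phi> u)) $ 3 $ 3 + fst (snd (\<phi> u)) $ 3 $ 3 * fst (snd (\<phi> w)) $ 3 $ 3 +
        4 * (fst (\<phi> w) $ 3 * snd (snd (\<phi> u)) $ 3 + fst (\<phi> u) $ 3 * snd (snd (\<phi> w)) $ 3))) (at w)"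
      by (intro has_derivative_add has_derivative_mult has_derivative_mult_right d)
    then show ?thesis by (simp add: g2_form_def algebra_simps)
  qed
  have Qinv: "?Q' w (lie_bracket G c z w) = 0" if "z \<in> \<theta> ` g2_ev" for z w
  proof -
    obtain z' where z': "z' \<in> g2_ev" "z = \<theta> z'" using \<open>z \<in> \<theta> ` g2_ev\<close> by blast
    have zg: "z' \<in> g2" using z'(1) g2_ev_subset by blast
    have "lie_bracket G c z (\<theta> (\<phi> w)) = \<theta> (g2_bracket z' (\<phi> w))" unfolding z'(2) by (rule br[OF zg \<phi>_g2, symmetric])
    then have "\<phi> (lie_bracket G c z w) = g2_bracket z' (\<phi> w)"
      by (simp only: \<theta>\<phi> \<phi>(3)[OF g2_bracket_in_g2[OF zg \<phi>_g2]])
    then show ?thesis by (simp add: g2_form_invariant[OF z'(1) \<phi>_g2])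
  qed
  have hom: "?Q (r *\<^sub>R w) = r\<^sup>2 * ?Q w" for r w
    by (simp add: linear_cmul[OF \<phi>(2)] g2_form_def power2_eq_square algebra_simps)
  let ?v = "\<theta> (e_mix 1 3)"
  have Qv: "?Q (?M u ?v) = g2_form (g2_exp u (g2_exp (e_up 1) (e_mix 1 3))) (g2_exp u (g2_exp (e_up 1) (e_mix 1 3)))"
    if "u \<in> g2" for u
    by (simp only: M_\<theta>[OF e_in_g2(2)] \<phi>(3) exp_g2 that e_in_g2)
  have v0: "?v \<noteq> 0"
  proof
    assume "?v = 0"
    then have "e_mix 1 3 = 0" using \<phi>(3)[OF e_in_g2(2)] linear_0[OF \<phi>(2)] by simp
    then show False by (simp add: e_mix_13 g2_of_zero g2_of_eq_iff)
  qed
  have eig: "lie_bracket G c z ?v = (fst (snd (\<phi> z)) $ 1 $ 1 - fst (snd (\<phi> z)) $ 3 $ 3) *\<^sub>R ?v"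
    if "z \<in> \<theta> ` g2_l" for z
  proof -
    obtain z' where z': "z' \<in> g2_l" "z = \<theta> z'" using \<open>z \<in> \<theta> ` g2_l\<close> by blast
    have zg: "z' \<in> g2" using z'(1) g2_l_subset by blast
    show ?thesis
      unfolding z'(2) br[OF zg e_in_g2(2), symmetric] g2_l_highest_root[OF z'(1)] \<phi>(3)[OF zg]
        linear_cmul[OF lin] ..
  qed
  show ?thesis
  proof (rule two_open_orbits[OF assms(6,7) _ _ v0 eig Q Qinv hom])
    show "subspace (\<theta> ` g2_l)" "subspace (\<theta> ` g2_ev)"
      by (rule linear_subspace_image[OF lin subspace_g2_l], rule linear_subspace_image[OF lin subspace_g2_ev])
    show "Ad_limit (?M (e_mix 3 1))" "Ad_limit (?M (e_mix 3 2))" by (rule M; simp)+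
    show "\<exists>a\<in>\<theta> ` g2_l. \<exists>b\<in>\<theta> ` g2_ev. y = ?M (e_mix 3 1) a + b" for y
      by (rule trans[OF g2_transversal_31])
    show "\<exists>a\<in>\<theta> ` g2_l. \<exists>b\<in>\<theta> ` g2_ev. y = ?M (e_mix 3 2) a + b" for y
      by (rule trans[OF g2_transversal_32])
    show "?Q (?M (e_mix 3 1) ?v) > 0" "?Q (?M (e_mix 3 2) ?v) < 0"
      unfolding Qv[OF e_in_g2(3)] Qv[OF e_in_g2(4)] g2_form_values by simp_all
  qed
qed

end
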